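(* Let $p$ be a prime, let $m,d\geq 1$ be integers, and let $a,r$ be integers with $0\le a<d$ and $0\le r<m$. Then there exist constants $\delta^{(1)}_{p,m}>0$ and $\delta^{(2)}_{p,m}>0$ (depending only on $p$ and $m$) such that, for $x\ge 2$, \[ \#\{ 0\le n<x : n\equiv a \bmod d,\ e_p(n^2!) \equiv r \bmod m\} = \frac{x}{dm} + O\!\left((\log x)^{11/4}\, x^{1-\delta^{(1)}_{p,m}}\right), \] and \[ \#\{ q<x : q \text{ prime},\ q\equiv a \bmod d,\ e_p(q!) \equiv r \bmod m\} = \frac{\pi(x;a,d)}{m} + O\!\left( (\log x)^3\, x^{1-\delta^{(2)}_{p,m}}\right). \] The implied constants depend only on $p$.
   Context: For a prime $p$ and a positive integer $N$, $e_p(N!)$ denotes the exponent of $p$ in the prime factorization of $N!$ (equivalently, by Legendre's formula, $e_p(N!)=\sum_{i\ge1}\lfloor N/p^i\rfloor=(N-s_p(N))/(p-1)$, where $s_p(N)$ is the sum of the base-$p$ digits of $N$). $\pi(x;a,d)$ denotes the number of primes $q\le x$ with $q\equiv a \bmod d$. *)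

theory Defs
  imports Complex_Main "HOL-Number_Theory.Number_Theory"
begin

definition fact_exponent :: "nat \<Rightarrow> nat \<Rightarrow> nat" where
  "fact_exponent p N = multiplicity p (fact N :: nat)"

definition primes_ap_pi :: "real \<Rightarrow> nat \<Rightarrow> nat \<Rightarrow> nat" where
  "primes_ap_pi x a d = card {q::nat. prime q \<and> real q \<le> x \<and> [q = a] (mod d)}"

end

theory Submission
  imports Defs "HOL-Number_Theory.Prime_Powers" "HOL-Computational_Algebra.Squarefree"
begin

text \<open>
  Write \<open>f n = \<omega> ^ e\<close> with \<open>e\<close> the exponent of \<open>p\<close> in \<open>n!\<close> and \<open>\<omega> \<noteq> 1\<close> a root of unity. Legendre's
  formula makes \<open>f\<close> a product over base-\<open>p\<close> digits, up to linear phases. By orthogonality of characters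
  it suffices to save a power of \<open>x\<close> in the sums of \<open>f (n\<^sup>2) \<chi>^n\<close> over \<open>n < x\<close> and of \<open>f q \<chi>^q\<close> over primes
  \<open>q < x\<close>, uniformly in the unimodular number \<open>\<chi>\<close>.

  As in the work of Mauduit and Rivat, the Cauchy-Schwarz inequality is applied twice, with a shift
  by a small \<open>r\<close> (the high digits cancel, up to rare carries) and a shift by multiples of a large power
  of \<open>p\<close> (the low digits cancel). What remains is a short window of digits. No Fourier analysis of
  the window is needed: rotations by a typical number equidistribute the window and the increment
  \<open>n\<close> jointly, up to a constant factor, so that the second moment becomes a complete sum over residues
  modulo \<open>p^W\<close>, in which different multiples \<open>j\<close> decouple. This leaves autocorrelations
  \<open>\<Sum>y. f y * cnj (f (y+t))\<close>, which obey a recursion in the digits of \<open>t\<close> and lose a constant factor at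
  every occurrence of the digit block 1, 0, 0 in \<open>t\<close>.

  For primes this gives bilinear sums \<open>\<Sum>m n. a m * b n * f (m*n)\<close> as soon as both variables exceed an
  arbitrarily small power of \<open>x\<close>. The von Mangoldt function, restricted to arguments above \<open>V\<close>, is the Dirichlet
  convolution of the Moebius function with a function bounded by the logarithm; splitting at \<open>V\<close> a
  small power of \<open>x\<close>, the part with large Moebius variable is bilinear and the rest is handled
  by the trivial product formula for linear exponential sums of \<open>f\<close>.
\<close>

section \<open>Sums over residues\<close>

text \<open>All sizes are powers of z = p^k with k left free. Losses are fixed powers of z, gains
  are exponential in k, so exponents such as 15, 105 or 400 only have to be large enough in the
  right order; k is taken proportional to ln X at the very end, in \<open>power_saving\<close>. The
  gain stems from \<omega> \<noteq> 1, and each Cauchy-Schwarz halves its exponent. The obstacle is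
  that the window digits of m*n and n^2 are not exactly equidistributed on the short ranges
  available. So the quantity to be averaged is first majorised by a nonnegative function of two
  residues; for such a function an upper bound of the correct order for each pair of residues
  suffices, and rotations too close to a fraction with small denominator may be counted trivially,
  being rare. The bounds hold for every unimodular \<chi> at once. This keeps d and a out of the
  constants: the d additive characters are averaged, not added up. The modulus m enters only through
  the finitely many values \<omega> = cis (2*pi*l/m), and its influence on the constant is finally
  moved into the exponent.\<close>

lemma sum_lessThan_mult:
  fixes g :: "nat \<Rightarrow> 'a::comm_monoid_add"
  shows "(\<Sum>y<b*a. g y) = (\<Sum>k<b. \<Sum>e<a. g (k*a+e))"
proof -
  have "(\<Sum>y<b*a. g y) = (\<Sum>m<b. sum g {m*a..<m*a+a})"
    by (rule sum.nat_group[symmetric])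
  also have "\<dots> = (\<Sum>k<b. \<Sum>e<a. g (k*a+e))"
  proof (rule sum.cong[OF refl])
    fix k
    show "sum g {k*a..<k*a+a} = (\<Sum>e<a. g (k*a+e))"
      using sum.shift_bounds_nat_ivl[of g 0 "k*a" a] by (simp add: lessThan_atLeast0 add.commute)
  qed
  finally show ?thesis .
qed

lemma sum_periodic_shift:
  fixes \<phi> :: "nat \<Rightarrow> 'a::ab_group_add"
  assumes per: "\<And>n. \<phi> (n mod T) = \<phi> n"
  shows "(\<Sum>n<T. \<phi> (y+n)) = (\<Sum>n<T. \<phi> n)"
proof (induction y)
  case (Suc y)
  have "(\<Sum>n<T. \<phi> (Suc y+n)) = (\<Sum>n<T. \<phi> (y+Suc n))" by simp
  also have "\<dots> = (\<Sum>n<Suc T. \<phi> (y+n)) - \<phi> y"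
    by (subst sum.lessThan_Suc_shift) simp
  also have "\<dots> = (\<Sum>n<T. \<phi> (y+n))"
    using per[of "y+T"] per[of y] by simp
  finally show ?case using Suc by simp
qed simp

lemma periodic_cong:
  assumes "\<And>n::nat. \<phi> (n mod T) = \<phi> n" "[a = b] (mod T)"
  shows "\<phi> a = \<phi> b"
  using assms unfolding cong_def by metis

text \<open>Translating n by \<open>u*i\<close> permutes the residues modulo T and adds g*i to d*n.
  With g = p^e this puts an average over a whole class modulo p^e inside a sum along the multiples
  of d.\<close>

lemma sum_periodic_dilate_shift:
  fixes \<phi> :: "nat \<Rightarrow> 'a::ab_group_add"
  assumes per: "\<And>n. \<phi> (n mod T) = \<phi> n" and du: "[d*u = g] (mod T)"
  shows "(\<Sum>n<T. \<phi> (y+d*n)) = (\<Sum>n<T. \<phi> (y+d*n+g*i))"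
proof -
  have "(\<Sum>n<T. \<phi> (y+d*n)) = (\<Sum>n<T. \<phi> (y+d*(u*i+n)))"
  proof (rule sum_periodic_shift[symmetric, of "\<lambda>n. \<phi> (y+d*n)"])
    fix n
    have "[y+d*(n mod T) = y+d*n] (mod T)"
      by (intro cong_add cong_mult) auto
    thus "\<phi> (y+d*(n mod T)) = \<phi> (y+d*n)" by (rule periodic_cong[of \<phi> T, OF per])
  qed
  also have "\<dots> = (\<Sum>n<T. \<phi> (y+d*n+g*i))"
  proof (rule sum.cong[OF refl])
    fix n
    have "[y+d*n+d*u*i = y+d*n+g*i] (mod T)"
      using du by (intro cong_add cong_mult) auto
    moreover have "y+d*(u*i+n) = y+d*n+d*u*i" by (simp add: algebra_simps)
    ultimately show "\<phi> (y+d*(u*i+n)) = \<phi> (y+d*n+g*i)"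
      using periodic_cong[of \<phi> T, OF per] by metis
  qed
  finally show ?thesis .
qed

lemma card_cong_lessThan:
  assumes "b > 0" "x < b"
  shows "card {j. j < m*b \<and> j mod b = x} = m"
proof -
  have "{j. j < m*b \<and> j mod b = x} = (\<lambda>i. i*b+x) ` {..<m}"
  proof (intro subset_antisym subsetI)
    fix j assume "j \<in> {j. j < m*b \<and> j mod b = x}"
    hence "j div b < m" "j = (j div b)*b+x" using assms
      by (auto simp: less_mult_imp_div_less)
    thus "j \<in> (\<lambda>i. i*b+x) ` {..<m}" by blast
  next
    fix j assume "j \<in> (\<lambda>i. i*b+x) ` {..<m}"
    then obtain i where i: "i < m" "j = i*b+x" by auto
    have "j < (i+1)*b" using i assms by simp
    also have "\<dots> \<le> m*b" using i by (intro mult_right_mono) auto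
    finally show "j \<in> {j. j < m*b \<and> j mod b = x}" using i assms by simp
  qed
  moreover have "inj_on (\<lambda>i. i*b+x) {..<m}" using assms by (auto simp: inj_on_def)
  ultimately show ?thesis by (simp add: card_image)
qed

text \<open>The gcd of d and p^W is p^v with v \<le> e; Bezout reaches p^v, and multiplication by
  p^(e-v) gives p^e. Aiming at p^e rather than at the gcd lets one e serve all admissible d.\<close>

lemma prime_power_dilation_solvable:
  fixes p d e W :: nat
  assumes p: "prime p" and nd: "\<not> p^(e+1) dvd d"
  shows "\<exists>u. [d*u = p^e] (mod p^W)"
proof -
  have "gcd d (p^W) dvd p^W" by simp
  then obtain v where v: "gcd d (p^W) = p^v" "v \<le> W"
    using divides_primepow_nat[OF p] by blast
  have "p^v dvd d" using v(1) by (metis gcd_dvd1)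
  hence "v \<le> e" using nd by (metis Suc_eq_plus1 dvd_trans le_imp_power_dvd not_less_eq_eq)
  have d0: "d \<noteq> 0" using nd by (intro notI) simp
  then obtain x y where xy: "d*x = p^W*y + gcd d (p^W)"
    using bezout_nat[of d "p^W"] by blast
  have "[d*x = p^v] (mod p^W)" unfolding xy v(1) by (simp add: cong_def)
  hence "[d*x*p^(e-v) = p^v*p^(e-v)] (mod p^W)" by (rule cong_mult) simp
  moreover have "p^v*p^(e-v) = p^e" using \<open>v \<le> e\<close> by (simp flip: power_add)
  ultimately show ?thesis by (metis mult.assoc)
qed

section \<open>The exponent of a prime in a factorial\<close>

lemma fact_exponent_0 [simp]: "fact_exponent p 0 = 0"
  by (simp add: fact_exponent_def)

text \<open>Legendre's formula as a recursion: the multiples of p up to n are p times 1, ..., n div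
  p. In this form it removes one base-p digit at a time.\<close>

lemma fact_exponent_rec:
  assumes "prime p"
  shows "fact_exponent p n = n div p + fact_exponent p (n div p)"
proof (induction n)
  case (Suc n)
  have step: "fact_exponent p (Suc k) = multiplicity p (Suc k) + fact_exponent p k" for k
    using assms by (simp add: fact_exponent_def prime_elem_multiplicity_mult_distrib del: mult_Suc)
  show ?case
  proof (cases "p dvd Suc n")
    case True
    then obtain k where k: "Suc n = p * k" by blast
    then obtain j where j: "k = Suc j" by (cases k) auto
    have p0: "p > 1" using assms prime_gt_1_nat by blast
    have "n = p * j + (p-1)" using k j p0 by simp
    moreover have "(p * j + (p-1)) div p = j" using p0 by (subst div_mult_self4) auto
    ultimately have "n div p = j" by metis
    moreover have "Suc n div p = k" using k p0 by simp
    moreover have "multiplicity p (Suc n) = Suc (multiplicity p k)"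
      unfolding k using assms j p0 by (subst multiplicity_times_same) auto
    ultimately show ?thesis using Suc step[of n] step[of j] j by simp
  next
    case False
    hence "multiplicity p (Suc n) = 0" by (rule not_dvd_imp_multiplicity_0)
    moreover have "Suc n div p = n div p" using False by (simp add: div_Suc dvd_eq_mod_eq_0)
    ultimately show ?thesis using Suc step[of n] by simp
  qed
qed simp

section \<open>Autocorrelations of the digital function\<close>

locale digital_phase =
  fixes p :: nat and \<omega> :: complex
  assumes prime_p: "prime p" and norm_\<omega>: "norm \<omega> = 1" and \<omega>_neq_1: "\<omega> \<noteq> 1"
begin

definition f :: "nat \<Rightarrow> complex" where "f n = \<omega> ^ fact_exponent p n"

text \<open>This is (p^K - 1)/(p - 1), the exponent of p in (p^K)!. It is the frequency of the
  linear phase that K removed digits leave on the higher ones.\<close>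

definition repunit :: "nat \<Rightarrow> nat" where "repunit K = (\<Sum>i<K. p^i)"

text \<open>The linear phase is unavoidable: removing the last digit turns \<zeta> into
  \<zeta>^p*\<omega>, so only the family of all twists is closed under the digit recursion.\<close>

definition twist :: "complex \<Rightarrow> nat \<Rightarrow> complex" where "twist \<zeta> n = \<zeta>^n * f n"

text \<open>The shift is cyclic: a carry out of the top digit is discarded, which makes the
  recursion in \<open>autocorr_rec\<close> exact.\<close>

definition autocorr :: "complex \<Rightarrow> nat \<Rightarrow> nat \<Rightarrow> complex" where
  "autocorr \<zeta> W t = (\<Sum>y<p^W. twist \<zeta> y * cnj (twist \<zeta> ((y+t) mod p^W)))"

lemma p_ge_2: "p \<ge> 2" using prime_p prime_ge_2_nat by blast
lemma p_pos [simp]: "p > 0" using p_ge_2 by simp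
lemma p_neq_0 [simp]: "p \<noteq> 0" using p_pos by blast

lemma norm_f [simp]: "norm (f n) = 1" by (simp add: f_def norm_power norm_\<omega>)

lemma norm_twist [simp]: "norm \<zeta> = 1 \<Longrightarrow> norm (twist \<zeta> n) = 1"
  by (simp add: twist_def norm_mult norm_power)

lemma f_0 [simp]: "f 0 = 1" by (simp add: f_def)

lemma f_rec: "f n = \<omega>^(n div p) * f (n div p)"
  unfolding f_def by (subst fact_exponent_rec[OF prime_p]) (simp add: power_add)

lemma f_digit: "e < p \<Longrightarrow> f (k*p+e) = \<omega>^k * f k"
  by (subst f_rec) simp

text \<open>For i \<le> K the quotient of u + p^K*k by p^i is u div p^i + p^(K-i)*k. So by
  Legendre's formula the low digits and k interact only through the sum of the terms p^(K-i)*k,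
  which is \<open>repunit K * k\<close>.\<close>

lemma f_split: "u < p^K \<Longrightarrow> f (u + p^K*k) = f u * (\<omega>^repunit K)^k * f k"
proof (induction K arbitrary: u)
  case 0 thus ?case by (simp add: repunit_def)
next
  case (Suc K)
  define u' where "u' = u div p"
  have u': "u' < p^K" using Suc.prems by (simp add: u'_def less_mult_imp_div_less mult.commute)
  have "(u + p^Suc K*k) div p = u' + p^K*k"
    by (simp add: u'_def mult.assoc div_mult_self3)
  hence "f (u + p^Suc K*k) = \<omega>^(u' + p^K*k) * f (u' + p^K*k)" by (subst f_rec) simp
  also have "\<dots> = (\<omega>^u' * f u') * (\<omega>^(p^K*k) * (\<omega>^repunit K)^k) * f k"
    by (subst Suc.IH[OF u']) (simp add: power_add)
  also have "\<omega>^u' * f u' = f u" by (subst (2) f_rec) (simp add: u'_def)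
  also have "\<omega>^(p^K*k) * (\<omega>^repunit K)^k = (\<omega>^repunit (Suc K))^k"
    by (simp add: repunit_def power_add power_mult power_mult_distrib)
  finally show ?case .
qed

lemma f_split_mod: "f y = f (y mod p^K) * (\<omega>^repunit K)^(y div p^K) * f (y div p^K)"
  using f_split[of "y mod p^K" K "y div p^K"] by simp

lemma norm_repunit_root [simp]: "norm (\<omega>^repunit K) = 1" by (simp add: norm_power norm_\<omega>)

lemma twist_digit: "e < p \<Longrightarrow> twist \<zeta> (k*p+e) = \<zeta>^e * twist (\<zeta>^p*\<omega>) k"
  by (simp add: twist_def f_digit power_add power_mult_distrib flip: power_mult)
     (simp add: mult.commute)

text \<open>Adding t0 to the last digit e of y carries exactly when e \<ge> p-t0. Without a carry
  the remaining shift is t1, with one it is t1+1, and in either case the phase does not depend on e.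
  The value t0 = p is allowed so that t+1 can be treated with the same t1 as t.\<close>

lemma autocorr_rec:
  assumes \<zeta>: "norm \<zeta> = 1" and t0: "t0 \<le> p"
  shows "autocorr \<zeta> (Suc W) (t1*p+t0) =
     of_nat (p-t0) * cnj \<zeta>^t0 * autocorr (\<zeta>^p*\<omega>) W t1 + of_nat t0 * \<zeta>^(p-t0) * autocorr (\<zeta>^p*\<omega>) W (t1+1)"
proof -
  define \<zeta>' where "\<zeta>' = \<zeta>^p*\<omega>"
  have zz: "\<zeta> * cnj \<zeta> = 1" using \<zeta> by (simp add: complex_norm_square[symmetric])
  have zzk: "\<zeta>^e * cnj \<zeta>^e = 1" for e by (metis zz power_mult_distrib power_one)
  define a where "a k = twist \<zeta>' k * cnj (twist \<zeta>' ((k+t1) mod p^W))" for k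
  define b where "b k = twist \<zeta>' k * cnj (twist \<zeta>' ((k+(t1+1)) mod p^W))" for k
  have A: "twist \<zeta> (k*p+e) * cnj (twist \<zeta> ((k*p+e+(t1*p+t0)) mod p^Suc W))
     = (if e < p-t0 then cnj \<zeta>^t0 * a k else \<zeta>^(p-t0) * b k)" if "e < p" for k e
  proof (cases "e < p-t0")
    case True
    have "(k*p+e+(t1*p+t0)) mod p^Suc W = ((k+t1)*p+(e+t0)) mod (p*p^W)"
      by (simp add: algebra_simps)
    also have "\<dots> = p * (((k+t1)*p+(e+t0)) div p mod p^W) + ((k+t1)*p+(e+t0)) mod p"
      by (rule mod_mult2_eq)
    also have "\<dots> = ((k+t1) mod p^W)*p + (e+t0)"
      using True by (simp add: mult.commute)
    finally have "twist \<zeta> ((k*p+e+(t1*p+t0)) mod p^Suc W) = \<zeta>^(e+t0) * twist \<zeta>' ((k+t1) mod p^W)"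
      using twist_digit[of "e+t0" \<zeta>] True by (simp add: \<zeta>'_def)
    thus ?thesis using True that twist_digit[of e \<zeta> k] zzk[of e]
      by (simp add: a_def \<zeta>'_def power_add algebra_simps)
  next
    case False
    have e': "e+t0-p < p" "e + t0 = p + (e+t0-p)" using False that t0 by auto
    have "(k*p+e+(t1*p+t0)) mod p^Suc W = ((k+(t1+1))*p+(e+t0-p)) mod (p*p^W)"
      using e'(2) by (simp add: algebra_simps)
    also have "\<dots> = p * (((k+(t1+1))*p+(e+t0-p)) div p mod p^W) + ((k+(t1+1))*p+(e+t0-p)) mod p"
      by (rule mod_mult2_eq)
    also have "\<dots> = ((k+(t1+1)) mod p^W)*p + (e+t0-p)"
    proof -
      have "(K*p+x) div p = K" "(K*p+x) mod p = x" if "x < p" for K x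
        using that by simp_all
      from this[OF e'(1), of "k+(t1+1)"] show ?thesis by (simp only: mult.commute)
    qed
    finally have "twist \<zeta> ((k*p+e+(t1*p+t0)) mod p^Suc W) = \<zeta>^(e+t0-p) * twist \<zeta>' ((k+(t1+1)) mod p^W)"
      using twist_digit[of "e+t0-p" \<zeta>] e' by (simp add: \<zeta>'_def)
    moreover have "\<zeta>^e * cnj \<zeta>^(e+t0-p) = \<zeta>^(p-t0)"
    proof -
      have "e = (p-t0) + (e+t0-p)" using False that t0 by simp
      hence "\<zeta>^e = \<zeta>^(p-t0) * \<zeta>^(e+t0-p)" by (metis power_add)
      thus ?thesis using zzk[of "e+t0-p"] by (simp add: mult.assoc)
    qed
    ultimately show ?thesis using False that twist_digit[of e \<zeta> k]
      by (simp add: b_def \<zeta>'_def algebra_simps)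
  qed
  have inner: "(\<Sum>e<p. twist \<zeta> (k*p+e) * cnj (twist \<zeta> ((k*p+e+(t1*p+t0)) mod p^Suc W)))
     = of_nat (p-t0) * cnj \<zeta>^t0 * a k + of_nat t0 * \<zeta>^(p-t0) * b k" for k
  proof -
    have "(\<Sum>e<p. twist \<zeta> (k*p+e) * cnj (twist \<zeta> ((k*p+e+(t1*p+t0)) mod p^Suc W)))
       = (\<Sum>e<p. if e < p-t0 then cnj \<zeta>^t0 * a k else \<zeta>^(p-t0) * b k)"
      by (rule sum.cong) (use A in auto)
    also have "\<dots> = (\<Sum>e\<in>{..<p} \<inter> {e. e < p-t0}. cnj \<zeta>^t0 * a k)
        + (\<Sum>e\<in>{..<p} \<inter> - {e. e < p-t0}. \<zeta>^(p-t0) * b k)"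
      by (rule sum.If_cases) simp
    also have "{..<p} \<inter> {e. e < p-t0} = {..<p-t0}" by auto
    also have "{..<p} \<inter> - {e. e < p-t0} = {p-t0..<p}" by auto
    finally show ?thesis using t0 by (simp add: mult.assoc)
  qed
  have "autocorr \<zeta> (Suc W) (t1*p+t0) =
     (\<Sum>k<p^W. \<Sum>e<p. twist \<zeta> (k*p+e) * cnj (twist \<zeta> ((k*p+e+(t1*p+t0)) mod p^Suc W)))"
    unfolding autocorr_def using sum_lessThan_mult[of _ "p^W" p]
    by (simp add: mult.commute[of p "p^W"])
  also have "\<dots> = of_nat (p-t0) * cnj \<zeta>^t0 * (\<Sum>k<p^W. a k) + of_nat t0 * \<zeta>^(p-t0) * (\<Sum>k<p^W. b k)"
    by (simp only: inner sum.distrib sum_distrib_left)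
  finally show ?thesis by (simp add: autocorr_def a_def b_def \<zeta>'_def)
qed

text \<open>The loss in the triangle inequality for two terms whose phases differ by \<omega>. This
  is the only source of cancellation in the autocorrelations.\<close>

definition gap :: real where "gap = 2 - norm (1+\<omega>)"

lemma gap_pos: "gap > 0"
proof -
  have "norm (1+\<omega>) ^ 2 = 2 + 2 * Re \<omega>"
  proof -
    have "(Re \<omega>)^2 + (Im \<omega>)^2 = 1" using norm_\<omega> by (simp add: cmod_def)
    moreover have "norm (1+\<omega>) ^ 2 = (1 + Re \<omega>)^2 + (Im \<omega>)^2" by (simp add: cmod_power2)
    ultimately show ?thesis by (simp add: power2_eq_square algebra_simps)
  qed
  moreover have "Re \<omega> < 1"
  proof (rule ccontr)
    assume "\<not> Re \<omega> < 1"
    moreover have "(Re \<omega>)^2 + (Im \<omega>)^2 = 1" using norm_\<omega> by (simp add: cmod_def)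
    moreover have "Re \<omega> \<le> 1" using complex_Re_le_cmod[of \<omega>] norm_\<omega> by simp
    ultimately have "Re \<omega> = 1" "Im \<omega> = 0" by auto
    thus False using \<omega>_neq_1 by (simp add: complex_eq_iff)
  qed
  ultimately have "norm (1+\<omega>) ^ 2 < 2^2" by simp
  hence "norm (1+\<omega>) < 2" by (rule power2_less_imp_less) simp
  thus ?thesis by (simp add: gap_def)
qed

lemma gap_le_2: "gap \<le> 2" by (simp add: gap_def)

text \<open>Upper bound for the autocorrelation at \<^term>\<open>t\<close>: every block of three digits 1, 0, 0 of \<^term>\<open>t\<close>
  forces two carry paths ending in the same state with phases differing by \<^term>\<open>\<omega>\<close>.\<close>

fun weight :: "nat \<Rightarrow> nat \<Rightarrow> real" where
  "weight 0 t = 1"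
| "weight (Suc k) t = (if t mod p^3 = 1 then 1 - gap / p^3 else 1) * weight k (t div p^3)"

text \<open>The pair t, t+1 is carried along as a whole: removing a digit from either of them leads
  to t div p or t div p + 1, so the pair is closed under the recursion.\<close>

lemma norm_autocorr_step:
  assumes \<zeta>: "norm \<zeta> = 1"
    and bd: "\<And>\<zeta>. norm \<zeta> = 1 \<Longrightarrow> norm (autocorr \<zeta> W (t div p)) \<le> (B::real) \<and> norm (autocorr \<zeta> W (t div p + 1)) \<le> B"
  shows "norm (autocorr \<zeta> (Suc W) t) \<le> real p*B \<and> norm (autocorr \<zeta> (Suc W) (t+1)) \<le> real p*B"
proof -
  have \<zeta>': "norm (\<zeta>^p*\<omega>) = 1" using \<zeta> norm_\<omega> by (simp add: norm_mult norm_power)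
  have gen: "norm (autocorr \<zeta> (Suc W) ((t div p)*p+t0)) \<le> p*B" if "t0 \<le> p" for t0
  proof -
    have "norm (autocorr \<zeta> (Suc W) ((t div p)*p+t0)) \<le> 
       real (p-t0) * norm (autocorr (\<zeta>^p*\<omega>) W (t div p)) + real t0 * norm (autocorr (\<zeta>^p*\<omega>) W (t div p+1))"
      unfolding autocorr_rec[OF \<zeta> that]
      by (rule order.trans[OF norm_triangle_ineq]) (simp add: norm_mult norm_power \<zeta>)
    also have "\<dots> \<le> real (p-t0) * B + real t0 * B"
      using bd[OF \<zeta>'] by (intro add_mono mult_left_mono) auto
    also have "\<dots> = p*B" using that by (simp add: of_nat_diff algebra_simps)
    finally show ?thesis .
  qed
  have "t mod p + 1 \<le> p" using mod_less_divisor[OF p_pos, of t] by linarith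
  thus ?thesis using gen[of "t mod p"] gen[of "t mod p+1"] by (simp add: add.assoc[symmetric])
qed

text \<open>The digit 1 produces a carry for at least one last digit of y. At the two following
  digits 0 this carry can die at the first or at the second; both ways end with the shift s = t div
  p^3, and \<open>z1\<close> shows that their phases differ by cnj \<omega>. The shifts t and t+1
  are the cases t0 = 1 and t0 = 2 of \<open>gen\<close>, where t0 \<ge> 1 gives the gaining state
  positive weight.\<close>

lemma norm_autocorr_block:
  assumes \<zeta>: "norm \<zeta> = 1" and t: "t mod p^3 = 1"
    and bd: "\<And>\<zeta>. norm \<zeta> = 1 \<Longrightarrow> norm (autocorr \<zeta> W (t div p^3)) \<le> B \<and> norm (autocorr \<zeta> W (t div p^3 + 1)) \<le> B"
  shows "norm (autocorr \<zeta> (W+3) t) \<le> (p^3-gap)*B \<and> norm (autocorr \<zeta> (W+3) (t+1)) \<le> (p^3-gap)*B"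
proof -
  define s where "s = t div p^3"
  define \<zeta>1 where "\<zeta>1 = \<zeta>^p*\<omega>"
  define \<zeta>2 where "\<zeta>2 = \<zeta>1^p*\<omega>"
  define \<zeta>3 where "\<zeta>3 = \<zeta>2^p*\<omega>"
  have n1: "norm \<zeta>1 = 1" using \<zeta> norm_\<omega> by (simp add: \<zeta>1_def norm_mult norm_power)
  have n2: "norm \<zeta>2 = 1" using n1 norm_\<omega> by (simp add: \<zeta>2_def norm_mult norm_power)
  have n3: "norm \<zeta>3 = 1" using n2 norm_\<omega> by (simp add: \<zeta>3_def norm_mult norm_power)
  have B0: "B \<ge> 0" using bd[OF \<zeta>] norm_ge_zero by (meson order.trans)
  have bs: "norm (autocorr \<zeta>3 W s) \<le> B" "norm (autocorr \<zeta>3 W (s+1)) \<le> B"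
    using bd[OF n3] by (auto simp: s_def)
  have c1: "autocorr \<zeta>2 (Suc W) (s*p) = p * autocorr \<zeta>3 W s"
    using autocorr_rec[OF n2, of 0 W s] by (simp add: \<zeta>3_def)
  have c2: "autocorr \<zeta>2 (Suc W) (s*p+1) = of_nat (p-1) * cnj \<zeta>2 * autocorr \<zeta>3 W s + \<zeta>2^(p-1) * autocorr \<zeta>3 W (s+1)"
    using autocorr_rec[OF n2, of 1 W s] p_ge_2 by (simp add: \<zeta>3_def)
  have d1: "autocorr \<zeta>1 (Suc (Suc W)) (s*p*p) = p^2 * autocorr \<zeta>3 W s"
    using autocorr_rec[OF n1, of 0 "Suc W" "s*p"] c1 by (simp add: \<zeta>2_def power2_eq_square)
  have z1: "\<zeta>1^(p-1) * cnj \<zeta>2 = cnj \<zeta>1 * cnj \<omega>"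
  proof -
    have "\<zeta>1 * cnj \<zeta>1 = 1" using n1 by (simp add: complex_norm_square[symmetric])
    hence "\<zeta>1^(p-1) * cnj \<zeta>1^(p-1) = 1" by (metis power_mult_distrib power_one)
    moreover have "cnj \<zeta>1^p = cnj \<zeta>1 * cnj \<zeta>1^(p-1)"
      using p_pos by (metis power_minus_mult mult.commute)
    ultimately show ?thesis by (simp add: \<zeta>2_def mult.assoc)
  qed
  have "autocorr \<zeta>1 (Suc (Suc W)) (s*p*p+1)
     = of_nat (p-1) * cnj \<zeta>1 * (p * autocorr \<zeta>3 W s)
       + \<zeta>1^(p-1) * (of_nat (p-1) * cnj \<zeta>2 * autocorr \<zeta>3 W s + \<zeta>2^(p-1) * autocorr \<zeta>3 W (s+1))"
    using autocorr_rec[OF n1, of 1 "Suc W" "s*p"] p_ge_2 c1 c2 by (simp add: \<zeta>2_def)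
  also have "\<dots> = of_nat (p-1) * cnj \<zeta>1 * of_nat p * autocorr \<zeta>3 W s
     + of_nat (p-1) * (\<zeta>1^(p-1) * cnj \<zeta>2) * autocorr \<zeta>3 W s + \<zeta>1^(p-1) * \<zeta>2^(p-1) * autocorr \<zeta>3 W (s+1)"
    by (simp add: algebra_simps)
  also have "\<dots> = of_nat (p-1) * cnj \<zeta>1 * (of_nat p + cnj \<omega>) * autocorr \<zeta>3 W s + \<zeta>1^(p-1) * \<zeta>2^(p-1) * autocorr \<zeta>3 W (s+1)"
    unfolding z1 by (simp add: algebra_simps)
  finally have d2: "autocorr \<zeta>1 (Suc (Suc W)) (s*p*p+1) =
     of_nat (p-1) * cnj \<zeta>1 * (of_nat p + cnj \<omega>) * autocorr \<zeta>3 W s + \<zeta>1^(p-1) * \<zeta>2^(p-1) * autocorr \<zeta>3 W (s+1)" .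
  \<comment> \<open>Among the p equal terms only one is paired with cnj \<omega>; so exactly one
    \<open>gap\<close> is gained here.\<close>
  have pw: "norm (of_nat p + cnj \<omega>) \<le> p + 1 - gap"
  proof -
    have "of_nat p + cnj \<omega> = of_nat (p-1) + cnj (1+\<omega>)" using p_ge_2 by (simp add: of_nat_diff)
    hence "norm (of_nat p + cnj \<omega>) \<le> real (p-1) + norm (1+\<omega>)"
      by (metis complex_mod_cnj norm_of_nat norm_triangle_ineq)
    thus ?thesis using p_ge_2 by (simp add: gap_def of_nat_diff)
  qed
  have e2: "norm (autocorr \<zeta>1 (Suc (Suc W)) (s*p*p+1)) \<le> (p^2-gap)*B"
  proof -
    have "norm (autocorr \<zeta>1 (Suc (Suc W)) (s*p*p+1)) \<le> real (p-1) * norm (of_nat p + cnj \<omega>) * norm (autocorr \<zeta>3 W s) + norm (autocorr \<zeta>3 W (s+1))"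
      unfolding d2 by (rule order.trans[OF norm_triangle_ineq]) (simp add: norm_mult norm_power n1 n2)
    also have "\<dots> \<le> real (p-1) * (p+1-gap) * B + B"
      using pw bs p_ge_2 gap_le_2 by (intro add_mono mult_mono) auto
    also have "\<dots> = (p^2 - real (p-1)*gap)*B"
      using p_ge_2 by (simp add: of_nat_diff algebra_simps power2_eq_square)
    also have "\<dots> \<le> (p^2-gap)*B"
    proof -
      have "1*gap \<le> real (p-1)*gap" using p_ge_2 gap_pos by (intro mult_right_mono) auto
      thus ?thesis using B0 by (intro mult_right_mono) auto
    qed
    finally show ?thesis .
  qed
  have e1: "norm (autocorr \<zeta>1 (Suc (Suc W)) (s*p*p)) \<le> p^2*B"
    unfolding d1 using bs by (simp add: norm_mult norm_power mult_left_mono)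
  have t': "t = s*p*p*p+1" using t div_mult_mod_eq[of t "p^3"] 
    by (simp add: s_def power3_eq_cube mult.assoc)
  have gen: "norm (autocorr \<zeta> (W+3) (s*p*p*p+t0)) \<le> (p^3-gap)*B" if "1 \<le> t0" "t0 \<le> p" for t0
  proof -
    have "norm (autocorr \<zeta> (W+3) (s*p*p*p+t0)) \<le> real (p-t0) * norm (autocorr \<zeta>1 (Suc (Suc W)) (s*p*p))
       + real t0 * norm (autocorr \<zeta>1 (Suc (Suc W)) (s*p*p+1))"
      using autocorr_rec[OF \<zeta> that(2), of "Suc (Suc W)" "s*p*p"]
      by (simp add: \<zeta>1_def eval_nat_numeral) 
         (rule order.trans[OF norm_triangle_ineq], simp add: norm_mult norm_power \<zeta>)
    also have "\<dots> \<le> real (p-t0) * (p^2*B) + real t0 * ((p^2-gap)*B)"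
      using e1 e2 by (intro add_mono mult_left_mono) auto
    also have "\<dots> = (p^3 - real t0 * gap)*B"
      using that by (simp add: of_nat_diff algebra_simps power2_eq_square power3_eq_cube)
    also have "\<dots> \<le> (p^3-gap)*B"
    proof -
      have "1*gap \<le> real t0*gap" using that gap_pos by (intro mult_right_mono) auto
      thus ?thesis using B0 by (intro mult_right_mono) auto
    qed
    finally show ?thesis .
  qed
  show ?thesis using gen[of 1] gen[of 2] p_ge_2 unfolding t' by (simp add: add.assoc)
qed

lemma norm_autocorr_le: "norm \<zeta> = 1 \<Longrightarrow> norm (autocorr \<zeta> W t) \<le> p^W"
proof -
  assume "norm \<zeta> = 1"
  hence "norm (autocorr \<zeta> W t) \<le> (\<Sum>y<p^W. 1)"
    unfolding autocorr_def by (intro sum_norm_le) (simp add: norm_mult)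
  thus ?thesis by simp
qed

lemma p3_ge_8: "real p ^ 3 \<ge> 8"
proof -
  have "(2::real)^3 \<le> real p ^ 3" using p_ge_2 by (intro power_mono) auto
  thus ?thesis by simp
qed

lemma weight_factor_nonneg: "0 \<le> 1 - gap / p^3" 
  using p3_ge_8 gap_le_2 by (simp add: field_simps)

lemma weight_nonneg: "0 \<le> weight k t"
  using weight_factor_nonneg by (induction k arbitrary: t) auto

text \<open>Each block of three digits of t either gains by \<open>norm_autocorr_block\<close> or is
  passed by three trivial steps. The W digits above the k blocks are estimated trivially.\<close>

lemma norm_autocorr_weight:
  "norm \<zeta> = 1 \<Longrightarrow> norm (autocorr \<zeta> (W+3*k) t) \<le> p^(W+3*k) * weight k t \<and>
                 norm (autocorr \<zeta> (W+3*k) (t+1)) \<le> p^(W+3*k) * weight k t"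
proof (induction k arbitrary: \<zeta> t)
  case 0 thus ?case using norm_autocorr_le[of \<zeta> W] by simp
next
  case (Suc k)
  define B where "B = p^(W+3*k) * weight k (t div p^3)"
  have eq: "W + 3 * Suc k = W+3*k+3" by simp
  show ?case
  proof (cases "t mod p^3 = 1")
    case True
    have "(p^3-gap)*B = p^(W+3*Suc k) * weight (Suc k) t"
      using True p_pos by (simp add: B_def power_add field_simps)
    thus ?thesis unfolding eq
      using norm_autocorr_block[OF Suc.prems True, of "W+3*k" B] Suc.IH unfolding B_def by (simp only: eq) 
  next
    case False
    have d2: "t div p^2 div p = t div p^3" by (simp add: div_mult2_eq[symmetric] power3_eq_cube power2_eq_square)
    have d1: "t div p div p = t div p^2" by (simp add: div_mult2_eq[symmetric] power2_eq_square)
    have s1: "norm \<zeta> = 1 \<Longrightarrow> norm (autocorr \<zeta> (Suc (W+3*k)) (t div p^2)) \<le> p*B \<and> norm (autocorr \<zeta> (Suc (W+3*k)) (t div p^2+1)) \<le> p*B" for \<zeta>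
      using norm_autocorr_step[of \<zeta> "W+3*k" "t div p^2" B] Suc.IH[of _ "t div p^3"] unfolding B_def d2 by blast
    have s2: "norm \<zeta> = 1 \<Longrightarrow> norm (autocorr \<zeta> (Suc (Suc (W+3*k))) (t div p)) \<le> p*(p*B) \<and> norm (autocorr \<zeta> (Suc (Suc (W+3*k))) (t div p+1)) \<le> p*(p*B)" for \<zeta>
      using norm_autocorr_step[of \<zeta> "Suc (W+3*k)" "t div p" "p*B"] s1 unfolding d1 by blast
    have s3: "norm (autocorr \<zeta> (Suc (Suc (Suc (W+3*k)))) t) \<le> p*(p*(p*B)) \<and> norm (autocorr \<zeta> (Suc (Suc (Suc (W+3*k)))) (t+1)) \<le> p*(p*(p*B))"
      using norm_autocorr_step[of \<zeta> "Suc (Suc (W+3*k))" t "p*(p*B)"] s2 Suc.prems by blast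
    have "p*(p*(p*B)) = p^(W+3*Suc k) * weight (Suc k) t"
      using False by (simp add: B_def power_add power3_eq_cube)
    moreover have "Suc (Suc (Suc (W+3*k))) = W+3*Suc k" by simp
    ultimately show ?thesis using s3 by metis
  qed
qed

text \<open>The mean of the factor of one digit block in \<open>weight\<close>: the block 1, 0, 0
  has frequency 1/p^3 and then loses gap/p^3.\<close>

definition decay :: real where "decay = 1 - gap / p^6"

lemma sum_weight: "(\<Sum>t<p^(3*k). weight k t) = p^(3*k) * decay^k"
proof (induction k)
  case (Suc k)
  have "(\<Sum>t<p^(3*Suc k). weight (Suc k) t) = (\<Sum>t<p^(3*k)*p^3. weight (Suc k) t)"
    by (simp add: power_add mult.commute)
  also have "\<dots> = (\<Sum>u<p^(3*k). \<Sum>e<p^3. weight (Suc k) (u*p^3+e))"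
    by (rule sum_lessThan_mult)
  also have "\<dots> = (\<Sum>u<p^(3*k). \<Sum>e<p^3. (if e = 1 then 1 - gap / p^3 else 1) * weight k u)"
    by (intro sum.cong refl) (simp del: power_Suc)
  also have "\<dots> = (\<Sum>u<p^(3*k). (\<Sum>e<p^3. (if e = 1 then 1 - gap / p^3 else 1)) * weight k u)"
    by (simp only: sum_distrib_right)
  also have "(\<Sum>e<p^3. (if e = 1 then 1 - gap / p^3 else (1::real))) = p^3 - gap / p^3"
  proof -
    have 1: "(1::nat) < p^3" using p_ge_2 by (intro one_less_power) auto
    have "(\<Sum>e<p^3. (if e = 1 then 1 - gap / p^3 else (1::real))) = (\<Sum>e<p^3. 1 - (if e = 1 then gap / p^3 else 0))"
      by (rule sum.cong) auto
    also have "\<dots> = p^3 - gap / p^3"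
      using 1 by (simp add: sum_subtractf sum.delta del: One_nat_def)
    finally show ?thesis .
  qed
  also have "(\<Sum>u<p^(3*k). (p^3 - gap / p^3) * weight k u) = (p^3 - gap / p^3) * (p^(3*k) * decay^k)"
    unfolding sum_distrib_left[symmetric] Suc.IH by simp
  also have "p^3 - gap / p^3 = p^3 * decay"
    by (simp add: decay_def field_simps flip: power_add)
  finally show ?case by (simp add: power_add mult_ac)
qed simp

lemma weight_mod: "weight k (t mod p^(3*k)) = weight k t"
proof (induction k arbitrary: t)
  case (Suc k)
  have e: "p^(3*Suc k) = p^3 * p^(3*k)" by (simp add: power_add)
  have m: "t mod p^(3*Suc k) mod p^3 = t mod p^3" unfolding e by (simp add: mod_mod_cancel)
  have d: "t mod p^(3*Suc k) div p^3 = (t div p^3) mod p^(3*k)"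
    unfolding e by (simp add: mod_mult2_eq)
  show ?case unfolding weight.simps m d Suc.IH by simp
qed simp

lemma p6_ge_64: "real p ^ 6 \<ge> 64"
proof -
  have "(2::real)^6 \<le> real p ^ 6" using p_ge_2 by (intro power_mono) auto
  thus ?thesis by simp
qed

lemma decay_bounds: "1/2 \<le> decay" "decay < 1" "0 < decay"
  using gap_pos gap_le_2 p6_ge_64 by (auto simp: decay_def field_simps)

end

section \<open>Mean squares over residues\<close>

lemma sum_rotate:
  "(\<Sum>a\<in>A. \<Sum>n\<in>B. \<Sum>j\<in>C. F a n j) = (\<Sum>j\<in>C. \<Sum>a\<in>A. \<Sum>n\<in>B. F a n j)"
proof -
  have "(\<Sum>a\<in>A. \<Sum>n\<in>B. \<Sum>j\<in>C. F a n j) = (\<Sum>a\<in>A. \<Sum>j\<in>C. \<Sum>n\<in>B. F a n j)"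
    by (rule sum.cong[OF refl], rule sum.swap)
  also have "\<dots> = (\<Sum>j\<in>C. \<Sum>a\<in>A. \<Sum>n\<in>B. F a n j)" by (rule sum.swap)
  finally show ?thesis .
qed

context digital_phase begin

section \<open>Correlations truncated to a digit window\<close>

definition trunc_corr :: "nat \<Rightarrow> nat \<Rightarrow> nat \<Rightarrow> complex" where
  "trunc_corr W t y = f (y mod p^W) * cnj (f ((y+t) mod p^W))"

lemma norm_trunc_corr [simp]: "norm (trunc_corr W t y) = 1" by (simp add: trunc_corr_def norm_mult)

lemma trunc_corr_mod: "trunc_corr W t (y mod p^W) = trunc_corr W t y"
  by (simp add: trunc_corr_def mod_simps)

text \<open>Without a carry out of the lowest W digits, y and y+s have the same high part. Its
  contribution Z, including the linear phase, is unimodular and cancels.\<close>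

lemma trunc_corr_eq:
  assumes "y mod p^W + s < p^W"
  shows "f y * cnj (f (y+s)) = trunc_corr W s y"
proof -
  define b where "b = y div p^W"
  define Z where "Z = (\<omega>^repunit W)^b * f b"
  have m: "(y+s) mod p^W = y mod p^W + s"
    using assms by (metis mod_add_left_eq mod_less)
  have y: "y = b * p^W + y mod p^W" unfolding b_def by (rule div_mult_mod_eq[symmetric])
  have "y + s = b * p^W + (y mod p^W + s)" using y by linarith
  moreover have "(b * p^W + x) div p^W = b" if "x < p^W" for x using that by simp
  ultimately have d: "(y+s) div p^W = b" using assms by metis
  have "f y = f (y mod p^W) * Z"
    using f_split_mod[of y W] by (simp add: Z_def b_def mult.assoc)
  moreover have "f (y+s) = f ((y+s) mod p^W) * Z"
    using f_split_mod[of "y+s" W] by (simp add: Z_def d mult.assoc)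
  moreover have "Z * cnj Z = 1"
    by (subst complex_norm_square[symmetric]) (simp add: Z_def norm_mult norm_power norm_\<omega>)
  ultimately show ?thesis by (simp add: trunc_corr_def mult_ac) 
qed

text \<open>Fixing the e lowest digits leaves an autocorrelation of the next L digits. By
  \<open>f_split\<close> the fixed digits only add a unimodular factor and the twist
  \<omega>^repunit e, and their carry is absorbed in (c0+t) div p^e.\<close>

lemma norm_sum_trunc_corr_class:
  assumes c0: "c0 < p^e"
  shows "norm (\<Sum>i<p^L. trunc_corr (e+L) t (c0+p^e*i)) = norm (autocorr (\<omega>^repunit e) L ((c0+t) div p^e))"
proof -
  define b where "b = (c0+t) div p^e"
  define c1 where "c1 = (c0+t) mod p^e"
  have c1: "c1 < p^e" by (simp add: c1_def)
  have "trunc_corr (e+L) t (c0+p^e*i) = (f c0 * cnj (f c1)) * 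
      (twist (\<omega>^repunit e) i * cnj (twist (\<omega>^repunit e) ((i+b) mod p^L)))" if i: "i < p^L" for i
  proof -
    have "c0+p^e*i < p^e * (i+1)" using c0 by simp
    also have "\<dots> \<le> p^e * p^L" using i by (intro mult_left_mono) auto
    finally have m1: "(c0+p^e*i) mod p^(e+L) = c0+p^e*i" by (simp add: power_add)
    have "(c0+p^e*i+t) mod p^(e+L) = p^e * ((c0+p^e*i+t) div p^e mod p^L) + (c0+p^e*i+t) mod p^e"
      by (simp add: power_add mod_mult2_eq)
    moreover have "c0+p^e*i+t = (c0+t) + p^e*i" by simp
    hence "(c0+p^e*i+t) div p^e = i+b" "(c0+p^e*i+t) mod p^e = c1"
      by (simp_all only:) (simp_all add: b_def c1_def)
    ultimately have m2: "(c0+p^e*i+t) mod p^(e+L) = c1 + p^e * ((i+b) mod p^L)" by simp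
    show ?thesis unfolding trunc_corr_def m1 m2 f_split[OF c0] f_split[OF c1] by (simp add: twist_def mult_ac)
  qed
  hence "(\<Sum>i<p^L. trunc_corr (e+L) t (c0+p^e*i)) = (\<Sum>i<p^L. (f c0 * cnj (f c1)) * 
      (twist (\<omega>^repunit e) i * cnj (twist (\<omega>^repunit e) ((i+b) mod p^L))))"
    by (intro sum.cong) auto
  also have "\<dots> = (f c0 * cnj (f c1)) * autocorr (\<omega>^repunit e) L b"
    by (simp add: autocorr_def sum_distrib_left)
  finally show ?thesis by (simp add: norm_mult b_def)
qed

text \<open>Modulo Q the number p^e is a multiple of d, so translating n averages H over a + d*n +
  p^e*i before absolute values are taken. After that only the sums over full classes modulo p^e are
  left, and a runs over all starting points equally.\<close>

lemma norm_sum_dilate_le: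
  fixes H :: "nat \<Rightarrow> complex" and L e :: nat
  defines "Q \<equiv> p^(e+L)"
  assumes per: "\<And>n. H (n mod Q) = H n" and nd: "\<not> p^(e+1) dvd d"
  shows "(\<Sum>a<Q. norm (\<Sum>n<Q. H (a+d*n))) \<le> Q * (\<Sum>c<p^e. norm (\<Sum>i<p^L. H (c+p^e*i)))"
proof -
  obtain u where u: "[d*u = p^e] (mod Q)"
    using prime_power_dilation_solvable[OF prime_p nd] unfolding Q_def by blast
  define B where "B y = norm (\<Sum>i<p^L. H (y+p^e*i))" for y
  have Bmod: "B (y mod p^e) = B y" for y
  proof -
    have "(\<Sum>i<p^L. H (y mod p^e+p^e*(y div p^e+i))) = (\<Sum>i<p^L. H (y mod p^e+p^e*i))"
    proof (rule sum_periodic_shift[of "\<lambda>i. H (y mod p^e+p^e*i)"])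
      fix n
      have "[p^e*(n mod p^L) = p^e*n] (mod p^e*p^L)" unfolding mult_mod_right by (rule cong_mod_left[THEN iffD2]) simp
      hence "[y mod p^e+p^e*(n mod p^L) = y mod p^e+p^e*n] (mod Q)"
        unfolding Q_def power_add by (rule cong_add[OF cong_refl])
      thus "H (y mod p^e+p^e*(n mod p^L)) = H (y mod p^e+p^e*n)"
        by (rule periodic_cong[of H Q, OF per])
    qed
    moreover have "y mod p^e+p^e*(y div p^e+i) = y + p^e*i" for i
      by (simp add: distrib_left add.assoc[symmetric])
    ultimately show ?thesis by (simp add: B_def)
  qed
  have "p^L * norm (\<Sum>n<Q. H (a+d*n)) \<le> (\<Sum>n<Q. B (a+d*n))" for a
  proof -
    have "of_nat (p^L) * (\<Sum>n<Q. H (a+d*n)) = (\<Sum>i<p^L. \<Sum>n<Q. H (a+d*n))" by simp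
    also have "\<dots> = (\<Sum>i<p^L. \<Sum>n<Q. H (a+d*n+p^e*i))"
      by (rule sum.cong[OF refl], rule sum_periodic_dilate_shift[of H Q, OF per u])
    also have "\<dots> = (\<Sum>n<Q. \<Sum>i<p^L. H (a+d*n+p^e*i))" by (rule sum.swap)
    finally have "norm (of_nat (p^L) * (\<Sum>n<Q. H (a+d*n))) \<le> (\<Sum>n<Q. B (a+d*n))"
      by (simp only:) (auto simp: B_def intro: sum_norm_le)
    thus ?thesis by (simp only: norm_mult norm_of_nat)
  qed
  hence "(\<Sum>a<Q. p^L * norm (\<Sum>n<Q. H (a+d*n))) \<le> (\<Sum>a<Q. \<Sum>n<Q. B (a+d*n))"
    by (intro sum_mono) auto
  also have "\<dots> = (\<Sum>n<Q. \<Sum>a<Q. B (d*n+a))" by (subst sum.swap) (simp add: add.commute)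
  also have "\<dots> = (\<Sum>n<Q. \<Sum>a<Q. B a)"
  proof (rule sum.cong[OF refl], rule sum_periodic_shift)
    fix n show "B (n mod Q) = B n"
      using Bmod[of "n mod Q"] Bmod[of n] by (simp add: Q_def power_add mod_mod_cancel)
  qed
  also have "(\<Sum>a<Q. B a) = (\<Sum>k<p^L. \<Sum>c<p^e. B (k*p^e+c))"
    unfolding Q_def power_add using sum_lessThan_mult[of B "p^L" "p^e"] by (simp add: mult.commute)
  also have "\<dots> = (\<Sum>k<p^L. \<Sum>c<p^e. B c)"
  proof (intro sum.cong refl)
    fix k c assume "c \<in> {..<p^e}"
    thus "B (k*p^e+c) = B c" using Bmod[of "k*p^e+c"] by simp
  qed
  also have "(\<Sum>n<Q. \<Sum>k<p^L. \<Sum>c<p^e. B c) = p^L * (Q * (\<Sum>c<p^e. B c))" by simp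
  finally have "p^L * (\<Sum>a<Q. norm (\<Sum>n<Q. H (a+d*n))) \<le> p^L * (Q * (\<Sum>c<p^e. B c))"
    by (simp add: sum_distrib_left)
  thus ?thesis unfolding B_def by (simp add: mult_le_cancel_left_pos)
qed

text \<open>With a + D*n as the new variable, n survives only inside H, with coefficient D'-D. So X
  is bounded trivially and all cancellation is taken from H.\<close>

lemma norm_pair_correlation_le:
  fixes L e :: nat
  defines "Q \<equiv> p^(e+L)"
  assumes perX: "\<And>n. X (n mod Q) = X n" and X1: "\<And>n. norm (X n) \<le> 1"
    and perH: "\<And>n. H (n mod Q) = H n" and D: "D \<le> D'" and nd: "\<not> p^(e+1) dvd (D'-D)"
  shows "norm (\<Sum>a<Q. \<Sum>n<Q. X (a+D*n) * cnj (H (a+D'*n))) \<le> Q * (\<Sum>c<p^e. norm (\<Sum>i<p^L. H (c+p^e*i)))"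
proof -
  define d where "d = D'-D"
  have "(\<Sum>a<Q. \<Sum>n<Q. X (a+D*n) * cnj (H (a+D'*n))) = (\<Sum>n<Q. \<Sum>a<Q. X (D*n+a) * cnj (H (D*n+a+d*n)))"
    using D by (subst sum.swap) (simp add: d_def algebra_simps diff_mult_distrib)
  also have "\<dots> = (\<Sum>n<Q. \<Sum>a<Q. X a * cnj (H (a+d*n)))"
  proof (rule sum.cong[OF refl], rule sum_periodic_shift)
    fix n m :: nat
    have "[m mod Q + d*n = m+d*n] (mod Q)" by (intro cong_add) auto
    thus "X (m mod Q) * cnj (H (m mod Q+d*n)) = X m * cnj (H (m+d*n))"
      using perX periodic_cong[of H Q, OF perH] by metis
  qed
  also have "\<dots> = (\<Sum>a<Q. X a * cnj (\<Sum>n<Q. H (a+d*n)))"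
    by (subst sum.swap) (simp add: sum_distrib_left)
  finally have "norm (\<Sum>a<Q. \<Sum>n<Q. X (a+D*n) * cnj (H (a+D'*n))) \<le> (\<Sum>a<Q. norm (X a * cnj (\<Sum>n<Q. H (a+d*n))))"
    by (simp add: norm_sum)
  also have "\<dots> \<le> (\<Sum>a<Q. norm (\<Sum>n<Q. H (a+d*n)))"
  proof (rule sum_mono)
    fix a
    have "norm (X a) * norm (\<Sum>n<Q. H (a+d*n)) \<le> 1 * norm (\<Sum>n<Q. H (a+d*n))"
      using X1 by (intro mult_right_mono) auto
    thus "norm (X a * cnj (\<Sum>n<Q. H (a+d*n))) \<le> norm (\<Sum>n<Q. H (a+d*n))"
      by (simp only: norm_mult complex_mod_cnj mult_1)
  qed
  also have "\<dots> \<le> Q * (\<Sum>c<p^e. norm (\<Sum>i<p^L. H (c+p^e*i)))"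
    unfolding Q_def using perH nd by (intro norm_sum_dilate_le) (auto simp: Q_def d_def)
  finally show ?thesis .
qed

text \<open>Translates by p^e can be inserted into the sum over j. They move (s + D*j) div p^e
  through a complete period p^(3*k) of the weight, whose mean is given by
  \<open>sum_weight\<close>.\<close>

lemma sum_weight_progression:
  assumes nd: "\<not> p^(e+1) dvd D"
  shows "(\<Sum>j<p^(e+3*k). weight k ((s+D*j) div p^e)) = p^(e+3*k) * decay^k"
proof -
  define T where "T = p^(e+3*k)"
  define \<phi> where "\<phi> z = weight k (z div p^e)" for z
  have per: "\<phi> (z mod T) = \<phi> z" for z
  proof -
    have "(z mod T) div p^e = (z div p^e) mod p^(3*k)"
      unfolding T_def power_add by (simp add: mod_mult2_eq)
    thus ?thesis by (simp add: \<phi>_def weight_mod)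
  qed
  obtain u where u: "[D*u = p^e] (mod T)"
    using prime_power_dilation_solvable[OF prime_p nd] unfolding T_def by blast
  have "p^(3*k) * (\<Sum>j<T. \<phi> (s+D*j)) = (\<Sum>i<p^(3*k). \<Sum>j<T. \<phi> (s+D*j+p^e*i))"
    using sum_periodic_dilate_shift[of \<phi> T D u "p^e" s, OF per u] by simp
  also have "\<dots> = (\<Sum>j<T. \<Sum>i<p^(3*k). weight k ((s+D*j) div p^e + i))"
    by (subst sum.swap) (simp add: \<phi>_def add.commute)
  also have "\<dots> = (\<Sum>j<T. \<Sum>i<p^(3*k). weight k i)"
    by (intro sum.cong refl sum_periodic_shift weight_mod)
  also have "\<dots> = p^(3*k) * (p^(e+3*k) * decay^k)"
    by (simp add: sum_weight T_def)
  finally have "real (p^(3*k)) * (\<Sum>j<T. \<phi> (s+D*j)) = real (p^(3*k)) * (p^(e+3*k) * decay^k)" .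
  hence "(\<Sum>j<T. \<phi> (s+D*j)) = p^(e+3*k) * decay^k"
    by (subst (asm) mult_cancel_left) simp
  thus ?thesis by (simp add: T_def \<phi>_def)
qed

text \<open>The factor h is 1 for products and 2 for squares. If h = p = 2 it absorbs one power of
  p, which is why e+1 stands in the hypothesis and e in the conclusion.\<close>

lemma prime_power_dvd_cancel_small:
  assumes h: "1 \<le> h" "h \<le> p" and dvd: "p^(e+1) dvd h*d"
  shows "p^e dvd d"
proof (cases "h = p")
  case True thus ?thesis using dvd by simp
next
  case False
  hence "\<not> p dvd h" using h by (auto dest: dvd_imp_le)
  hence "coprime (p^(e+1)) h" using prime_p by (metis coprime_power_left_iff prime_imp_coprime)
  hence "p^(e+1) dvd d" using dvd by (simp add: coprime_dvd_mult_right_iff)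
  thus ?thesis by (metis power_add dvd_mult_left)
qed

lemma inverse_p_power_le_decay: "1 / p^(3*k) \<le> decay^k"
proof -
  have "1 / real p^3 \<le> decay" using p3_ge_8 decay_bounds(1)
    mult_mono[of "1/2" decay 8 "real p^3"] by (simp add: field_simps)
  hence "(1 / real p^3)^k \<le> decay^k" by (intro power_mono) auto
  thus ?thesis by (simp add: power_divide power_mult)
qed

text \<open>In units of \<open>z = p^k\<close>: shifts \<open>r\<close> are below \<open>z^2\<close>, there are \<open>J = z^6\<close> multiples \<open>j\<close>, the digit window has length
  \<open>Q = z^15\<close>, and carries are caused by amounts below \<open>z^12\<close>. Unless \<open>j\<close> and \<open>j'\<close> agree modulo \<open>z^3\<close>, the
  points \<open>a + h*j*n\<close> and \<open>a + h*j'*n\<close> are independent within classes modulo \<open>z^3\<close>, so it is enough to average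
  the autocorrelation of the factor belonging to the larger index.\<close>

lemma mean_square_le:
  fixes k h r c :: nat and l :: "nat \<Rightarrow> complex"
  defines "Q \<equiv> p^(15*k)" and "J \<equiv> p^(6*k)"
  assumes h: "1 \<le> h" "h \<le> p" and nd: "\<not> p^(3*k+1) dvd h*r" and l1: "\<And>j. norm (l j) = 1"
  shows "(\<Sum>a<Q. \<Sum>n<Q. (norm (\<Sum>j<J. l j * trunc_corr (15*k) (h*j*r+c) (a+h*j*n)))^2) \<le> 3*(real J)^2*(real Q)^2*decay^k"
proof -
  define e where "e = 3*k"
  define L where "L = 12*k"
  have eL: "15*k = e+L" by (simp add: e_def L_def)
  define Gj where "Gj j = trunc_corr (15*k) (h*j*r+c)" for j
  have perG: "Gj j (n mod Q) = Gj j n" for j n by (simp add: Gj_def Q_def trunc_corr_mod)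
  have nG: "norm (Gj j n) = 1" for j n by (simp add: Gj_def)
  define P where "P j j' = (\<Sum>a<Q. \<Sum>n<Q. Gj j (a+h*j*n) * cnj (Gj j' (a+h*j'*n)))" for j j'
  define b where "b j = (\<Sum>c0<p^e. p^L * weight k ((c0+(h*j*r+c)) div p^e))" for j
  have b0: "b j \<ge> 0" for j unfolding b_def by (intro sum_nonneg mult_nonneg_nonneg weight_nonneg) auto
  have class_le: "(\<Sum>c0<p^e. norm (\<Sum>i<p^L. Gj j (c0+p^e*i))) \<le> b j" for j
    unfolding b_def
  proof (rule sum_mono)
    fix c0 assume "c0 \<in> {..<p^e}"
    hence "norm (\<Sum>i<p^L. Gj j (c0+p^e*i)) = norm (autocorr (\<omega>^repunit e) L ((c0+(h*j*r+c)) div p^e))"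
      unfolding Gj_def eL by (intro norm_sum_trunc_corr_class) auto
    also have "\<dots> \<le> p^L * weight k ((c0+(h*j*r+c)) div p^e)"
      \<comment> \<open>Of the L = 12*k digits only the lowest 3*k are used for the gain: j runs
        over J = p^(e+3*k) values, exactly one period of the resulting weights.\<close>
      using norm_autocorr_weight[of "\<omega>^repunit e" "9*k" k] by (simp add: L_def)
    finally show "norm (\<Sum>i<p^L. Gj j (c0+p^e*i)) \<le> p^L * weight k ((c0+(h*j*r+c)) div p^e)" .
  qed
  have sym: "norm (P j j') = norm (P j' j)" for j j'
  proof -
    have "P j j' = cnj (P j' j)" by (simp add: P_def mult.commute)
    thus ?thesis by simp
  qed
  have triv: "norm (P j j') \<le> (real Q)^2" for j j'
  proof -
    have "norm (P j j') \<le> (\<Sum>a<Q. \<Sum>n<Q. 1)" unfolding P_def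
      by (intro sum_norm_le) (simp add: norm_mult nG)
    thus ?thesis by (simp add: power2_eq_square)
  qed
  have ord: "norm (P j j') \<le> Q * b j'" if "j \<le> j'" "j mod p^e \<noteq> j' mod p^e" for j j'
  proof -
    have "\<not> p^e dvd j'-j" using that by (metis mod_eq_dvd_iff_nat)
    hence "\<not> p^(e+1) dvd h*(j'-j)" using prime_power_dvd_cancel_small h by blast
    hence nd': "\<not> p^(e+1) dvd (h*j'-h*j)" by (simp add: diff_mult_distrib2)
    have "norm (P j j') \<le> Q * (\<Sum>c0<p^e. norm (\<Sum>i<p^L. Gj j' (c0+p^e*i)))"
      unfolding P_def Q_def eL using perG nG nd' that unfolding Q_def eL
      by (intro norm_pair_correlation_le) auto
    also have "\<dots> \<le> Q * b j'" using class_le by (intro mult_left_mono) auto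
    finally show ?thesis .
  qed
  have all: "norm (P j j') \<le> Q * (b j + b j') + (if j' mod p^e = j mod p^e then (real Q)^2 else 0)" for j j'
  proof (cases "j' mod p^e = j mod p^e")
    case True
    thus ?thesis using triv[of j j'] b0[of j] b0[of j'] by (simp add: add_increasing)
  next
    case False
    have "norm (P j j') \<le> max (Q * b j) (Q * b j')"
      using ord[of j j'] ord[of j' j] sym[of j j'] False by (cases "j \<le> j'") auto
    also have "\<dots> \<le> Q * (b j + b j')" using b0[of j] b0[of j'] by (simp add: distrib_left)
    finally show ?thesis using False by simp
  qed
  \<comment> \<open>No single shift h*j*r+c need have a small autocorrelation. As j varies the
    shifts form a progression with difference h*r, not divisible by p^(e+1), so the weights have
    mean decay^k.\<close>
  have sumb: "(\<Sum>j<J. b j) = Q * (J * decay^k)"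
  proof -
    have "(\<Sum>j<J. b j) = (\<Sum>c0<p^e. p^L * (\<Sum>j<J. weight k ((c0+(h*j*r+c)) div p^e)))"
      unfolding b_def by (subst sum.swap) (simp add: sum_distrib_left)
    also have "\<dots> = (\<Sum>c0<p^e. p^L * (J * decay^k))"
    proof (intro sum.cong refl arg_cong[where f="\<lambda>x. _ * x"])
      fix c0
      have "(\<Sum>j<J. weight k ((c0+c+h*r*j) div p^e)) = J * decay^k"
        using sum_weight_progression[of e "h*r" k "c0+c"] nd by (simp add: J_def e_def)
      thus "(\<Sum>j<J. weight k ((c0+(h*j*r+c)) div p^e)) = J * decay^k"
        by (simp add: algebra_simps)
    qed
    also have "\<dots> = real (p^e * p^L) * (J * decay^k)" by simp
    also have "p^e * p^L = Q" by (simp add: Q_def eL power_add)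
    finally show ?thesis .
  qed
  \<comment> \<open>The excluded pairs have proportion 1/p^(3*k) among all pairs, which is at most
    decay^k and hence harmless.\<close>
  have count: "(\<Sum>j<J. \<Sum>j'<J. (if j' mod p^e = j mod p^e then (real Q)^2 else 0)) = J * (p^(3*k) * (real Q)^2)"
  proof -
    have "(\<Sum>j'<J. (if j' mod p^e = j mod p^e then (real Q)^2 else 0)) = p^(3*k) * (real Q)^2" for j
    proof -
      have "(\<Sum>j'<J. (if j' mod p^e = j mod p^e then (real Q)^2 else 0))
          = (\<Sum>j'\<in>{j'. j' < J \<and> j' mod p^e = j mod p^e}. (real Q)^2)"
        by (rule sum.mono_neutral_cong_right) auto
      also have "\<dots> = card {j'. j' < p^(3*k) * p^e \<and> j' mod p^e = j mod p^e} * (real Q)^2"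
        by (simp add: J_def e_def flip: power_add)
      also have "card {j'. j' < p^(3*k) * p^e \<and> j' mod p^e = j mod p^e} = p^(3*k)"
        by (rule card_cong_lessThan) auto
      finally show ?thesis by simp
    qed
    thus ?thesis by simp
  qed
  have "complex_of_real (\<Sum>a<Q. \<Sum>n<Q. (norm (\<Sum>j<J. l j * Gj j (a+h*j*n)))^2)
     = (\<Sum>a<Q. \<Sum>n<Q. \<Sum>j<J. \<Sum>j'<J. l j * cnj (l j') * (Gj j (a+h*j*n) * cnj (Gj j' (a+h*j'*n))))"
  proof -
    have "complex_of_real ((norm (\<Sum>j<J. l j * Gj j (a+h*j*n)))^2) = (\<Sum>j<J. \<Sum>j'<J. l j * cnj (l j') * (Gj j (a+h*j*n) * cnj (Gj j' (a+h*j'*n))))" for a n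
      unfolding complex_norm_square cnj_sum sum_product by (intro sum.cong refl) (simp add: mult_ac)
    thus ?thesis by (simp only: of_real_sum)
  qed
  also have "\<dots> = (\<Sum>j<J. \<Sum>a<Q. \<Sum>n<Q. \<Sum>j'<J. l j * cnj (l j') * (Gj j (a+h*j*n) * cnj (Gj j' (a+h*j'*n))))"
    by (rule sum_rotate)
  also have "\<dots> = (\<Sum>j<J. \<Sum>j'<J. \<Sum>a<Q. \<Sum>n<Q. l j * cnj (l j') * (Gj j (a+h*j*n) * cnj (Gj j' (a+h*j'*n))))"
    by (rule sum.cong[OF refl], rule sum_rotate)
  also have "\<dots> = (\<Sum>j<J. \<Sum>j'<J. l j * cnj (l j') * P j j')"
    by (simp add: P_def sum_distrib_left)
  finally have "norm (complex_of_real (\<Sum>a<Q. \<Sum>n<Q. (norm (\<Sum>j<J. l j * Gj j (a+h*j*n)))^2)) \<le> (\<Sum>j<J. \<Sum>j'<J. norm (P j j'))"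
    by (simp only:) (intro sum_norm_le, simp add: norm_mult l1)
  hence "(\<Sum>a<Q. \<Sum>n<Q. (norm (\<Sum>j<J. l j * Gj j (a+h*j*n)))^2) \<le> (\<Sum>j<J. \<Sum>j'<J. norm (P j j'))"
    by (simp only: norm_of_real)
  also have "\<dots> \<le> (\<Sum>j<J. \<Sum>j'<J. Q * (b j + b j') + (if j' mod p^e = j mod p^e then (real Q)^2 else 0))"
    by (intro sum_mono all)
  also have "\<dots> = Q * (\<Sum>j<J. \<Sum>j'<J. b j + b j') + J * (p^(3*k) * (real Q)^2)"
    by (simp only: sum.distrib count sum_distrib_left[symmetric])
  also have "(\<Sum>j<J. \<Sum>j'<J. b j + b j') = 2 * J * (\<Sum>j<J. b j)"
    by (simp add: sum.distrib sum_distrib_left[symmetric])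
  also have "Q * (2 * J * (\<Sum>j<J. b j)) + J * (p^(3*k) * (real Q)^2) = (real Q)^2 * (real J)^2 * (2 * decay^k + 1 / p^(3*k))"
  proof -
    have "real J = p^(3*k) * p^(3*k)" by (simp add: J_def flip: power_add)
    hence "real J * p^(3*k) = (real J)^2 * (1 / p^(3*k))" by (simp add: power2_eq_square)
    hence "J * (p^(3*k) * (real Q)^2) = (real J)^2 * (1 / p^(3*k)) * (real Q)^2"
      by (simp only: mult.assoc[symmetric])
    thus ?thesis unfolding sumb by (simp only: ring_distribs) (simp add: power2_eq_square mult_ac)
  qed
  also have "\<dots> \<le> (real Q)^2 * (real J)^2 * (3 * decay^k)"
    using inverse_p_power_le_decay[of k] by (intro mult_left_mono) auto
  finally show ?thesis by (simp add: Gj_def mult_ac)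
qed

text \<open>The envelope is a majorant of the squared correlation sum that depends only on residues modulo \<open>p^(15*k)\<close>;
  being nonnegative, it can be summed with an upper bound for the distribution of these residues.\<close>

definition carries :: "nat \<Rightarrow> nat \<Rightarrow> nat \<Rightarrow> nat \<Rightarrow> nat" where
  "carries k h a n = card {j. j < p^(6*k) \<and> p^(15*k) \<le> (a+h*j*n) mod p^(15*k) + p^(12*k)}"

definition envelope :: "nat \<Rightarrow> nat \<Rightarrow> nat \<Rightarrow> nat \<Rightarrow> (nat \<Rightarrow> complex) \<Rightarrow> nat \<Rightarrow> nat \<Rightarrow> real" where
  "envelope k h r c l a n = 2 * (norm (\<Sum>j<p^(6*k). l j * trunc_corr (15*k) (h*j*r+c) (a+h*j*n)))^2
      + 8 * p^(6*k) * carries k h a n"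

lemma envelope_nonneg: "envelope k h r c l a n \<ge> 0" by (simp add: envelope_def)

lemma envelope_mod: "envelope k h r c l (a mod p^(15*k)) (n mod p^(15*k)) = envelope k h r c l a n"
proof -
  have *: "(a mod p^(15*k) + h*j*(n mod p^(15*k))) mod p^(15*k) = (a+h*j*n) mod p^(15*k)" for j
    by (intro cong_add cong_mult iffD1[OF cong_def]) auto
  have "trunc_corr (15*k) t (a mod p^(15*k) + h*j*(n mod p^(15*k))) = trunc_corr (15*k) t (a+h*j*n)" for t j
    by (metis * trunc_corr_mod)
  thus ?thesis unfolding envelope_def carries_def * by simp
qed

text \<open>For fixed n and j the variable a makes a + h*j*n uniform modulo p^(15*k), and the
  residues near the top that can cause a carry have density at most p^(12*k)/p^(15*k).\<close>

lemma sum_carries: 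
  "(\<Sum>a<p^(15*k). \<Sum>n<p^(15*k). carries k h a n) \<le> p^(6*k) * p^(15*k) * p^(12*k)"
proof -
  define Q where "Q = p^(15*k)"
  define \<chi> where "\<chi> y = (if Q \<le> y mod Q + p^(12*k) then 1 else (0::int))" for y
  have "int (carries k h a n) = (\<Sum>j<p^(6*k). \<chi> (a+h*j*n))" for a n
  proof -
    have "(\<Sum>j<p^(6*k). \<chi> (a+h*j*n)) = (\<Sum>j\<in>{j. j < p^(6*k) \<and> Q \<le> (a+h*j*n) mod Q + p^(12*k)}. 1)"
      by (rule sum.mono_neutral_cong_right) (auto simp: \<chi>_def)
    thus ?thesis by (simp add: carries_def Q_def)
  qed
  hence "int (\<Sum>a<Q. \<Sum>n<Q. carries k h a n) = (\<Sum>a<Q. \<Sum>n<Q. \<Sum>j<p^(6*k). \<chi> (a+h*j*n))" by simp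
  also have "\<dots> = (\<Sum>n<Q. \<Sum>a<Q. \<Sum>j<p^(6*k). \<chi> (h*j*n+a))" by (subst sum.swap) (simp add: add.commute)
  also have "\<dots> = (\<Sum>n<Q. \<Sum>j<p^(6*k). \<Sum>a<Q. \<chi> (h*j*n+a))" by (intro sum.cong refl sum.swap)
  also have "\<dots> = (\<Sum>n<Q. \<Sum>j<p^(6*k). \<Sum>a<Q. \<chi> a)"
    by (intro sum.cong refl sum_periodic_shift) (simp add: \<chi>_def)
  also have "(\<Sum>a<Q. \<chi> a) \<le> p^(12*k)"
  proof -
    have "(\<Sum>a<Q. \<chi> a) = (\<Sum>a\<in>{Q-p^(12*k)..<Q}. 1)"
      by (rule sum.mono_neutral_cong_right) (auto simp: \<chi>_def)
    also have "\<dots> = int (Q - (Q-p^(12*k)))" by simp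
    also have "\<dots> \<le> int (p^(12*k))" by (subst of_nat_le_iff) arith
    finally show ?thesis .
  qed
  hence "(\<Sum>n<Q. \<Sum>j<p^(6*k). \<Sum>a<Q. \<chi> a) \<le> (\<Sum>n<Q. \<Sum>j<p^(6*k). int (p^(12*k)))"
    by (intro sum_mono)
  also have "\<dots> = int (p^(6*k) * Q * p^(12*k))" by simp
  finally show ?thesis unfolding Q_def by (simp only: of_nat_le_iff)
qed

lemma sum_envelope_le:
  fixes k h r c :: nat and l :: "nat \<Rightarrow> complex"
  defines "Q \<equiv> p^(15*k)" and "J \<equiv> p^(6*k)"
  assumes h: "1 \<le> h" "h \<le> p" and nd: "\<not> p^(3*k+1) dvd h*r" and l1: "\<And>j. norm (l j) = 1"
  shows "(\<Sum>a<Q. \<Sum>n<Q. envelope k h r c l a n) \<le> 14*(real J)^2*(real Q)^2*decay^k"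
proof -
  have "(\<Sum>a<Q. \<Sum>n<Q. envelope k h r c l a n) = 
     2 * (\<Sum>a<Q. \<Sum>n<Q. (norm (\<Sum>j<J. l j * trunc_corr (15*k) (h*j*r+c) (a+h*j*n)))^2) 
     + 8 * J * real (\<Sum>a<Q. \<Sum>n<Q. carries k h a n)"
    by (simp add: envelope_def sum.distrib J_def sum_distrib_left)
  also have "\<dots> \<le> 2 * (3*(real J)^2*(real Q)^2*decay^k) + 8 * J * real (J * Q * p^(12*k))"
    using mean_square_le[OF h nd, of l c, OF l1] sum_carries[of k h]
    unfolding Q_def J_def by (intro add_mono mult_left_mono of_nat_mono) simp_all
  also have "real (J * Q * p^(12*k)) = J * (real Q)^2 * (1/p^(3*k))"
  proof -
    have "real Q = p^(12*k) * p^(3*k)" by (simp add: Q_def flip: power_add)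
    thus ?thesis by (simp add: power2_eq_square)
  qed
  also have "2 * (3*(real J)^2*(real Q)^2*decay^k) + 8 * J * (J * (real Q)^2 * (1/p^(3*k)))
     \<le> 2 * (3*(real J)^2*(real Q)^2*decay^k) + 8 * J * (J * (real Q)^2 * decay^k)"
    using inverse_p_power_le_decay[of k] by (intro add_left_mono mult_left_mono) auto
  also have "\<dots> = 14*(real J)^2*(real Q)^2*decay^k" by (simp add: power2_eq_square)
  finally show ?thesis .
qed

text \<open>An index j without a carry contributes exactly its truncated correlation; each index in
  B changes the sum by at most 2. Squaring |g| + 2*|B| gives 2*|g|^2 + 8*|B|^2, and |B| \<le> J
  makes the last term linear in the number of carries, so that it can be averaged by
  \<open>sum_carries\<close>.\<close>

lemma norm_correlation_le_envelope:
  assumes y: "\<And>j. j < p^(6*k) \<Longrightarrow> [y j = a+h*j*n] (mod p^(15*k))"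
    and s: "\<And>j. j < p^(6*k) \<Longrightarrow> h*j*r+c < p^(12*k)" and l1: "\<And>j. norm (l j) = 1"
  shows "(norm (\<Sum>j<p^(6*k). l j * (f (y j) * cnj (f (y j + (h*j*r+c))))))^2 \<le> envelope k h r c l a n"
proof -
  define J where "J = p^(6*k)"
  define B where "B = {j. j < J \<and> p^(15*k) \<le> (a+h*j*n) mod p^(15*k) + p^(12*k)}"
  define x where "x = (\<Sum>j<J. l j * (f (y j) * cnj (f (y j + (h*j*r+c)))))"
  define g where "g = (\<Sum>j<J. l j * trunc_corr (15*k) (h*j*r+c) (a+h*j*n))"
  have cardB: "card B = carries k h a n" by (simp add: carries_def B_def J_def)
  have "card B \<le> card {..<J}" by (rule card_mono) (auto simp: B_def)
  hence BJ: "real (card B) \<le> real J" by simp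
  have eq: "f (y j) * cnj (f (y j + (h*j*r+c))) = trunc_corr (15*k) (h*j*r+c) (a+h*j*n)" if "j < J" "j \<notin> B" for j
  proof -
    have m: "y j mod p^(15*k) = (a+h*j*n) mod p^(15*k)" using y that by (auto simp: J_def cong_def)
    have "(a+h*j*n) mod p^(15*k) + p^(12*k) < p^(15*k)" using that by (auto simp: B_def)
    hence "y j mod p^(15*k) + (h*j*r+c) < p^(15*k)"
      using s[of j] that(1) by (simp add: m J_def)
    hence "f (y j) * cnj (f (y j + (h*j*r+c))) = trunc_corr (15*k) (h*j*r+c) (y j)" by (rule trunc_corr_eq)
    also have "\<dots> = trunc_corr (15*k) (h*j*r+c) (a+h*j*n)" by (metis trunc_corr_mod m)
    finally show ?thesis .
  qed
  have "x - g = (\<Sum>j<J. l j * (f (y j) * cnj (f (y j + (h*j*r+c))) - trunc_corr (15*k) (h*j*r+c) (a+h*j*n)))"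
    by (simp add: x_def g_def sum_subtractf right_diff_distrib)
  also have "norm \<dots> \<le> (\<Sum>j<J. if j \<in> B then 2 else 0)"
  proof (rule sum_norm_le)
    fix j assume j: "j \<in> {..<J}"
    have "norm (f (y j) * cnj (f (y j + (h*j*r+c))) - trunc_corr (15*k) (h*j*r+c) (a+h*j*n)) \<le> 2"
      by (rule order.trans[OF norm_triangle_ineq4]) (simp add: norm_mult)
    thus "norm (l j * (f (y j) * cnj (f (y j + (h*j*r+c))) - trunc_corr (15*k) (h*j*r+c) (a+h*j*n))) \<le> (if j \<in> B then 2 else 0)"
      using eq[of j] j by (auto simp: norm_mult l1)
  qed
  also have "(\<Sum>j<J. if j \<in> B then 2 else 0) = (\<Sum>j\<in>B. (2::real))"
    by (rule sum.mono_neutral_cong_right) (auto simp: B_def)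
  finally have d: "norm (x - g) \<le> 2 * card B" by simp
  have "norm x \<le> norm g + 2 * card B" using norm_triangle_sub[of x g] d by linarith
  hence "(norm x)^2 \<le> (norm g + 2 * card B)^2" by (intro power_mono) auto
  also have "\<dots> \<le> 2 * (norm g)^2 + 2 * (2 * real (card B))^2"
    using sum_squares_bound[of "norm g" "2 * card B"] by (simp add: power2_eq_square algebra_simps)
  also have "\<dots> \<le> 2 * (norm g)^2 + 8 * J * card B"
    using mult_right_mono[OF BJ, of "real (card B)"] by (simp add: power2_eq_square)
  finally show ?thesis by (simp add: x_def g_def envelope_def cardB J_def)
qed

end

section \<open>Counting returns of rotations\<close>

text \<open>The orbit winds around the circle of length P at most K*s/P + 2 times, and during each
  turn at most D/s + 1 points fall into a window of length D.\<close>

lemma card_rotation_pos: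
  fixes t s P D :: int and K :: nat
  assumes s: "s > 0" and P: "P > 0" and D: "D \<ge> 0"
  shows "real (card {l. l < K \<and> (t + int l * s) mod P < D}) \<le> (K*s/P + 2) * (D/s + 1)"
proof -
  define A where "A = {l. l < K \<and> (t + int l * s) mod P < D}"
  define q where "q l = (t + int l * s) div P" for l
  have finA: "finite A" by (simp add: A_def)
  have fib: "card {l\<in>A. q l = y} \<le> nat (D div s) + 1" for y
  proof (cases "{l\<in>A. q l = y} = {}")
    case False
    define F where "F = {l\<in>A. q l = y}"
    have finF: "finite F" using finA by (simp add: F_def)
    define l0 where "l0 = Min F"
    have l0: "l0 \<in> F" unfolding l0_def using finF False by (intro Min_in) (auto simp: F_def)
    have "F \<subseteq> {l0..l0 + nat (D div s)}"
    proof
      fix l assume l: "l \<in> F"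
      have le: "l0 \<le> l" unfolding l0_def using finF l by simp
      have qx: "t + int x * s = q x * P + (t + int x * s) mod P" for x
        unfolding q_def by (rule div_mult_mod_eq[symmetric])
      have a: "t + int l * s = y*P + (t + int l * s) mod P" "t + int l0 * s = y*P + (t + int l0 * s) mod P"
        using l l0 qx[of l] qx[of l0] by (simp_all add: F_def)
      have "(t + int l0 * s) mod P \<ge> 0" "(t + int l * s) mod P < D" using l P by (auto simp: F_def A_def)
      hence "int l * s - int l0 * s \<le> D" using a by linarith
      hence "(int l - int l0) * s \<le> D" by (simp add: left_diff_distrib)
      hence "int l - int l0 \<le> D div s" using s zdiv_mono1[of "(int l - int l0) * s" D s] by simp
      thus "l \<in> {l0..l0 + nat (D div s)}" using le by auto
    qed
    hence "card F \<le> card {l0..l0 + nat (D div s)}" by (intro card_mono) auto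
    thus ?thesis by (simp add: F_def)
  next
    case True
    show ?thesis unfolding True by simp
  qed
  have img: "q ` A \<subseteq> {t div P..(t + int K * s) div P}"
  proof
    fix y assume "y \<in> q ` A"
    then obtain l where l: "l < K" "y = (t + int l * s) div P" by (auto simp: A_def q_def)
    have "t \<le> t + int l * s" "t + int l * s \<le> t + int K * s" using l s by (auto intro: mult_right_mono)
    thus "y \<in> {t div P..(t + int K * s) div P}" using l P by (auto intro: zdiv_mono1)
  qed
  have "card (q ` A) \<le> card {t div P..(t + int K * s) div P}" by (rule card_mono[OF _ img]) simp
  hence "real (card (q ` A)) \<le> real (nat ((t + int K * s) div P - t div P + 1))" by simp
  also have "\<dots> \<le> K*s/P + 2"
  proof -
    have "t div P \<le> (t + int K * s) div P" using s P by (intro zdiv_mono1) auto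
    moreover have "real_of_int ((t + int K * s) div P) \<le> real_of_int (t + int K * s) / P"
      by (rule real_of_int_div4)
    moreover have "real_of_int t / P - 1 \<le> real_of_int (t div P)"
      using real_of_int_div3[of t P] by linarith
    ultimately show ?thesis by (simp add: add_divide_distrib)
  qed
  finally have c1: "real (card (q ` A)) \<le> K*s/P + 2" .
  have c2: "real (nat (D div s) + 1) \<le> D/s + 1"
    using real_of_int_div4[of D s] D s by (simp add: pos_imp_zdiv_nonneg_iff)
  have "card A = card (\<Union>y\<in>q`A. {l\<in>A. q l = y})" by (rule arg_cong[of _ _ card]) auto
  also have "\<dots> \<le> (\<Sum>y\<in>q`A. card {l\<in>A. q l = y})" using finA by (intro card_UN_le) simp
  also have "\<dots> \<le> card (q`A) * (nat (D div s) + 1)" using sum_bounded_above[of "q`A", OF fib] by simp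
  finally have "real (card A) \<le> real (card (q`A)) * real (nat (D div s) + 1)"
    by (simp only: of_nat_le_iff flip: of_nat_mult)
  also have "\<dots> \<le> (K*s/P + 2) * (D/s + 1)" using c1 c2 s P D by (intro mult_mono) auto
  finally show ?thesis by (simp add: A_def)
qed

lemma card_rotation:
  fixes t s P D :: int and K :: nat
  assumes s: "s \<noteq> 0" and P: "P > 0" and D: "D \<ge> 0"
  shows "real (card {l. l < K \<and> (t + int l * s) mod P < D}) \<le> (K*\<bar>s\<bar>/P + 2) * (D/\<bar>s\<bar> + 1)"
proof (cases "s > 0")
  case True thus ?thesis using card_rotation_pos[of s P D K t] P D by simp
next
  case False
  hence s': "-s > 0" using s by simp
  \<comment> \<open>Reading the orbit backwards, l to K-1-l, turns a negative step into a positive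
    one; t' is its last point.\<close>
  define t' where "t' = t + (int K - 1) * s"
  have "{l. l < K \<and> (t + int l * s) mod P < D} \<subseteq> (\<lambda>l. K-1-l) ` {l. l < K \<and> (t' + int l * (-s)) mod P < D}"
  proof
    fix l assume l: "l \<in> {l. l < K \<and> (t + int l * s) mod P < D}"
    have "t' + int (K-1-l) * (-s) = t + int l * s"
      using l by (simp add: t'_def of_nat_diff algebra_simps)
    thus "l \<in> (\<lambda>l. K-1-l) ` {l. l < K \<and> (t' + int l * (-s)) mod P < D}"
      using l by (intro image_eqI[of _ _ "K-1-l"]) auto
  qed
  hence "card {l. l < K \<and> (t + int l * s) mod P < D} \<le> card ((\<lambda>l. K-1-l) ` {l. l < K \<and> (t' + int l * (-s)) mod P < D})"
    by (intro card_mono) auto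
  also have "\<dots> \<le> card {l. l < K \<and> (t' + int l * (-s)) mod P < D}" by (intro card_image_le) auto
  also have "real \<dots> \<le> (K*(-s)/P + 2) * (D/(-s) + 1)"
    using card_rotation_pos[OF s' P D, of K t'] by simp
  finally show ?thesis using False by simp
qed

text \<open>Dirichlet's approximation theorem for g/P, cleared of denominators: Q+1 multiples are
  sorted into Q boxes by F.\<close>

lemma dirichlet_int:
  fixes g P :: int and Q :: nat
  assumes P: "P > 0" and Q: "Q > 0"
  shows "\<exists>b\<in>{1..Q}. \<exists>z. \<bar>int b * g - z * P\<bar> * int Q \<le> P"
proof -
  define F where "F b = (int Q * ((int b * g) mod P)) div P" for b :: nat
  have "F ` {0..Q} \<subseteq> {0..<int Q}"
  proof
    fix y assume "y \<in> F ` {0..Q}"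
    then obtain b where b: "y = (int Q * ((int b * g) mod P)) div P" by (auto simp: F_def)
    have "int Q * ((int b * g) mod P) < int Q * P" using P Q by simp
    moreover have "int Q * ((int b * g) mod P) = y * P + (int Q * ((int b * g) mod P)) mod P"
      unfolding b by (rule div_mult_mod_eq[symmetric])
    moreover have "(int Q * ((int b * g) mod P)) mod P \<ge> 0" using P by simp
    ultimately have "y * P < int Q * P" by linarith
    hence "y < int Q" using P by simp
    moreover have "0 \<le> y" unfolding b using P by (simp add: pos_imp_zdiv_nonneg_iff)
    ultimately show "y \<in> {0..<int Q}" by simp
  qed
  hence "card (F ` {0..Q}) \<le> card {0..<int Q}" by (intro card_mono) auto
  hence "card (F ` {0..Q}) < card {0..Q}" by simp
  hence "\<not> inj_on F {0..Q}" by (rule pigeonhole)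
  then obtain x y where xy: "x \<le> Q" "y \<le> Q" "x < y" "F x = F y"
    unfolding inj_on_def by (metis atLeastAtMost_iff linorder_neqE_nat)
  define m where "m x = (int x * g) mod P" for x :: nat
  have "\<bar>int Q * m y - int Q * m x\<bar> \<le> P"
  proof -
    have "int Q * m x = P * F x + (int Q * m x) mod P" "int Q * m y = P * F y + (int Q * m y) mod P"
      by (simp_all add: F_def m_def)
    moreover have "0 \<le> (int Q * m x) mod P" "(int Q * m x) mod P < P" "0 \<le> (int Q * m y) mod P" "(int Q * m y) mod P < P"
      using P by auto
    ultimately show ?thesis unfolding xy(4) by linarith
  qed
  hence "\<bar>m y - m x\<bar> * int Q \<le> P"
    by (simp add: right_diff_distrib[symmetric] abs_mult mult.commute)
  moreover have "m y - m x = int (y-x) * g - ((int y * g) div P - (int x * g) div P) * P"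
    using xy(3) by (simp add: m_def minus_div_mult_eq_mod[symmetric] of_nat_diff algebra_simps)
  moreover have "y - x \<in> {1..Q}" using xy by auto
  ultimately show ?thesis by metis
qed

text \<open>Says that g/P is not too close to any fraction with denominator at most Q, so that a
  rotation by g does not linger near a short cycle.\<close>

definition well_spread :: "int \<Rightarrow> int \<Rightarrow> nat \<Rightarrow> int \<Rightarrow> bool" where
  "well_spread \<sigma> P Q g \<longleftrightarrow> (\<forall>b\<in>{1..Q}. \<forall>z. \<sigma> \<le> \<bar>int b * g - z * P\<bar>)"

text \<open>Take b from Dirichlet's theorem and split l modulo b. Along each class the rotation has
  the step s = b*g - z*P with \<sigma> \<le> |s| \<le> P/Q \<le> D: it is slow enough not to jump
  over the window, and by the condition on H fast enough to wind around often. So each class meets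
  the window in the expected proportion 1/Q up to a constant.\<close>

lemma card_rotation_well_spread:
  fixes t g P D \<sigma> :: int and H Q :: nat
  assumes ws: "well_spread \<sigma> P Q g" and \<sigma>: "\<sigma> > 0" and P: "P > 0" and Q: "Q > 0"
    and D: "P \<le> D * int Q" "D * int Q \<le> 2*P" and H: "8*P*int Q \<le> int H * \<sigma>"
  shows "real (card {l. l < H \<and> (t + int l * g) mod P < D}) \<le> 6 * H / Q"
proof -
  obtain b z where b: "b \<in> {1..Q}" and bz: "\<bar>int b * g - z * P\<bar> * int Q \<le> P"
    using dirichlet_int[OF P Q] by blast
  define s where "s = int b * g - z * P"
  have s\<sigma>: "\<sigma> \<le> \<bar>s\<bar>" using ws b unfolding well_spread_def s_def by blast
  have sQ: "\<bar>s\<bar> * int Q \<le> P" using bz by (simp add: s_def)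
  have s0: "s \<noteq> 0" using s\<sigma> \<sigma> by auto
  have D0: "D > 0" using D(1) P Q by (metis less_le_trans zero_less_mult_pos2 of_nat_0_less_iff)
  have sD: "\<bar>s\<bar> \<le> D" using sQ D(1) Q by (metis mult_le_cancel_right_pos of_nat_0_less_iff order.trans)
  define K where "K = H div b + 1"
  have "{l. l < H \<and> (t + int l * g) mod P < D} \<subseteq> 
     (\<Union>l0<b. (\<lambda>l'. l0 + b*l') ` {l'. l' < K \<and> (t + int l0 * g + int l' * s) mod P < D})"
  proof
    fix l assume l: "l \<in> {l. l < H \<and> (t + int l * g) mod P < D}"
    have "l div b \<le> H div b" using l by (intro div_le_mono) auto
    hence 1: "l div b < K" by (simp add: K_def)
    have 2: "l = l mod b + b * (l div b)" by simp
    have "t + int (l mod b) * g + int (l div b) * s = t + int (l mod b + b * (l div b)) * g + (- int (l div b) * z) * P"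
      by (simp only: s_def of_nat_add of_nat_mult) (simp add: algebra_simps)
    hence "(t + int (l mod b) * g + int (l div b) * s) mod P = (t + int l * g) mod P"
      using 2 by (metis mod_mult_self1)
    hence "l \<in> (\<lambda>l'. l mod b + b*l') ` {l'. l' < K \<and> (t + int (l mod b) * g + int l' * s) mod P < D}"
      using 1 2 l by (intro image_eqI[of _ _ "l div b"]) auto
    moreover have "l mod b < b" using b by simp
    ultimately show "l \<in> (\<Union>l0<b. (\<lambda>l'. l0 + b*l') ` {l'. l' < K \<and> (t + int l0 * g + int l' * s) mod P < D})"
      by blast
  qed
  hence "card {l. l < H \<and> (t + int l * g) mod P < D} \<le> 
     card (\<Union>l0<b. (\<lambda>l'. l0 + b*l') ` {l'. l' < K \<and> (t + int l0 * g + int l' * s) mod P < D})"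
    by (intro card_mono) auto
  also have "\<dots> \<le> (\<Sum>l0<b. card ((\<lambda>l'. l0 + b*l') ` {l'. l' < K \<and> (t + int l0 * g + int l' * s) mod P < D}))"
    by (rule card_UN_le) simp
  also have "\<dots> \<le> (\<Sum>l0<b. card {l'. l' < K \<and> (t + int l0 * g + int l' * s) mod P < D})"
    by (intro sum_mono card_image_le) auto
  finally have "real (card {l. l < H \<and> (t + int l * g) mod P < D}) \<le> 
     (\<Sum>l0<b. real (card {l'. l' < K \<and> (t + int l0 * g + int l' * s) mod P < D}))"
    by (simp only: of_nat_le_iff flip: of_nat_sum)
  also have "\<dots> \<le> (\<Sum>l0<b. (K*\<bar>s\<bar>/P + 2) * (D/\<bar>s\<bar> + 1))"
    using s0 P D0 by (intro sum_mono card_rotation) auto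
  also have "\<dots> = b * ((K*\<bar>s\<bar>/P + 2) * (D/\<bar>s\<bar> + 1))" by simp
  also have "\<dots> \<le> 6 * H / Q"
  proof -
    define S where "S = real_of_int \<bar>s\<bar>"
    define d where "d = real_of_int D"
    define P' where "P' = real_of_int P"
    define q where "q = real Q"
    define \<sigma>' where "\<sigma>' = real_of_int \<sigma>"
    have S: "S > 0" using s0 by (simp add: S_def)
    have P': "P' > 0" using P by (simp add: P'_def)
    have q: "q \<ge> 1" using Q by (simp add: q_def)
    have i1: "S \<le> d" using sD by (simp add: S_def d_def)
    have i2: "d * q \<le> 2*P'" using of_int_le_iff[of "D * int Q" "2*P", where ?'a = real, THEN iffD2, OF D(2)] unfolding d_def q_def P'_def by simp
    have i3: "8*P'*q \<le> H*\<sigma>'" using of_int_le_iff[of "8*P*int Q" "int H * \<sigma>", where ?'a = real, THEN iffD2, OF H] unfolding P'_def q_def \<sigma>'_def by simp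
    have i4: "\<sigma>' \<le> S" using s\<sigma> by (simp add: \<sigma>'_def S_def)
    have \<sigma>': "\<sigma>' > 0" using \<sigma> by (simp add: \<sigma>'_def)
    have i5: "S * q \<le> P'" using of_int_le_iff[of "\<bar>s\<bar> * int Q" P, where ?'a = real, THEN iffD2, OF sQ] unfolding S_def q_def P'_def by simp
    have bq: "1 \<le> real b" "real b \<le> q" using b by (auto simp: q_def)
    have K: "real K \<le> H / b + 1" unfolding K_def using of_nat_div_le_of_nat[of H b, where ?'a = real] by simp
    have "d/S + 1 \<le> 2*d/S" using i1 S by (simp add: field_simps)
    hence "b * ((K*S/P' + 2) * (d/S + 1)) \<le> b * ((K*S/P' + 2) * (2*d/S))"
      using S P' by (intro mult_left_mono) auto
    also have "\<dots> = 2 * b * K * (d/P') + 4 * b * d / S" using S P' by (simp add: field_simps)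
    also have "\<dots> \<le> 2 * b * K * (2/q) + 4 * b * (2*P'/q) / S"
    proof -
      have "d/P' \<le> 2/q" "d \<le> 2*P'/q" using i2 P' q by (auto simp: field_simps)
      thus ?thesis using S by (intro add_mono mult_left_mono divide_right_mono) auto
    qed
    also have "\<dots> \<le> 4 * (H + q) / q + 8 * P' / \<sigma>'"
    proof -
      have "b * K \<le> H + q" using K bq by (simp add: field_simps)
      hence "2 * b * K * (2/q) \<le> 4 * (H + q) / q" using q by (simp add: field_simps)
      moreover have "4 * b * (2*P'/q) / S \<le> 8 * P' / \<sigma>'"
      proof -
        have "4 * b * (2*P'/q) \<le> 4 * q * (2*P'/q)" using bq P' q by (intro mult_right_mono mult_left_mono) auto
        also have "\<dots> = 8*P'" using q by simp
        finally have "4 * b * (2*P'/q) / S \<le> 8*P' / S" using S by (intro divide_right_mono) auto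
        also have "\<dots> \<le> 8*P'/\<sigma>'" using i4 \<sigma>' P' by (intro divide_left_mono) auto
        finally show ?thesis .
      qed
      ultimately show ?thesis by linarith
    qed
    also have "\<dots> \<le> 6 * H / q"
    proof -
      have h1: "8 * P' / \<sigma>' \<le> H / q" using i3 \<sigma>' q by (simp add: field_simps)
      have "\<sigma>' * q \<le> P'" using i4 i5 q by (meson mult_right_mono order.trans zero_le_one)
      hence "8 * (\<sigma>' * q) * q \<le> H*\<sigma>'" using i3 q by (smt (verit) mult_right_mono)
      hence "\<sigma>' * (8 * q * q) \<le> \<sigma>' * H" by (simp add: mult_ac)
      hence "8 * q * q \<le> H" using \<sigma>' by simp
      moreover have "8*q*1 \<le> 8*q*q" using q by (intro mult_left_mono) auto
      ultimately have "4 * q \<le> H" using q by linarith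
      hence "4 * (H + q) / q \<le> 5 * H / q" using q by (intro divide_right_mono) auto
      thus ?thesis using h1 by (simp add: field_simps)
    qed
    finally show ?thesis by (simp add: S_def d_def P'_def q_def)
  qed
  finally show ?thesis .
qed

text \<open>If spreading fails at the denominator b, then b*g0 + \<sigma> + n*b*h lies in [0,
  2*\<sigma>) modulo P. This is again a rotation, now in n with step b*h \<le> 2*\<sigma>, so
  \<open>card_rotation\<close> counts the failures.\<close>

lemma card_not_well_spread:
  fixes P \<sigma> g0 h :: int and N Q :: nat
  assumes P: "P > 0" and \<sigma>: "\<sigma> > 0" "2*\<sigma> \<le> P" and h: "h > 0" "int Q * h \<le> 2*\<sigma>"
  shows "real (card {n. n < N \<and> \<not> well_spread \<sigma> P Q (g0 + int n * h)}) \<le> 4*N*Q*\<sigma>/P + 8*Q*\<sigma>/h"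
proof -
  define B where "B b = {n. n < N \<and> (int b * g0 + \<sigma> + int n * (int b * h)) mod P < 2*\<sigma>}" for b :: nat
  have "{n. n < N \<and> \<not> well_spread \<sigma> P Q (g0 + int n * h)} \<subseteq> (\<Union>b\<in>{1..Q}. B b)"
  proof
    fix n assume n: "n \<in> {n. n < N \<and> \<not> well_spread \<sigma> P Q (g0 + int n * h)}"
    then obtain b z where b: "b \<in> {1..Q}" and z: "\<bar>int b * (g0 + int n * h) - z * P\<bar> < \<sigma>"
      unfolding well_spread_def by (auto simp: not_le)
    define x where "x = int b * (g0 + int n * h) + \<sigma> - z*P"
    have x: "0 \<le> x" "x < 2*\<sigma>" using z by (auto simp: x_def)
    have "(int b * g0 + \<sigma> + int n * (int b * h)) = x + z*P" by (simp add: x_def algebra_simps)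
    hence "(int b * g0 + \<sigma> + int n * (int b * h)) mod P = x" using x \<sigma> by simp
    thus "n \<in> (\<Union>b\<in>{1..Q}. B b)" using n x b by (auto simp: B_def)
  qed
  hence "card {n. n < N \<and> \<not> well_spread \<sigma> P Q (g0 + int n * h)} \<le> card (\<Union>b\<in>{1..Q}. B b)"
    by (intro card_mono) (auto simp: B_def)
  also have "\<dots> \<le> (\<Sum>b\<in>{1..Q}. card (B b))" by (rule card_UN_le) simp
  finally have "real (card {n. n < N \<and> \<not> well_spread \<sigma> P Q (g0 + int n * h)}) \<le> (\<Sum>b\<in>{1..Q}. real (card (B b)))"
    by (simp only: of_nat_le_iff flip: of_nat_sum)
  also have "\<dots> \<le> (\<Sum>b\<in>{1..Q}. 4*N*\<sigma>/P + 8*\<sigma>/h)"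
  proof (rule sum_mono)
    fix b assume b: "b \<in> {1..Q}"
    define c where "c = real b * h"
    define s where "s = real_of_int \<sigma>"
    define P' where "P' = real_of_int P"
    have c0: "c > 0" using b h by (simp add: c_def)
    have bh: "int b * h \<le> 2*\<sigma>"
    proof -
      have "int b * h \<le> int Q * h" using b h by (intro mult_right_mono) auto
      thus ?thesis using h by linarith
    qed
    have c2: "c \<le> 2*s" using of_int_le_iff[of "int b * h" "2*\<sigma>", where ?'a = real, THEN iffD2, OF bh] unfolding c_def s_def by simp
    have hc: "real_of_int h \<le> c" using b h unfolding c_def by (simp add: mult_le_cancel_right1)
    have P0: "P' > 0" "s > 0" using P \<sigma> by (auto simp: P'_def s_def)
    have "real (card (B b)) \<le> (N*\<bar>int b * h\<bar>/P + 2) * ((2*\<sigma>)/\<bar>int b * h\<bar> + 1)"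
      unfolding B_def using b h P \<sigma> by (intro card_rotation) auto
    also have "\<dots> = (N*c/P' + 2) * (2*s/c + 1)" using h by (simp add: c_def s_def P'_def abs_mult)
    also have "\<dots> \<le> (N*c/P' + 2) * (4*s/c)" using c2 c0 P0 by (intro mult_left_mono) (auto simp: field_simps)
    also have "\<dots> = 4*N*s/P' + 8*s/c" using c0 P0 by (simp add: field_simps)
    also have "\<dots> \<le> 4*N*s/P' + 8*s/h" using hc h P0 c0 by (intro add_left_mono divide_left_mono) auto
    finally show "real (card (B b)) \<le> 4*N*\<sigma>/P + 8*\<sigma>/h" by (simp add: s_def P'_def)
  qed
  also have "\<dots> = 4*N*Q*\<sigma>/P + 8*Q*\<sigma>/h" by (simp add: algebra_simps)
  finally show ?thesis .
qed

section \<open>Residues of window digits for products and squares\<close>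

lemma mod_window:
  fixes y P0 u Q :: nat
  assumes "(y div P0) mod Q = u" "P0 > 0" "Q > 0"
  shows "(int y - int u * int P0) mod (int P0 * int Q) < int P0"
    and "\<exists>w. int y - int u * int P0 = w * (int P0 * int Q) + int (y mod P0)"
proof -
  have "y = y mod P0 + P0 * (y div P0)" by simp
  moreover have "y div P0 = u + Q * (y div P0 div Q)" using assms(1) mult_div_mod_eq[of Q "y div P0"] by simp
  ultimately have "y = y mod P0 + P0 * (u + Q * (y div P0 div Q))" by metis
  hence "int y = int (y mod P0 + P0 * (u + Q * (y div P0 div Q)))" by metis
  hence e: "int y - int u * int P0 = int (y div P0 div Q) * (int P0 * int Q) + int (y mod P0)"
    by (simp only: of_nat_add of_nat_mult) (simp add: algebra_simps)
  thus "\<exists>w. int y - int u * int P0 = w * (int P0 * int Q) + int (y mod P0)" by blast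
  have "int (y mod P0) < int P0" using assms by simp
  moreover have "int P0 \<le> int P0 * int Q" using assms by simp
  ultimately have "int (y mod P0) < int P0 * int Q" by linarith
  hence "(int y - int u * int P0) mod (int P0 * int Q) = int (y mod P0)"
    unfolding e by simp
  thus "(int y - int u * int P0) mod (int P0 * int Q) < int P0" using assms by simp
qed

lemma sum_good_bad:
  fixes w :: "nat \<Rightarrow> real" and a b :: real
  assumes fin: "finite X" and good: "\<And>n. n \<in> X \<Longrightarrow> g n \<Longrightarrow> w n \<le> a" and bad: "\<And>n. n \<in> X \<Longrightarrow> \<not> g n \<Longrightarrow> w n \<le> b"
    and b: "0 \<le> b" "0 \<le> a"
  shows "(\<Sum>n\<in>X. w n) \<le> card X * a + card {n\<in>X. \<not> g n} * b"
proof -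
  have "(\<Sum>n\<in>X. w n) \<le> (\<Sum>n\<in>X. a + (if \<not> g n then b else 0))"
    using good bad b by (intro sum_mono) (auto simp: add_increasing)
  also have "\<dots> = card X * a + (\<Sum>n\<in>{n\<in>X. \<not> g n}. b)"
    using fin by (simp add: sum.distrib sum.inter_filter[symmetric])
  finally show ?thesis by simp
qed

text \<open>For fixed n the products rotate with step N0+n modulo P0*Q, and the digit condition is a
  window of length P0. The choice \<sigma> = Q^3 is what 8*P0 \<le> H*Q allows. Exceptional n are
  not separated by their class modulo Q, so all of them, at most Q^5, are charged with the trivial
  bound H; the length N = Q^7 makes Q^5 equal to N/Q^2.\<close>

lemma card_bilinear_class:
  fixes Q P0 H i0 N0 u v :: nat
  defines "N \<equiv> Q^7"
  assumes Q: "Q \<ge> 16" and P0: "8*Q^5 \<le> P0" and H: "8*P0 \<le> H*Q" and v: "v < Q"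
  shows "real (card {(l,n). l < H \<and> n < N \<and> (N0+n) mod Q = v \<and> ((i0+l)*(N0+n) div P0) mod Q = u}) \<le> 7*H*N/Q^2"
proof -
  define P where "P = int P0 * int Q"
  define \<sigma> where "\<sigma> = int Q^3"
  define X where "X = {n. n < N \<and> (N0+n) mod Q = v}"
  define E where "E n = {l. l < H \<and> ((i0+l)*(N0+n) div P0) mod Q = u}" for n
  define ws where "ws n = well_spread \<sigma> P Q (int N0 + int n * 1)" for n
  have Q0: "Q > 0" "P0 > 0"
  proof -
    show "Q > 0" using Q by simp
    hence "0 < 8*Q^5" by simp
    thus "P0 > 0" using P0 by linarith
  qed
  have P: "P > 0" using Q0 by (simp add: P_def)
  have \<sigma>0: "\<sigma> > 0" using Q0 by (simp add: \<sigma>_def)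
  have "16 * Q^4 \<le> Q * Q^4" using Q by (intro mult_right_mono) auto
  hence Q45: "16 * Q^4 \<le> Q^5" by (simp add: power_numeral_reduce)
  have finX: "finite X" by (simp add: X_def)
  have cardX: "card X = Q^6"
  proof -
    define \<chi> where "\<chi> n = (if n mod Q = v then 1 else (0::int))" for n
    have "int (card X) = (\<Sum>n\<in>X. 1)" by simp
    also have "\<dots> = (\<Sum>n<N. \<chi> (N0+n))"
      by (rule sum.mono_neutral_cong_left) (auto simp: X_def \<chi>_def)
    also have "\<dots> = (\<Sum>n<N. \<chi> n)"
    proof (rule sum_periodic_shift)
      fix n
      have "n mod N mod Q = n mod Q" by (rule mod_mod_cancel) (simp add: N_def)
      thus "\<chi> (n mod N) = \<chi> n" by (simp add: \<chi>_def)
    qed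
    also have "\<dots> = (\<Sum>n\<in>{j. j < Q^6 * Q \<and> j mod Q = v}. 1)"
      by (rule sum.mono_neutral_cong_right) (auto simp: \<chi>_def N_def power_numeral_reduce mult_ac)
    also have "\<dots> = int (card {j. j < Q^6 * Q \<and> j mod Q = v})" by simp
    finally show ?thesis using card_cong_lessThan[OF Q0(1) v, of "Q^6"] by simp
  qed
  have good: "real (card (E n)) \<le> 6*H/Q" if "ws n" for n
  proof -
    have "E n \<subseteq> {l. l < H \<and> (int (i0*(N0+n)) - int u * int P0 + int l * (int N0 + int n * 1)) mod P < int P0}"
    proof
      fix l assume l: "l \<in> E n"
      have "(int ((i0+l)*(N0+n)) - int u * int P0) mod P < int P0"
        using l Q0 unfolding P_def by (intro mod_window(1)) (auto simp: E_def)
      moreover have "int ((i0+l)*(N0+n)) - int u * int P0 = int (i0*(N0+n)) - int u * int P0 + int l * (int N0 + int n * 1)"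
        by (simp add: algebra_simps)
      ultimately show "l \<in> {l. l < H \<and> (int (i0*(N0+n)) - int u * int P0 + int l * (int N0 + int n * 1)) mod P < int P0}"
        using l unfolding E_def by (simp only: mem_Collect_eq)
    qed
    hence "real (card (E n)) \<le> real (card {l. l < H \<and> (int (i0*(N0+n)) - int u * int P0 + int l * (int N0 + int n * 1)) mod P < int P0})"
      by (intro of_nat_mono card_mono) auto
    also have "\<dots> \<le> 6*H/Q"
    proof (rule card_rotation_well_spread)
      show "well_spread \<sigma> P Q (int N0 + int n * 1)" using that by (simp add: ws_def)
      have "(8*P0)*Q^2 \<le> (H*Q)*Q^2" using H by (intro mult_right_mono) auto
      hence "8*(P0*Q)*Q \<le> H*Q^3" by (simp add: power2_eq_square power3_eq_cube mult_ac)
      hence "int (8*(P0*Q)*Q) \<le> int (H*Q^3)" by (simp only: of_nat_le_iff)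
      thus "8*P*int Q \<le> int H * \<sigma>" by (simp add: P_def \<sigma>_def)
    qed (use P \<sigma>0 Q0 in \<open>auto simp: P_def\<close>)
    finally show ?thesis .
  qed
  have badE: "real (card (E n)) \<le> H" for n
  proof -
    have "card (E n) \<le> card {..<H}" by (rule card_mono) (auto simp: E_def)
    thus ?thesis by simp
  qed
  have bad: "real (card {n\<in>X. \<not> ws n}) \<le> Q^5"
  proof -
    have "real (card {n\<in>X. \<not> ws n}) \<le> real (card {n. n < N \<and> \<not> well_spread \<sigma> P Q (int N0 + int n * 1)})"
      by (intro of_nat_mono card_mono) (auto simp: X_def ws_def)
    also have "\<dots> \<le> 4*N*Q*\<sigma>/P + 8*Q*\<sigma>/(1::int)"
    proof (rule card_not_well_spread)
      have "Q^3 \<le> Q^6" using Q0 by (intro power_increasing) auto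
      moreover have "8*Q^5*Q = 8*Q^6" by (simp add: power_numeral_reduce)
      ultimately have "2*Q^3 \<le> 8*Q^5*Q" by linarith
      also have "\<dots> \<le> P0*Q" using P0 by (intro mult_right_mono) auto
      finally have "int (2*Q^3) \<le> int (P0*Q)" by (simp only: of_nat_le_iff)
      thus "2*\<sigma> \<le> P" by (simp add: \<sigma>_def P_def)
      have "Q^1 \<le> Q^3" using Q0 by (intro power_increasing) auto
      hence "Q * 1 \<le> 2*Q^3" by simp
      hence "int (Q * 1) \<le> int (2*Q^3)" by (simp only: of_nat_le_iff)
      thus "int Q * 1 \<le> 2*\<sigma>" by (simp add: \<sigma>_def)
    qed (use P \<sigma>0 in auto)
    also have "\<dots> = 4*real Q^10/P0 + 8*real Q^4"
      using Q0 by (simp add: N_def \<sigma>_def P_def power_numeral_reduce field_simps)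
    also have "\<dots> \<le> real Q^5/2 + real Q^5/2"
    proof (intro add_mono)
      have "real (8*Q^5) \<le> real P0" using P0 by (simp only: of_nat_le_iff)
      hence "real Q^5 * (8*real Q^5) \<le> real Q^5 * real P0" by (intro mult_left_mono) auto
      moreover have "real Q^5 * (8*real Q^5) = 8 * real Q^10" by (simp flip: power_add)
      ultimately show "4*real Q^10/P0 \<le> real Q^5/2" using Q0 by (simp add: field_simps)
      have "real (16*Q^4) \<le> real (Q^5)" using Q45 by (simp only: of_nat_le_iff)
      thus "8*real Q^4 \<le> real Q^5/2" by simp
    qed
    finally show ?thesis by simp
  qed
  have "{(l,n). l < H \<and> n < N \<and> (N0+n) mod Q = v \<and> ((i0+l)*(N0+n) div P0) mod Q = u} = (\<lambda>(n,l). (l,n)) ` (SIGMA n:X. E n)"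
    by (auto simp: X_def E_def image_iff)
  hence "card {(l,n). l < H \<and> n < N \<and> (N0+n) mod Q = v \<and> ((i0+l)*(N0+n) div P0) mod Q = u} \<le> card (SIGMA n:X. E n)"
    by (simp only:) (intro card_image_le finite_SigmaI finX, auto simp: E_def)
  also have "\<dots> = (\<Sum>n\<in>X. card (E n))" by (rule card_SigmaI[OF finX]) (auto simp: E_def)
  finally have "real (card {(l,n). l < H \<and> n < N \<and> (N0+n) mod Q = v \<and> ((i0+l)*(N0+n) div P0) mod Q = u}) \<le> (\<Sum>n\<in>X. real (card (E n)))"
    by (simp only: of_nat_le_iff flip: of_nat_sum)
  also have "\<dots> \<le> card X * (6*H/Q) + card {n\<in>X. \<not> ws n} * real H"
    using finX good badE by (intro sum_good_bad) auto
  also have "\<dots> \<le> real Q^6 * (6*H/Q) + real Q^5 * real H"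
    using bad cardX by (intro add_mono mult_right_mono) auto
  also have "\<dots> = 7*H*N/Q^2" using Q0 by (simp add: N_def power_numeral_reduce field_simps)
  finally show ?thesis .
qed

text \<open>Along \<open>Q^10\<close> steps of length \<open>Q\<close> the quadratic term \<open>(Q*l)^2\<close> stays below \<open>P0\<close>, so that the squares move like a
  rotation with a window enlarged by a factor 2.\<close>

lemma card_square_class:
  fixes Q P0 H i0 u v T N :: nat
  assumes Q: "Q \<ge> 16" and P0: "P0 = Q^22*T" and H: "H = N*Q^11" and N: "Q^10*T \<le> N" and T: "T > 0" and v: "v < Q"
  shows "real (card {i. i < H \<and> (i0+i) mod Q = v \<and> ((i0+i)^2 div P0) mod Q = u}) \<le> 7*H/Q^2"
proof -
  define P where "P = int P0 * int Q"
  \<comment> \<open>With L = Q^10 and P = Q^23*T the requirement 8*P*Q \<le> L*\<sigma> needs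
    \<sigma> \<ge> 8*Q^14*T; the power Q^15 suffices since Q \<ge> 16.\<close>
  define \<sigma> where "\<sigma> = int Q^15 * int T"
  define L where "L = Q^10"
  have Q0: "Q > 0" "P0 > 0" using Q P0 T by auto
  define x0 where "x0 = nat ((int v - int i0) mod int Q)"
  define s where "s q = i0 + x0 + q*(Q*L)" for q
  define E where "E q = {l. l < L \<and> ((s q + Q*l)^2 div P0) mod Q = u}" for q
  \<comment> \<open>In (s q + Q*l)^2 the coefficient of l is 2*Q*s q. It is linear in q, namely g0 +
    q*h, so \<open>card_not_well_spread\<close> applies to the steps themselves.\<close>
  define g0 where "g0 = int (2*Q*(i0+x0))"
  define h where "h = int (2*Q^12)"
  define ws where "ws q = well_spread \<sigma> P Q (g0 + int q * h)" for q
  have P: "P > 0" using Q0 by (simp add: P_def)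
  have \<sigma>0: "\<sigma> > 0" using Q0 T by (simp add: \<sigma>_def)
  have sub: "{i. i < H \<and> (i0+i) mod Q = v \<and> ((i0+i)^2 div P0) mod Q = u} \<subseteq> (\<lambda>(q,l). q*(Q*L) + (x0 + Q*l)) ` (SIGMA q:{..<N}. E q)"
  proof
    fix i assume i: "i \<in> {i. i < H \<and> (i0+i) mod Q = v \<and> ((i0+i)^2 div P0) mod Q = u}"
    define q where "q = i div (Q*L)"
    define x where "x = i mod (Q*L)"
    define l where "l = x div Q"
    have "H = N*(Q*L)" by (simp add: H L_def power_numeral_reduce)
    hence qN: "q < N" using i by (simp add: q_def less_mult_imp_div_less)
    have xl: "x < Q*L" using Q0 by (simp add: x_def L_def)
    hence lL: "l < L" by (simp add: l_def less_mult_imp_div_less mult.commute)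
    have "x mod Q = i mod Q" by (simp add: x_def mod_mod_cancel)
    moreover have "i mod Q = x0"
    proof -
      have "(int i) mod int Q = (int (i0+i) - int i0) mod int Q" by simp
      also have "\<dots> = (int (i0+i) mod int Q - int i0) mod int Q" by (simp only: mod_diff_left_eq)
      also have "int (i0+i) mod int Q = int v" using i by (metis (mono_tags, lifting) mem_Collect_eq of_nat_mod)
      finally have "int (i mod Q) = (int v - int i0) mod int Q" by (simp add: of_nat_mod)
      thus ?thesis unfolding x0_def by (metis nat_int)
    qed
    ultimately have xx: "x = x0 + Q*l" by (metis l_def add.commute mult.commute div_mult_mod_eq)
    have "i = q*(Q*L) + x" unfolding q_def x_def by (rule div_mult_mod_eq[symmetric])
    hence ii: "i = q*(Q*L) + (x0 + Q*l)" using xx by simp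
    have "i0 + i = s q + Q*l" by (simp add: ii s_def)
    hence "l \<in> E q" using i lL by (simp add: E_def)
    thus "i \<in> (\<lambda>(q,l). q*(Q*L) + (x0 + Q*l)) ` (SIGMA q:{..<N}. E q)"
      using qN ii by (intro image_eqI[of _ _ "(q,l)"]) auto
  qed
  have good: "real (card (E q)) \<le> 6*L/Q" if "ws q" for q
  proof -
    define t where "t = int (s q)^2 + int P0 - int u * int P0"
    have "E q \<subseteq> {l. l < L \<and> (t + int l * (g0 + int q * h)) mod P < 2 * int P0}"
    proof
      fix l assume l: "l \<in> E q"
      obtain w where w: "int ((s q + Q*l)^2) - int u * int P0 = w * P + int ((s q + Q*l)^2 mod P0)"
        using mod_window(2)[of "(s q + Q*l)^2" P0 Q u] l Q0 unfolding P_def E_def by auto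
      define m where "m = int ((s q + Q*l)^2 mod P0) + int P0 - int (Q*l)^2"
      have sm: "(Q*l)^2 < P0"
      proof -
        have "Q*l < Q*L" using l Q0 by (simp add: E_def)
        hence "(Q*l)^2 < (Q*L)^2" by (intro power_strict_mono) auto
        also have "(Q*L)^2 = Q^22" by (simp add: L_def power_mult_distrib flip: power_mult power_add)
        also have "\<dots> \<le> P0" using T by (simp add: P0)
        finally show ?thesis .
      qed
      have b: "0 \<le> m" "m < 2 * int P0"
      proof -
        have "int ((Q*l)^2) < int P0" using sm by (simp only: of_nat_less_iff)
        moreover have "int ((s q + Q*l)^2 mod P0) < int P0" using Q0 by simp
        moreover have "0 \<le> int ((s q + Q*l)^2 mod P0)" "0 \<le> int (Q*l)^2" by simp_all
        ultimately show "0 \<le> m" "m < 2 * int P0" unfolding m_def of_nat_power by linarith+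
      qed
      have gs: "g0 + int q * h = int (2*Q*s q)"
        by (simp add: g0_def h_def s_def L_def power_numeral_reduce algebra_simps)
      have "t + int l * (g0 + int q * h) = int ((s q + Q*l)^2) - int u * int P0 + int P0 - int (Q*l)^2"
        unfolding gs t_def by (simp add: power2_eq_square algebra_simps)
      also have "\<dots> = m + w * P" unfolding w m_def by simp
      finally have "(t + int l * (g0 + int q * h)) mod P = m mod P" by simp
      also have "m mod P \<le> m" using b P by (simp add: zmod_le_nonneg_dividend)
      also note b(2)
      finally show "l \<in> {l. l < L \<and> (t + int l * (g0 + int q * h)) mod P < 2 * int P0}"
        using l by (auto simp: E_def)
    qed
    hence "real (card (E q)) \<le> real (card {l. l < L \<and> (t + int l * (g0 + int q * h)) mod P < 2 * int P0})"
      by (intro of_nat_mono card_mono) auto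
    also have "\<dots> \<le> 6*L/Q"
    proof (rule card_rotation_well_spread)
      show "well_spread \<sigma> P Q (g0 + int q * h)" using that by (simp add: ws_def)
      have "8*(P0*Q)*Q = (8*Q^24)*T" by (simp add: P0 power_numeral_reduce)
      also have "\<dots> \<le> (Q*Q^24)*T" using Q by (intro mult_right_mono) auto
      also have "\<dots> = L * (Q^15*T)" by (simp add: L_def flip: power_add power_Suc)
      finally have "int (8*(P0*Q)*Q) \<le> int (L*(Q^15*T))" by (simp only: of_nat_le_iff)
      thus "8*P*int Q \<le> int L * \<sigma>" by (simp add: P_def \<sigma>_def)
    qed (use P \<sigma>0 Q0 in \<open>auto simp: P_def\<close>)
    finally show ?thesis .
  qed
  have badE: "real (card (E q)) \<le> L" for q
  proof -
    have "card (E q) \<le> card {..<L}" by (rule card_mono) (auto simp: E_def)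
    thus ?thesis by simp
  qed
  have bad: "real (card {q\<in>{..<N}. \<not> ws q}) \<le> N/Q"
  proof -
    have "real (card {q\<in>{..<N}. \<not> ws q}) = real (card {q. q < N \<and> \<not> well_spread \<sigma> P Q (g0 + int q * h)})"
      by (simp add: ws_def)
    also have "\<dots> \<le> 4*N*Q*\<sigma>/P + 8*Q*\<sigma>/h"
    proof (rule card_not_well_spread)
      have "2*(Q^15*T) \<le> Q^23*T"
      proof -
        have "2*Q^15 \<le> Q^8*Q^15" using Q0 Q by (intro mult_right_mono) (auto intro: order.trans[OF _ self_le_power])
        thus ?thesis by (simp flip: power_add)
      qed
      hence "int (2*(Q^15*T)) \<le> int (Q^23*T)" by (simp only: of_nat_le_iff)
      thus "2*\<sigma> \<le> P" by (simp add: \<sigma>_def P_def P0 power_numeral_reduce mult_ac)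
      have "Q*(2*Q^12) \<le> 2*(Q^15*T)"
      proof -
        have "Q*Q^12*1 \<le> Q^15*T" using Q0 T power_increasing[of 13 15 Q] by (intro mult_mono) (auto simp flip: power_Suc)
        thus ?thesis by simp
      qed
      hence "int (Q*(2*Q^12)) \<le> int (2*(Q^15*T))" by (simp only: of_nat_le_iff)
      thus "int Q * h \<le> 2*\<sigma>" by (simp add: \<sigma>_def h_def)
    qed (use P \<sigma>0 Q0 in \<open>auto simp: h_def\<close>)
    also have "\<dots> = 4*N/real Q^7 + 4*real Q^4*T"
      using Q0 T by (simp add: \<sigma>_def P_def P0 h_def power_numeral_reduce field_simps)
    also have "\<dots> \<le> N/(2*Q) + N/(2*Q)"
    proof (intro add_mono)
      have q: "real Q \<ge> 16" using Q by simp
      have "8 * real Q \<le> real Q * real Q" using q by (intro mult_right_mono) auto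
      also have "\<dots> \<le> real Q^7" using power_increasing[of 2 7 "real Q"] q by (simp add: power2_eq_square)
      finally have q7: "8 * real Q \<le> real Q^7" .
      hence "real N * (8 * real Q) \<le> real N * real Q^7" by (intro mult_left_mono) auto
      thus "4*N/real Q^7 \<le> N/(2*Q)" using Q0 by (simp add: field_simps)
      have "real (Q^10*T) \<le> real N" using N by (simp only: of_nat_le_iff)
      moreover have "real Q^4 * T * (8*real Q) \<le> real Q^4 * T * real Q^6"
      proof -
        have "8 * real Q \<le> real Q^6" 
        proof -
          have "8 * real Q \<le> real Q * real Q" using q by (intro mult_right_mono) auto
          also have "\<dots> \<le> real Q^6" using power_increasing[of 2 6 "real Q"] q by (simp add: power2_eq_square)
          finally show ?thesis .
        qed
        thus ?thesis by (intro mult_left_mono) auto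
      qed
      moreover have "real Q^4 * T * real Q^6 = real (Q^10*T)" by (simp flip: power_add)
      ultimately have "real Q^4 * T * (8*real Q) \<le> N" by linarith
      thus "4*real Q^4*T \<le> N/(2*Q)" using Q0 by (simp add: field_simps)
    qed
    also have "\<dots> = N/Q" by (simp add: field_simps)
    finally show ?thesis .
  qed
  have finS: "finite (SIGMA q:{..<N}. E q)" by (auto simp: E_def)
  have "card {i. i < H \<and> (i0+i) mod Q = v \<and> ((i0+i)^2 div P0) mod Q = u} \<le> card (SIGMA q:{..<N}. E q)"
    using surj_card_le[OF finS sub] by simp
  also have "\<dots> = (\<Sum>q<N. card (E q))" by (rule card_SigmaI) (auto simp: E_def)
  finally have "real (card {i. i < H \<and> (i0+i) mod Q = v \<and> ((i0+i)^2 div P0) mod Q = u}) \<le> (\<Sum>q<N. real (card (E q)))"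
    by (simp only: of_nat_le_iff flip: of_nat_sum)
  also have "\<dots> \<le> card {..<N} * (6*L/Q) + card {q\<in>{..<N}. \<not> ws q} * real L"
    using good badE by (intro sum_good_bad) auto
  also have "\<dots> \<le> N * (6*L/Q) + N/Q * real L"
    using bad by (intro add_mono mult_right_mono) auto
  also have "\<dots> = 7*H/Q^2" using Q0 by (simp add: H L_def power_numeral_reduce field_simps)
  finally show ?thesis .
qed

section \<open>Bilinear sums and sums over squares\<close>

lemma sum_squared_le_card:
  fixes g :: "'a \<Rightarrow> real"
  shows "(\<Sum>i\<in>I. g i)^2 \<le> card I * (\<Sum>i\<in>I. (g i)^2)"
proof -
  have "0 \<le> (\<Sum>i\<in>I. \<Sum>j\<in>I. (g i - g j)^2)" by (intro sum_nonneg) auto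
  also have "\<dots> = (\<Sum>i\<in>I. \<Sum>j\<in>I. (g i)^2 + (g j)^2 - 2 * (g i * g j))"
    by (simp add: power2_eq_square algebra_simps)
  also have "\<dots> = 2 * card I * (\<Sum>i\<in>I. (g i)^2) - 2 * (\<Sum>i\<in>I. \<Sum>j\<in>I. g i * g j)"
    by (simp add: sum.distrib sum_subtractf sum_distrib_left[symmetric])
  also have "(\<Sum>i\<in>I. \<Sum>j\<in>I. g i * g j) = (\<Sum>i\<in>I. g i)^2"
    by (simp add: power2_eq_square sum_product)
  finally show ?thesis by simp
qed

lemma sum_pairs_lessThan_le:
  fixes c :: "nat \<Rightarrow> nat \<Rightarrow> real"
  assumes c: "\<And>n r. c n r \<ge> 0"
  shows "(\<Sum>a<R. \<Sum>b<R. if a < b then c a (b-a) else 0) \<le> (\<Sum>a<R. \<Sum>r\<in>{1..<R}. c a r)"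
proof (rule sum_mono)
  fix a assume a: "a \<in> {..<R}"
  have "(\<Sum>b<R. if a < b then c a (b-a) else 0) = (\<Sum>b\<in>{a+1..<R}. c a (b-a))"
    by (rule sum.mono_neutral_cong_right) auto
  also have "\<dots> = (\<Sum>r\<in>{1..<R-a}. c a r)"
    using a by (intro sum.reindex_bij_witness[of _ "\<lambda>r. r+a" "\<lambda>b. b-a"]) auto
  also have "\<dots> \<le> (\<Sum>r\<in>{1..<R}. c a r)" using c by (intro sum_mono2) auto
  finally show "(\<Sum>b<R. if a < b then c a (b-a) else 0) \<le> (\<Sum>r\<in>{1..<R}. c a r)" .
qed

text \<open>Cauchy-Schwarz over m and over the N blocks of length R, after which the square is
  opened inside each block only. Equal positions give the trivial term; other pairs are sorted by
  their distance r. Pairs n, n+r that leave their block are added to the upper bound, so B involves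
  v also slightly beyond N*R.\<close>

lemma block_cauchy:
  fixes v :: "'a \<Rightarrow> nat \<Rightarrow> complex" and B :: real
  assumes v1: "\<And>m n. norm (v m n) \<le> 1" 
    and B: "\<And>r. r \<in> {1..<R} \<Longrightarrow> (\<Sum>n<N*R. norm (\<Sum>m\<in>M. v m n * cnj (v m (n+r)))) \<le> B"
  shows "(\<Sum>m\<in>M. norm (\<Sum>n<N*R. v m n))^2 \<le> card M * N * (card M * N * R + 2 * (\<Sum>r\<in>{1..<R}. B))"
proof -
  define c where "c n r = norm (\<Sum>m\<in>M. v m n * cnj (v m (n+r)))" for n r
  define P where "P n n' = (\<Sum>m\<in>M. v m n * cnj (v m n'))" for n n'
  have sym: "norm (P n n') = norm (P n' n)" for n n'
  proof -
    have "P n n' = cnj (P n' n)" by (simp add: P_def mult.commute)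
    thus ?thesis by simp
  qed
  have triv: "norm (P n n') \<le> card M" for n n'
  proof -
    have "norm (P n n') \<le> (\<Sum>m\<in>M. 1)"
      unfolding P_def
    proof (rule sum_norm_le)
      fix m show "norm (v m n * cnj (v m n')) \<le> 1"
        using mult_mono[OF v1[of m n] v1[of m n']] by (simp add: norm_mult)
    qed
    thus ?thesis by simp
  qed
  have pair: "(\<Sum>a<R. \<Sum>b<R. norm (P (q*R+a) (q*R+b))) \<le> card M * R + 2 * (\<Sum>a<R. \<Sum>r\<in>{1..<R}. c (q*R+a) r)" for q
  proof -
    have "(\<Sum>a<R. \<Sum>b<R. norm (P (q*R+a) (q*R+b))) \<le> 
       (\<Sum>a<R. \<Sum>b<R. (if a = b then real (card M) else 0) + (if a < b then c (q*R+a) (b-a) else 0) + (if b < a then c (q*R+b) (a-b) else 0))"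
    proof (intro sum_mono)
      fix a b
      have "c (q*R+a) (b-a) = norm (P (q*R+a) (q*R+b))" if "a < b" 
        using that by (simp add: c_def P_def)
      moreover have "c (q*R+b) (a-b) = norm (P (q*R+a) (q*R+b))" if "b < a"
        using that sym[of "q*R+a" "q*R+b"] by (simp add: c_def P_def)
      ultimately show "norm (P (q*R+a) (q*R+b)) \<le> (if a = b then real (card M) else 0) + (if a < b then c (q*R+a) (b-a) else 0) + (if b < a then c (q*R+b) (a-b) else 0)"
        using triv[of "q*R+a" "q*R+b"] by (cases a b rule: linorder_cases) auto
    qed
    also have "\<dots> = (\<Sum>a<R. \<Sum>b<R. (if a = b then real (card M) else 0)) + (\<Sum>a<R. \<Sum>b<R. if a < b then c (q*R+a) (b-a) else 0)
        + (\<Sum>a<R. \<Sum>b<R. if b < a then c (q*R+b) (a-b) else 0)"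
      by (simp only: sum.distrib)
    also have "(\<Sum>a<R. \<Sum>b<R. (if a = b then real (card M) else 0)) = card M * R" by (simp add: sum.delta)
    also have "(\<Sum>a<R. \<Sum>b<R. if b < a then c (q*R+b) (a-b) else 0) = (\<Sum>a<R. \<Sum>b<R. if a < b then c (q*R+a) (b-a) else 0)"
      by (rule sum.swap)
    finally have "(\<Sum>a<R. \<Sum>b<R. norm (P (q*R+a) (q*R+b))) \<le> card M * R + 2 * (\<Sum>a<R. \<Sum>b<R. if a < b then c (q*R+a) (b-a) else 0)"
      by simp
    moreover have "(\<Sum>a<R. \<Sum>b<R. if a < b then c (q*R+a) (b-a) else 0) \<le> (\<Sum>a<R. \<Sum>r\<in>{1..<R}. c (q*R+a) r)"
      by (rule sum_pairs_lessThan_le[of "\<lambda>a r. c (q*R+a) r"]) (simp add: c_def)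
    ultimately show ?thesis by linarith
  qed
  have "(\<Sum>m\<in>M. norm (\<Sum>n<N*R. v m n))^2 \<le> card M * (\<Sum>m\<in>M. (norm (\<Sum>n<N*R. v m n))^2)"
    by (rule sum_squared_le_card)
  also have "(\<Sum>m\<in>M. (norm (\<Sum>n<N*R. v m n))^2) \<le> (\<Sum>m\<in>M. N * (\<Sum>q<N. (norm (\<Sum>a<R. v m (q*R+a)))^2))"
  proof (rule sum_mono)
    fix m
    have "norm (\<Sum>n<N*R. v m n) \<le> (\<Sum>q<N. norm (\<Sum>a<R. v m (q*R+a)))"
      unfolding sum_lessThan_mult by (rule norm_sum)
    hence "(norm (\<Sum>n<N*R. v m n))^2 \<le> (\<Sum>q<N. norm (\<Sum>a<R. v m (q*R+a)))^2"
      by (intro power_mono) auto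
    also have "\<dots> \<le> card {..<N} * (\<Sum>q<N. (norm (\<Sum>a<R. v m (q*R+a)))^2)" by (rule sum_squared_le_card)
    finally show "(norm (\<Sum>n<N*R. v m n))^2 \<le> N * (\<Sum>q<N. (norm (\<Sum>a<R. v m (q*R+a)))^2)" by simp
  qed
  also have "(\<Sum>m\<in>M. N * (\<Sum>q<N. (norm (\<Sum>a<R. v m (q*R+a)))^2)) = N * (\<Sum>q<N. \<Sum>m\<in>M. (norm (\<Sum>a<R. v m (q*R+a)))^2)"
    by (subst sum.swap) (simp add: sum_distrib_left)
  also have "(\<Sum>q<N. \<Sum>m\<in>M. (norm (\<Sum>a<R. v m (q*R+a)))^2) \<le> (\<Sum>q<N. card M * R + 2 * (\<Sum>a<R. \<Sum>r\<in>{1..<R}. c (q*R+a) r))"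
  proof (rule sum_mono)
    fix q
    have "complex_of_real (\<Sum>m\<in>M. (norm (\<Sum>a<R. v m (q*R+a)))^2) = (\<Sum>m\<in>M. \<Sum>a<R. \<Sum>b<R. v m (q*R+a) * cnj (v m (q*R+b)))"
      unfolding of_real_sum complex_norm_square cnj_sum sum_product ..
    also have "\<dots> = (\<Sum>a<R. \<Sum>b<R. P (q*R+a) (q*R+b))"
      unfolding P_def by (rule sum_rotate[symmetric])
    finally have "norm (complex_of_real (\<Sum>m\<in>M. (norm (\<Sum>a<R. v m (q*R+a)))^2)) \<le> (\<Sum>a<R. \<Sum>b<R. norm (P (q*R+a) (q*R+b)))"
      by (simp only:) (intro sum_norm_le, simp)
    hence "(\<Sum>m\<in>M. (norm (\<Sum>a<R. v m (q*R+a)))^2) \<le> (\<Sum>a<R. \<Sum>b<R. norm (P (q*R+a) (q*R+b)))"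
      by (simp only: norm_of_real)
    thus "(\<Sum>m\<in>M. (norm (\<Sum>a<R. v m (q*R+a)))^2) \<le> card M * R + 2 * (\<Sum>a<R. \<Sum>r\<in>{1..<R}. c (q*R+a) r)"
      using pair[of q] by linarith
  qed
  also have "\<dots> = card M * N * R + 2 * (\<Sum>q<N. \<Sum>a<R. \<Sum>r\<in>{1..<R}. c (q*R+a) r)"
    by (simp add: sum.distrib sum_distrib_left)
  also have "(\<Sum>q<N. \<Sum>a<R. \<Sum>r\<in>{1..<R}. c (q*R+a) r) = (\<Sum>r\<in>{1..<R}. \<Sum>n<N*R. c n r)"
    unfolding sum_lessThan_mult[of _ N R] by (rule sum_rotate)
  also have "\<dots> \<le> (\<Sum>r\<in>{1..<R}. B)" using B by (intro sum_mono) (simp add: c_def)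
  finally show ?thesis by (simp add: mult.assoc mult_left_mono)
qed

text \<open>A is the low part before the shift, B the contribution of the fixed starting point i0,
  and R the small contribution of the running index. Only the carry e depends on the sample, and
  \<open>sum_sample_le\<close> simply adds up its three values.\<close>

lemma carry_cases:
  fixes A B R P :: nat
  assumes "R < P"
  shows "\<exists>e<3. (A+B+R) div P = A div P + B div P + e"
proof -
  have P: "P > 0" using assms by simp
  define x where "x = A mod P + B mod P + R"
  have "x < 3*P" using assms mod_less_divisor[OF P, of A] mod_less_divisor[OF P, of B] unfolding x_def by linarith
  hence e: "x div P < 3" using P by (simp add: less_mult_imp_div_less)
  have "A+B+R = (A div P + B div P)*P + x"
    using div_mult_mod_eq[of A P] div_mult_mod_eq[of B P] unfolding x_def add_mult_distrib by linarith
  hence "(A+B+R) div P = A div P + B div P + x div P" using P by simp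
  thus ?thesis using e by blast
qed

context digital_phase begin

text \<open>One square root for each Cauchy-Schwarz: \<open>rate\<close> appears when the mean
  square is turned into a mean over samples, \<open>root_rate\<close> when the shift by r is
  undone.\<close>

definition rate :: real where "rate = sqrt decay"

lemma rate_bounds: "1/2 \<le> rate" "rate < 1" "0 < rate" "rate^2 = decay"
proof -
  show "rate < 1" "0 < rate" "rate^2 = decay" using decay_bounds by (auto simp: rate_def)
  have "(1/2)^2 \<le> decay" using decay_bounds(1) by (simp add: power2_eq_square)
  thus "1/2 \<le> rate" unfolding rate_def by (rule real_le_rsqrt)
qed

text \<open>The residues of a sample hit each pair modulo Q at most 7 times as often as expected.
  The envelope is nonnegative and depends on these residues only, so its sample mean is at most 7
  times the complete mean. With three carries this gives 7*3*14 = 294, below 18^2.\<close>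

lemma sum_sample_le:
  fixes k h r c0 :: nat and X :: "'s \<Rightarrow> real" and \<alpha> \<nu> :: "'s \<Rightarrow> nat"
  defines "J \<equiv> p^(6*k)" and "Q \<equiv> p^(15*k)"
  assumes fin: "finite Sm" and h: "1 \<le> h" "h \<le> p" and nd: "\<not> p^(3*k+1) dvd h*r" and l1: "\<And>j. norm (l j) = 1"
    and X0: "\<And>s. s \<in> Sm \<Longrightarrow> 0 \<le> X s"
    and X: "\<And>s. s \<in> Sm \<Longrightarrow> \<exists>e<3. (X s)^2 \<le> envelope k h r (c0+e) l (\<alpha> s) (\<nu> s)"
    and count: "\<And>u v. u < Q \<Longrightarrow> v < Q \<Longrightarrow> real (card {s\<in>Sm. \<alpha> s mod Q = u \<and> \<nu> s mod Q = v}) \<le> 7 * card Sm / (real Q)^2"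
  shows "(\<Sum>s\<in>Sm. X s) \<le> 18 * card Sm * J * rate^k"
proof -
  define \<Psi> where "\<Psi> a n = (\<Sum>e<3. envelope k h r (c0+e) l a n)" for a n
  have Q0: "Q > 0" by (simp add: Q_def)
  have \<Psi>0: "\<Psi> a n \<ge> 0" for a n unfolding \<Psi>_def by (intro sum_nonneg envelope_nonneg)
  have X\<Psi>: "(X s)^2 \<le> \<Psi> (\<alpha> s mod Q) (\<nu> s mod Q)" if s: "s \<in> Sm" for s
  proof -
    obtain e where e: "e < 3" "(X s)^2 \<le> envelope k h r (c0+e) l (\<alpha> s) (\<nu> s)" using X[OF s] by blast
    note e(2)
    also have "envelope k h r (c0+e) l (\<alpha> s) (\<nu> s) \<le> \<Psi> (\<alpha> s) (\<nu> s)"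
      unfolding \<Psi>_def by (rule member_le_sum) (use e envelope_nonneg in auto)
    also have "\<Psi> (\<alpha> s) (\<nu> s) = \<Psi> (\<alpha> s mod Q) (\<nu> s mod Q)"
      by (simp add: \<Psi>_def Q_def envelope_mod)
    finally show ?thesis .
  qed
  have "(\<Sum>s\<in>Sm. (X s)^2) \<le> (\<Sum>s\<in>Sm. \<Psi> (\<alpha> s mod Q) (\<nu> s mod Q))" by (intro sum_mono X\<Psi>)
  also have "\<dots> = (\<Sum>uv\<in>{..<Q}\<times>{..<Q}. \<Sum>s\<in>{s\<in>Sm. (\<alpha> s mod Q, \<nu> s mod Q) = uv}. \<Psi> (\<alpha> s mod Q) (\<nu> s mod Q))"
    using Q0 by (intro sum.group[symmetric] fin) auto
  also have "\<dots> = (\<Sum>uv\<in>{..<Q}\<times>{..<Q}. real (card {s\<in>Sm. \<alpha> s mod Q = fst uv \<and> \<nu> s mod Q = snd uv}) * \<Psi> (fst uv) (snd uv))"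
  proof (rule sum.cong[OF refl])
    fix uv assume "uv \<in> {..<Q}\<times>{..<Q}"
    have "(\<Sum>s\<in>{s\<in>Sm. (\<alpha> s mod Q, \<nu> s mod Q) = uv}. \<Psi> (\<alpha> s mod Q) (\<nu> s mod Q)) = (\<Sum>s\<in>{s\<in>Sm. \<alpha> s mod Q = fst uv \<and> \<nu> s mod Q = snd uv}. \<Psi> (fst uv) (snd uv))"
      by (rule sum.cong) auto
    thus "(\<Sum>s\<in>{s\<in>Sm. (\<alpha> s mod Q, \<nu> s mod Q) = uv}. \<Psi> (\<alpha> s mod Q) (\<nu> s mod Q)) = real (card {s\<in>Sm. \<alpha> s mod Q = fst uv \<and> \<nu> s mod Q = snd uv}) * \<Psi> (fst uv) (snd uv)"
      by simp
  qed
  also have "\<dots> \<le> (\<Sum>uv\<in>{..<Q}\<times>{..<Q}. (7 * card Sm / (real Q)^2) * \<Psi> (fst uv) (snd uv))"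
    using count \<Psi>0 by (intro sum_mono mult_right_mono) auto
  also have "\<dots> = (7 * card Sm / (real Q)^2) * (\<Sum>u<Q. \<Sum>v<Q. \<Psi> u v)"
    by (simp only: sum_distrib_left[symmetric] sum.cartesian_product case_prod_unfold)
  also have "(\<Sum>u<Q. \<Sum>v<Q. \<Psi> u v) = (\<Sum>e<3. \<Sum>u<Q. \<Sum>v<Q. envelope k h r (c0+e) l u v)"
    unfolding \<Psi>_def by (rule sum_rotate)
  also have "\<dots> \<le> (\<Sum>e<3::nat. 14*(real J)^2*(real Q)^2*decay^k)"
    unfolding J_def Q_def by (intro sum_mono sum_envelope_le h nd l1)
  finally have "(\<Sum>s\<in>Sm. (X s)^2) \<le> (7 * card Sm / (real Q)^2) * (42*(real J)^2*(real Q)^2*decay^k)"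
    by (simp add: mult_left_mono divide_right_mono)
  also have "\<dots> = 294 * card Sm * (real J)^2 * decay^k" using Q0 by (simp add: field_simps)
  finally have sq: "(\<Sum>s\<in>Sm. (X s)^2) \<le> 294 * card Sm * (real J)^2 * decay^k" .
  have "(\<Sum>s\<in>Sm. X s)^2 \<le> card Sm * (\<Sum>s\<in>Sm. (X s)^2)" by (rule sum_squared_le_card)
  also have "\<dots> \<le> card Sm * (294 * card Sm * (real J)^2 * decay^k)" using sq by (intro mult_left_mono) auto
  also have "\<dots> = 294 * (card Sm * J * rate^k)^2"
  proof -
    have "decay^k = rate^k * rate^k"
      by (simp add: rate_bounds(4)[symmetric] power2_eq_square power_mult_distrib)
    thus ?thesis by (simp add: power2_eq_square)
  qed
  also have "\<dots> \<le> 324 * (card Sm * J * rate^k)^2" by (intro mult_right_mono) auto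
  also have "\<dots> = (18 * card Sm * J * rate^k)^2" by (simp add: power2_eq_square)
  finally show ?thesis
    by (rule power2_le_imp_le) (use rate_bounds in auto)
qed


definition root_rate :: real where "root_rate = sqrt rate"

lemma root_rate_bounds: "1/2 \<le> root_rate" "root_rate < 1" "0 < root_rate" "root_rate^2 = rate"
proof -
  show "root_rate < 1" "0 < root_rate" "root_rate^2 = rate" using rate_bounds by (auto simp: root_rate_def)
  have "(1/2)^2 \<le> rate" using rate_bounds(1) by (simp add: power2_eq_square)
  thus "1/2 \<le> root_rate" unfolding root_rate_def by (rule real_le_rsqrt)
qed

lemma inverse_p_power_le: "1/2 \<le> x \<Longrightarrow> 1 / p^k \<le> x^k" 
proof -
  assume x: "1/2 \<le> (x::real)"
  have "1 / real p \<le> 1/2" using p_ge_2 by (simp add: field_simps)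
  hence "1 / real p \<le> x" using x by linarith
  hence "(1 / real p)^k \<le> x^k" by (intro power_mono) auto
  thus ?thesis by (simp add: power_divide)
qed

lemma power_p_mult: "p^(a*k) = (p^k)^a"
  by (metis mult.commute power_mult)

lemma Suc_0_le_p_power [simp]: "Suc 0 \<le> p" "Suc 0 \<le> p^n" "1 \<le> real p" "1 \<le> real p^n"
proof -
  show "Suc 0 \<le> p" using p_ge_2 by simp
  thus "Suc 0 \<le> p^n" "1 \<le> real p" "1 \<le> real p^n" by (auto simp: Suc_le_eq)
qed

lemma p_power_ge_2: "k \<ge> 1 \<Longrightarrow> p^k \<ge> 2"
  using p_ge_2 self_le_power[of p k] by simp

section \<open>Reduction of product and square correlations to the digit window\<close>

lemma f_add_mult: 
  "f (A + p^K*B) = f (A mod p^K) * (\<omega>^repunit K)^(A div p^K + B) * f (A div p^K + B)"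
proof -
  have "A + p^K*B = A mod p^K + p^K*(A div p^K + B)" by (simp add: distrib_left add.assoc[symmetric])
  moreover have "A mod p^K < p^K" by simp
  ultimately show ?thesis using f_split[of "A mod p^K" K "A div p^K + B"] by simp
qed

text \<open>Adding a multiple of p^K leaves the digits below K untouched. Applied with B and B'
  depending on j and A, A' fixed, it pulls the low-digit factor out of the sum over j; there remain
  a phase linear in s and a correlation with shift s of the high parts.\<close>

lemma correlation_split:
  assumes "A' div p^K + B' = A div p^K + B + s"
  shows "f (A + p^K*B) * cnj (f (A' + p^K*B')) = f (A mod p^K) * cnj (f (A' mod p^K)) * 
     (cnj (\<omega>^repunit K)^s * (f (A div p^K + B) * cnj (f (A div p^K + B + s))))"
proof -
  define \<zeta> where "\<zeta> = \<omega>^repunit K"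
  define y where "y = A div p^K + B"
  have "\<zeta> * cnj \<zeta> = 1" unfolding \<zeta>_def by (subst complex_norm_square[symmetric]) simp
  hence "\<zeta>^y * cnj \<zeta>^y = 1" by (metis power_mult_distrib power_one)
  hence z: "\<zeta>^y * cnj \<zeta>^(y+s) = cnj \<zeta>^s" by (simp add: power_add mult.assoc[symmetric])
  have "f (A + p^K*B) = f (A mod p^K) * \<zeta>^y * f y"
    unfolding \<zeta>_def y_def by (rule f_add_mult)
  moreover have "f (A' + p^K*B') = f (A' mod p^K) * \<zeta>^(y+s) * f (y+s)"
    unfolding \<zeta>_def y_def assms[symmetric] by (rule f_add_mult)
  ultimately have "f (A + p^K*B) * cnj (f (A' + p^K*B')) = f (A mod p^K) * cnj (f (A' mod p^K)) * 
     ((\<zeta>^y * cnj \<zeta>^(y+s)) * (f y * cnj (f (y+s))))" by (simp add: mult_ac)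
  thus ?thesis unfolding z by (simp add: \<zeta>_def y_def)
qed

text \<open>With z = p^k the parts are bounded by z*z^6*z^2 = z^9 and 2*z^10 + 2. This is where the
  carry margin p^(12*k) comes from.\<close>

lemma shift_small:
  fixes k h j r c e :: nat
  assumes k: "k \<ge> 1" and h: "h \<le> p" and j: "j < p^(6*k)" and r: "r < p^(2*k)" and c: "c \<le> 2*p^(10*k)" and e: "e < 3"
  shows "h*j*r + (c+e) < p^(12*k)"
proof -
  define z where "z = p^k"
  have z2: "z \<ge> 2" using p_power_ge_2[OF k] by (simp add: z_def)
  have "h \<le> z^1" using h self_le_power[of p k] k p_ge_2 by (simp add: z_def)
  hence "h*j*r \<le> z^1*z^6*z^2" using j r by (intro mult_mono) (auto simp: power_p_mult z_def)
  also have "z^1*z^6*z^2 = z^9" by (simp only: power_add[symmetric]) simp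
  finally have a: "h*j*r \<le> z^9" .
  have b: "2*z^9 \<le> z^10" using z2 mult_right_mono[of 2 z "z^9"] by (simp flip: power_Suc)
  have "2^2 \<le> z^2" using z2 by (intro power_mono) auto
  hence "4*z^10 \<le> z^2*z^10" by (intro mult_right_mono) auto
  also have "z^2*z^10 = z^12" by (simp only: power_add[symmetric]) simp
  finally have d: "4*z^10 \<le> z^12" .
  have "2^9 \<le> z^9" using z2 by (intro power_mono) auto
  moreover have "c \<le> 2*z^10" using c by (simp add: power_p_mult z_def)
  ultimately have "h*j*r + (c+e) < z^12" using a b d e by simp
  thus ?thesis by (simp add: power_p_mult z_def)
qed

lemma not_dvd_small:
  assumes k: "k \<ge> 1" and h: "1 \<le> h" "h \<le> p" and r: "1 \<le> r" "r < p^(2*k)"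
  shows "\<not> p^(3*k+1) dvd h*r"
proof -
  have "h*r < p*p^(2*k)" using h r by (intro mult_le_less_imp_less) auto
  also have "\<dots> = p^(2*k+1)" by simp
  also have "\<dots> \<le> p^(3*k+1)" using p_ge_2 by (intro power_increasing) auto
  finally show ?thesis using h r by (intro nat_dvd_not_less) auto
qed

definition F :: "complex \<Rightarrow> nat \<Rightarrow> complex" where "F \<chi> n = f n * \<chi>^n"

lemma norm_F [simp]: "norm \<chi> = 1 \<Longrightarrow> norm (F \<chi> n) = 1" by (simp add: F_def norm_mult norm_power)

lemma unimodular_shift: "norm \<chi> = 1 \<Longrightarrow> \<chi>^a * cnj \<chi>^(a+b) = cnj \<chi>^b"
proof -
  assume "norm \<chi> = 1"
  hence "\<chi> * cnj \<chi> = 1" by (subst complex_norm_square[symmetric]) simp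
  hence "\<chi>^a * cnj \<chi>^a = 1" by (metis power_mult_distrib power_one)
  thus ?thesis by (simp add: power_add mult.assoc[symmetric])
qed

text \<open>Put x = N0+n. The shift by r adds (i0+l)*r, which is independent of j, and j*P0*r, which
  acts above position K. Of the former i0*r is fixed, and l*r < P0 because H = P0/p^(4*k); so only a
  carry e < 3 varies. Above position K the point is A div P0 + j*x with shift j*r+c, which is the
  situation of the envelope with h = 1. The length 105 = 7*15 is N = Q^7 of
  \<open>card_bilinear_class\<close>.\<close>

lemma bilinear_correlation_le:
  fixes k K i0 N0 r :: nat
  defines "P0 \<equiv> p^K" and "H \<equiv> p^(K-4*k)" and "N \<equiv> p^(105*k)" and "J \<equiv> p^(6*k)"
  assumes k: "k \<ge> 1" and K: "100*k \<le> K" and i0: "i0 \<le> p^(K+8*k)" and r: "1 \<le> r" "r < p^(2*k)" and \<chi>: "norm \<chi> = 1"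
  shows "(\<Sum>l<H. \<Sum>n<N. norm (\<Sum>j<J. F \<chi> ((i0+l+j*P0)*(N0+n)) * cnj (F \<chi> ((i0+l+j*P0)*(N0+n+r))))) \<le> 18*H*N*J*rate^k"
proof -
  define Q where "Q = p^(15*k)"
  define \<zeta> where "\<zeta> = \<omega>^repunit K"
  define l where "l j = cnj \<zeta>^(1*j*r) * cnj \<chi>^(j*P0*r)" for j
  define c0 where "c0 = (i0*r) div P0"
  define X where "X = (\<lambda>(l,n). norm (\<Sum>j<J. F \<chi> ((i0+l+j*P0)*(N0+n)) * cnj (F \<chi> ((i0+l+j*P0)*(N0+n+r)))))"
  define Sm where "Sm = {..<H}\<times>{..<N}"
  define \<alpha> where "\<alpha> = (\<lambda>(l,n). (i0+l)*(N0+n) div P0)"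
  define \<nu> where "\<nu> = (\<lambda>(l::nat,n). N0+n)"
  have P0H: "P0 = H * p^(4*k)" using K by (simp add: P0_def H_def flip: power_add)
  have z2: "p^k \<ge> 2" by (rule p_power_ge_2[OF k])
  have l1: "norm (l j) = 1" for j by (simp add: l_def norm_mult norm_power \<zeta>_def \<chi> norm_\<omega>)
  have c0: "c0 \<le> 2*p^(10*k)"
  proof -
    have "i0*r \<le> p^(K+8*k)*p^(2*k)" using i0 r by (intro mult_mono) auto
    also have "\<dots> = p^(10*k)*P0" by (simp add: P0_def flip: power_add)
    finally have "c0 \<le> (p^(10*k)*P0) div P0" unfolding c0_def by (rule div_le_mono)
    thus ?thesis by (simp add: P0_def)
  qed
  have cardS: "card Sm = H*N" by (simp add: Sm_def)
  have "(\<Sum>s\<in>Sm. X s) \<le> 18 * card Sm * J * rate^k"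
    unfolding J_def
  proof (rule sum_sample_le)
    show "finite Sm" by (simp add: Sm_def)
    show "\<not> p^(3*k+1) dvd 1*r" using k r p_ge_2 by (intro not_dvd_small) auto
    fix s assume s: "s \<in> Sm"
    then obtain i n where s_eq: "s = (i,n)" and i: "i < H" and n: "n < N" by (auto simp: Sm_def)
    show "0 \<le> X s" by (simp add: X_def s_eq)
    define x where "x = N0+n"
    define A where "A = (i0+i)*x"
    define A' where "A' = (i0+i)*(x+r)"
    have ir: "i*r < P0"
    proof -
      have "i*r < H*p^(2*k)" using i r by (intro mult_strict_mono) auto
      also have "\<dots> \<le> H*p^(4*k)" by (intro mult_left_mono power_increasing) auto
      finally show ?thesis by (simp add: P0H)
    qed
    have "A' = A + i0*r + i*r" by (simp add: A_def A'_def algebra_simps)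
    then obtain e where e: "e < 3" "A' div P0 = A div P0 + c0 + e"
      using carry_cases[OF ir, of A "i0*r"] unfolding c0_def by auto
    define c where "c = c0+e"
    define y where "y j = A div P0 + j*x" for j
    define C where "C = f (A mod P0) * cnj (f (A' mod P0)) * cnj \<zeta>^c * cnj \<chi>^((i0+i)*r)"
    have nC: "norm C = 1" by (simp add: C_def norm_mult norm_power \<zeta>_def \<chi> norm_\<omega>)
    have term_eq: "F \<chi> ((i0+i+j*P0)*x) * cnj (F \<chi> ((i0+i+j*P0)*(x+r))) = C * (l j * (f (y j) * cnj (f (y j + (1*j*r+c)))))" for j
    proof -
      have m1: "(i0+i+j*P0)*x = A + p^K*(j*x)" by (simp add: A_def P0_def algebra_simps)
      have m2: "(i0+i+j*P0)*(x+r) = A' + p^K*(j*(x+r))" by (simp add: A'_def P0_def algebra_simps)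
      have m3: "(i0+i+j*P0)*(x+r) = (i0+i+j*P0)*x + ((i0+i)*r + j*P0*r)" by (simp add: algebra_simps)
      have "A' div p^K + j*(x+r) = A div p^K + j*x + (1*j*r+c)"
        using e(2) by (simp add: P0_def c_def algebra_simps)
      from correlation_split[OF this]
      have f: "f ((i0+i+j*P0)*x) * cnj (f ((i0+i+j*P0)*(x+r))) = f (A mod P0) * cnj (f (A' mod P0)) * (cnj \<zeta>^(1*j*r+c) * (f (y j) * cnj (f (y j + (1*j*r+c)))))"
        unfolding m1[symmetric] m2[symmetric] by (simp add: \<zeta>_def y_def P0_def)
      have g: "\<chi>^((i0+i+j*P0)*x) * cnj (\<chi>^((i0+i+j*P0)*(x+r))) = cnj \<chi>^((i0+i)*r) * cnj \<chi>^(j*P0*r)"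
        using unimodular_shift[OF \<chi>, of "(i0+i+j*P0)*x" "(i0+i)*r + j*P0*r"] unfolding m3 by (simp add: power_add)
      have "F \<chi> ((i0+i+j*P0)*x) * cnj (F \<chi> ((i0+i+j*P0)*(x+r))) = 
         (f ((i0+i+j*P0)*x) * cnj (f ((i0+i+j*P0)*(x+r)))) * (\<chi>^((i0+i+j*P0)*x) * cnj (\<chi>^((i0+i+j*P0)*(x+r))))"
        by (simp only: F_def complex_cnj_mult mult_ac)
      also have "\<dots> = C * (l j * (f (y j) * cnj (f (y j + (1*j*r+c)))))"
        unfolding f g C_def l_def power_add[of _ "1*j*r" c] by (simp only: mult_ac)
      finally show ?thesis .
    qed
    have "X s = norm (\<Sum>j<J. C * (l j * (f (y j) * cnj (f (y j + (1*j*r+c))))))"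
      unfolding X_def s_eq using term_eq by (simp add: x_def add.assoc)
    also have "\<dots> = norm (\<Sum>j<J. l j * (f (y j) * cnj (f (y j + (1*j*r+c)))))"
      by (simp only: sum_distrib_left[symmetric] norm_mult nC mult_1)
    finally have "(X s)^2 = (norm (\<Sum>j<p^(6*k). l j * (f (y j) * cnj (f (y j + (1*j*r+c))))))^2"
      by (simp add: J_def)
    also have "\<dots> \<le> envelope k 1 r c l (A div P0) x"
    proof (rule norm_correlation_le_envelope)
      fix j assume j: "j < p^(6*k)"
      show "[y j = A div P0 + 1*j*x] (mod p^(15*k))" by (simp add: y_def)
      show "1*j*r+c < p^(12*k)" unfolding c_def
        using k j r(2) c0 e(1) p_ge_2 by (intro shift_small) auto
    qed (rule l1)
    finally have "(X s)^2 \<le> envelope k 1 r (c0+e) l (\<alpha> s) (\<nu> s)"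
      by (simp add: c_def \<alpha>_def \<nu>_def s_eq A_def x_def)
    thus "\<exists>e<3. (X s)^2 \<le> envelope k 1 r (c0+e) l (\<alpha> s) (\<nu> s)" using e(1) by blast
  next
    fix u v assume u: "u < p^(15*k)" and v: "v < p^(15*k)"
    have NQ: "N = Q^7" by (simp add: N_def Q_def flip: power_mult)
    have eq: "{s\<in>Sm. \<alpha> s mod p^(15*k) = u \<and> \<nu> s mod p^(15*k) = v} = 
       {(l,n). l < H \<and> n < Q^7 \<and> (N0+n) mod Q = v \<and> ((i0+l)*(N0+n) div P0) mod Q = u}"
      by (auto simp: Sm_def \<alpha>_def \<nu>_def NQ Q_def)
    have "real (card {(l,n). l < H \<and> n < Q^7 \<and> (N0+n) mod Q = v \<and> ((i0+l)*(N0+n) div P0) mod Q = u}) \<le> 7*H*Q^7/Q^2"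
    proof (rule card_bilinear_class)
      have "2^15 \<le> (p^k)^15" using z2 by (intro power_mono) auto
      thus Q16: "16 \<le> Q" by (simp add: Q_def power_p_mult)
      have "2^3 \<le> (p^k)^3" using z2 by (intro power_mono) auto
      hence z3: "8 \<le> p^(3*k)" by (simp add: power_p_mult)
      hence "8*Q^5 \<le> p^(3*k)*Q^5" by (intro mult_right_mono) auto
      also have "\<dots> = p^(78*k)" by (simp add: Q_def flip: power_mult power_add)
      also have "\<dots> \<le> P0" unfolding P0_def using K by (intro power_increasing) auto
      finally show "8*Q^5 \<le> P0" .
      have "8*P0 = 8*p^(4*k)*H" by (simp add: P0H)
      also have "\<dots> \<le> p^(3*k)*p^(4*k)*H" using z3 by (intro mult_right_mono) auto
      also have "\<dots> = p^(7*k)*H" by (simp flip: power_add)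
      also have "\<dots> \<le> Q*H" unfolding Q_def by (intro mult_right_mono power_increasing) auto
      finally show "8*P0 \<le> H*Q" by (simp add: mult.commute)
      show "v < Q" using v by (simp add: Q_def)
    qed
    thus "real (card {s\<in>Sm. \<alpha> s mod p^(15*k) = u \<and> \<nu> s mod p^(15*k) = v}) \<le> 7 * card Sm / (real (p^(15*k)))^2"
      unfolding eq cardS NQ by (simp add: Q_def)
  qed (use l1 p_ge_2 in auto)
  thus ?thesis by (simp add: Sm_def X_def sum.cartesian_product)
qed

text \<open>Expanding (x + j*P0)^2 leaves 2*j*x + j^2*P0 above position K. The quadratic term is
  divisible by p^(15*k) and invisible in the window, so squares behave like products with h = 2. The
  bound 350 leaves room for P0 = Q^22*T, since 22*15 = 330.\<close>

lemma square_correlation_le: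
  fixes k K i0 r :: nat
  defines "P0 \<equiv> p^K" and "H \<equiv> p^(K-4*k)" and "J \<equiv> p^(6*k)"
  assumes k: "k \<ge> 1" and K: "350*k \<le> K" and i0: "i0 \<le> p^(K+8*k)" and r: "1 \<le> r" "r < p^(2*k)" and \<chi>: "norm \<chi> = 1"
  shows "(\<Sum>l<H. norm (\<Sum>j<J. (f ((i0+l+j*P0)^2) * \<chi>^(i0+l+j*P0)) * cnj (f ((i0+l+r+j*P0)^2) * \<chi>^(i0+l+r+j*P0)))) \<le> 18*H*J*rate^k"
proof -
  define Q where "Q = p^(15*k)"
  define \<zeta> where "\<zeta> = \<omega>^repunit K"
  define l where "l j = cnj \<zeta>^(2*j*r)" for j
  define c0 where "c0 = (2*i0*r) div P0"
  define X where "X i = norm (\<Sum>j<J. (f ((i0+i+j*P0)^2) * \<chi>^(i0+i+j*P0)) * cnj (f ((i0+i+r+j*P0)^2) * \<chi>^(i0+i+r+j*P0)))" for i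
  define \<alpha> where "\<alpha> i = (i0+i)^2 div P0" for i
  have P0H: "P0 = H * p^(4*k)" using K by (simp add: P0_def H_def flip: power_add)
  have z2: "p^k \<ge> 2" by (rule p_power_ge_2[OF k])
  have l1: "norm (l j) = 1" for j by (simp add: l_def norm_mult norm_power \<zeta>_def \<chi> norm_\<omega>)
  have c0: "c0 \<le> 2*p^(10*k)"
  proof -
    have "2*i0*r \<le> 2*p^(K+8*k)*p^(2*k)" using i0 r by (intro mult_mono) auto
    also have "\<dots> = 2*p^(10*k)*P0" by (simp add: P0_def flip: power_add)
    finally have "c0 \<le> (2*p^(10*k)*P0) div P0" unfolding c0_def by (rule div_le_mono)
    thus ?thesis by (simp add: P0_def)
  qed
  have "(\<Sum>s\<in>{..<H}. X s) \<le> 18 * card {..<H} * J * rate^k"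
    unfolding J_def
  proof (rule sum_sample_le)
    show "\<not> p^(3*k+1) dvd 2*r" using k r p_ge_2 by (intro not_dvd_small) auto
    fix i assume s: "i \<in> {..<H}"
    hence i: "i < H" by simp
    show "0 \<le> X i" by (simp add: X_def)
    define x where "x = i0+i"
    define A where "A = x^2"
    define A' where "A' = (x+r)^2"
    have ir: "2*i*r+r^2 < P0"
    proof -
      have "i*r \<le> H*p^(2*k)" using i r by (intro mult_mono) auto
      hence 1: "2*i*r \<le> 2*H*p^(2*k)" by simp
      have "2^2 \<le> (p^k)^2" using z2 by (intro power_mono) auto
      hence z4: "4 \<le> p^(2*k)" by (simp add: power_p_mult)
      hence "4*p^(2*k) \<le> p^(2*k)*p^(2*k)" by (intro mult_right_mono) auto
      also have "\<dots> = p^(4*k)" by (simp flip: power_add)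
      finally have "H*(4*p^(2*k)) \<le> P0" unfolding P0H by (intro mult_left_mono) auto
      hence 2: "2*(2*H*p^(2*k)) \<le> P0" by simp
      have "r^2 < (p^(2*k))^2" using r by (intro power_strict_mono) auto
      hence 3: "r^2 < p^(4*k)" by (simp flip: power_mult)
      have "2*p^(4*k) \<le> H*p^(4*k)"
      proof -
        have "p^1 \<le> p^(K-4*k)" using K k by (intro power_increasing) auto
        hence "2 \<le> H" using p_ge_2 by (simp add: H_def)
        thus ?thesis by (intro mult_right_mono) auto
      qed
      hence "2*p^(4*k) \<le> P0" by (simp add: P0H)
      thus ?thesis using 1 2 3 by linarith
    qed
    have "A' = A + 2*i0*r + (2*i*r+r^2)" by (simp add: A_def A'_def x_def power2_eq_square algebra_simps)
    then obtain e where e: "e < 3" "A' div P0 = A div P0 + c0 + e"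
      using carry_cases[OF ir, of A "2*i0*r"] unfolding c0_def by auto
    define c where "c = c0+e"
    define y where "y j = A div P0 + (2*j*x + j^2*P0)" for j
    define C where "C = f (A mod P0) * cnj (f (A' mod P0)) * cnj \<zeta>^c * cnj \<chi>^r"
    have nC: "norm C = 1" by (simp add: C_def norm_mult norm_power \<zeta>_def \<chi> norm_\<omega>)
    have term_eq: "(f ((x+j*P0)^2) * \<chi>^(x+j*P0)) * cnj (f ((x+r+j*P0)^2) * \<chi>^(x+r+j*P0)) = C * (l j * (f (y j) * cnj (f (y j + (2*j*r+c)))))" for j
    proof -
      have m1: "(x+j*P0)^2 = A + p^K*(2*j*x + j^2*P0)" by (simp add: A_def P0_def power2_eq_square algebra_simps)
      have m2: "(x+r+j*P0)^2 = A' + p^K*(2*j*(x+r) + j^2*P0)" by (simp add: A'_def P0_def power2_eq_square algebra_simps)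
      have m3: "x+r+j*P0 = x+j*P0+r" by simp
      have "A' div p^K + (2*j*(x+r) + j^2*P0) = A div p^K + (2*j*x + j^2*P0) + (2*j*r+c)"
        using e(2) by (simp add: P0_def c_def algebra_simps)
      from correlation_split[OF this]
      have f: "f ((x+j*P0)^2) * cnj (f ((x+r+j*P0)^2)) = f (A mod P0) * cnj (f (A' mod P0)) * (cnj \<zeta>^(2*j*r+c) * (f (y j) * cnj (f (y j + (2*j*r+c)))))"
        unfolding m1[symmetric] m2[symmetric] by (simp add: \<zeta>_def y_def P0_def)
      have g: "\<chi>^(x+j*P0) * cnj (\<chi>^(x+r+j*P0)) = cnj \<chi>^r"
        using unimodular_shift[OF \<chi>, of "x+j*P0" r] unfolding m3 by simp
      have "(f ((x+j*P0)^2) * \<chi>^(x+j*P0)) * cnj (f ((x+r+j*P0)^2) * \<chi>^(x+r+j*P0)) = 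
         (f ((x+j*P0)^2) * cnj (f ((x+r+j*P0)^2))) * (\<chi>^(x+j*P0) * cnj (\<chi>^(x+r+j*P0)))"
        by (simp only: complex_cnj_mult mult_ac)
      also have "\<dots> = C * (l j * (f (y j) * cnj (f (y j + (2*j*r+c)))))"
        unfolding f g C_def l_def power_add[of _ "2*j*r" c] by (simp only: mult_ac)
      finally show ?thesis .
    qed
    have "X i = norm (\<Sum>j<J. C * (l j * (f (y j) * cnj (f (y j + (2*j*r+c))))))"
      unfolding X_def x_def[symmetric] by (simp only: term_eq)
    also have "\<dots> = norm (\<Sum>j<J. l j * (f (y j) * cnj (f (y j + (2*j*r+c)))))"
      by (simp only: sum_distrib_left[symmetric] norm_mult nC mult_1)
    finally have "(X i)^2 = (norm (\<Sum>j<p^(6*k). l j * (f (y j) * cnj (f (y j + (2*j*r+c))))))^2"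
      by (simp add: J_def)
    also have "\<dots> \<le> envelope k 2 r c l (A div P0) x"
    proof (rule norm_correlation_le_envelope)
      fix j assume j: "j < p^(6*k)"
      have "p^(15*k) dvd P0" unfolding P0_def using K by (intro le_imp_power_dvd) auto
      hence "[j^2*P0 = 0] (mod p^(15*k))" by (simp add: cong_0_iff)
      hence "[A div P0 + 2*j*x + j^2*P0 = A div P0 + 2*j*x + 0] (mod p^(15*k))" by (intro cong_add) auto
      thus "[y j = A div P0 + 2*j*x] (mod p^(15*k))" by (simp add: y_def add.assoc)
      show "2*j*r+c < p^(12*k)" unfolding c_def
        using k j r(2) c0 e(1) p_ge_2 by (intro shift_small) auto
    qed (rule l1)
    finally have "(X i)^2 \<le> envelope k 2 r (c0+e) l (\<alpha> i) (i0+i)"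
      by (simp add: c_def \<alpha>_def A_def x_def)
    thus "\<exists>e<3. (X i)^2 \<le> envelope k 2 r (c0+e) l (\<alpha> i) (i0+i)" using e(1) by blast
  next
    fix u v assume u: "u < p^(15*k)" and v: "v < p^(15*k)"
    have eq: "{s\<in>{..<H}. \<alpha> s mod p^(15*k) = u \<and> (i0+s) mod p^(15*k) = v} = 
       {i. i < H \<and> (i0+i) mod Q = v \<and> ((i0+i)^2 div P0) mod Q = u}"
      by (auto simp: \<alpha>_def Q_def)
    have "real (card {i. i < H \<and> (i0+i) mod Q = v \<and> ((i0+i)^2 div P0) mod Q = u}) \<le> 7*H/Q^2"
    proof (rule card_square_class)
      have "2^15 \<le> (p^k)^15" using z2 by (intro power_mono) auto
      thus Q16: "16 \<le> Q" by (simp add: Q_def power_p_mult)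
      show "P0 = Q^22*p^(K-330*k)" using K by (simp add: P0_def Q_def flip: power_mult power_add)
      show "H = p^(K-169*k)*Q^11" using K by (simp add: H_def Q_def flip: power_mult power_add)
      have "150*k+(K-330*k) \<le> K-169*k" using K by simp
      hence "p^(150*k+(K-330*k)) \<le> p^(K-169*k)" by (intro power_increasing) auto
      thus "Q^10*p^(K-330*k) \<le> p^(K-169*k)" by (simp add: Q_def power_add flip: power_mult)
      show "v < Q" using v by (simp add: Q_def)
    qed auto
    thus "real (card {s\<in>{..<H}. \<alpha> s mod p^(15*k) = u \<and> (i0+s) mod p^(15*k) = v}) \<le> 7 * card {..<H} / (real (p^(15*k)))^2"
      unfolding eq by (simp add: Q_def)
  qed (use l1 p_ge_2 in auto)
  thus ?thesis by (simp add: X_def)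
qed

section \<open>Sums over products and over squares\<close>

lemma block_bound:
  fixes v :: "'a \<Rightarrow> nat \<Rightarrow> complex" and k N :: nat
  assumes v1: "\<And>m n. norm (v m n) \<le> 1" 
    and B: "\<And>r. 1 \<le> r \<Longrightarrow> r < p^(2*k) \<Longrightarrow> (\<Sum>n<N*p^(2*k). norm (\<Sum>m\<in>M. v m n * cnj (v m (n+r)))) \<le> 18 * card M * (N*p^(2*k)) * rate^k"
  shows "(\<Sum>m\<in>M. norm (\<Sum>n<N*p^(2*k). v m n)) \<le> 7 * card M * (N*p^(2*k)) * root_rate^k"
proof -
  define R where "R = p^(2*k)"
  define c where "c = real (card M)"
  define n where "n = real N"
  define R' where "R' = real R"
  have R1: "R' > 0" by (simp add: R'_def R_def)
  have rp: "rate^k \<ge> 0" using rate_bounds by simp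
  have iR: "1/R' \<le> rate^k"
  proof -
    have "1/R' = (1/p^k)*(1/p^k)" by (simp add: R'_def R_def power_p_mult power2_eq_square)
    also have "\<dots> \<le> (1/p^k)*1" by (intro mult_left_mono) auto
    also have "\<dots> \<le> rate^k" using inverse_p_power_le[OF rate_bounds(1)] by simp
    finally show ?thesis .
  qed
  have "(\<Sum>m\<in>M. norm (\<Sum>n<N*R. v m n))^2 \<le> card M * N * (card M * N * R + 2 * (\<Sum>r\<in>{1..<R}. 18 * card M * (N*R) * rate^k))"
    using B unfolding R_def by (intro block_cauchy v1) auto
  also have "(\<Sum>r\<in>{1..<R}. 18 * card M * (N*R) * rate^k) \<le> R' * (18 * c * (n*R') * rate^k)"
  proof -
    have "(\<Sum>r\<in>{1..<R}. 18 * card M * (N*R) * rate^k) = real (R-1) * (18 * c * (n*R') * rate^k)"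
      by (simp add: c_def n_def R'_def mult.assoc)
    also have "\<dots> \<le> R' * (18 * c * (n*R') * rate^k)"
      using rp by (intro mult_right_mono) (auto simp: R'_def c_def n_def)
    finally show ?thesis .
  qed
  finally have "(\<Sum>m\<in>M. norm (\<Sum>n<N*R. v m n))^2 \<le> c * n * (c * n * R' + 2 * (R' * (18 * c * (n*R') * rate^k)))"
    by (simp add: c_def n_def R'_def mult_left_mono)
  also have "\<dots> = (c*(n*R'))^2 * (1/R' + 36*rate^k)" using R1 by (simp add: field_simps power2_eq_square)
  also have "\<dots> \<le> (c*(n*R'))^2 * (49*rate^k)" using iR rp by (intro mult_left_mono) auto
  also have "\<dots> = (7 * c * (n*R') * root_rate^k)^2"
  proof -
    have "rate^k = root_rate^k * root_rate^k"
      by (simp add: root_rate_bounds(4)[symmetric] power2_eq_square power_mult_distrib)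
    thus ?thesis by (simp add: power2_eq_square)
  qed
  finally have "(\<Sum>m\<in>M. norm (\<Sum>n<N*R. v m n)) \<le> 7 * c * (n*R') * root_rate^k"
    by (rule power2_le_imp_le) (use root_rate_bounds in \<open>auto simp: c_def n_def R'_def\<close>)
  thus ?thesis by (simp add: c_def n_def R'_def R_def)
qed

text \<open>With p^n \<le> Y < p^(n+1) the choice is K = n-7*k. Then a block of J*P0 = p^(K+6*k)
  points is at most Y/p^k, so that an incomplete last block is negligible, while starting points up
  to Y stay below p^(K+8*k) as the correlation lemmas demand.\<close>

lemma scale_ex:
  assumes k: "k \<ge> 1" and Y: "p^(400*k) \<le> Y"
  shows "\<exists>K. 390*k \<le> K \<and> p^k*p^(K+6*k) \<le> Y \<and> Y \<le> p^(K+8*k)"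
proof -
  have "Y \<ge> 1" using Y p_pos by (metis One_nat_def Suc_leI le_trans zero_less_power)
  then obtain n where n: "p^n \<le> Y" "Y < p^(n+1)" using ex_power_ivl1[OF p_ge_2] by auto
  have "p^(400*k) < p^(n+1)" using Y n by linarith
  hence "400*k < n+1" using p_ge_2 power_less_imp_less_exp[of p "400*k" "n+1"] by simp
  hence nk: "n \<ge> 400*k" by simp
  have "p^k*p^(n-7*k+6*k) \<le> Y" using nk n by (simp flip: power_add)
  moreover have "p^(n+1) \<le> p^(n-7*k+8*k)" using nk k by (intro power_increasing) auto
  ultimately show ?thesis using n nk by (intro exI[of _ "n-7*k"]) auto
qed

lemma sum_scale_le:
  fixes g :: "nat \<Rightarrow> complex" and B x :: real
  assumes g: "\<And>m. norm (g m) \<le> B" and C: "C > 0" and d: "p^k*C \<le> Y"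
    and blk: "\<And>M0. M0 + C \<le> Y \<Longrightarrow> norm (\<Sum>t<C. g (M0+t)) \<le> 7*C*B*x" and x: "1/p^k \<le> x"
  shows "norm (\<Sum>m<Y. g m) \<le> 8*Y*B*x"
proof -
  have B0: "B \<ge> 0" using g norm_ge_zero order.trans by blast
  have x0: "x \<ge> 0" using x by (meson order.trans zero_le_divide_1_iff of_nat_0_le_iff)
  define b where "b = Y div C"
  have Yb: "b*C \<le> Y" "Y = b*C + Y mod C" by (simp_all add: b_def)
  have "(\<Sum>m<Y. g m) = (\<Sum>m<b*C. g m) + (\<Sum>m\<in>{b*C..<Y}. g m)"
    using sum.atLeastLessThan_concat[of 0 "b*C" Y g] Yb(1) by (simp add: lessThan_atLeast0)
  hence "norm (\<Sum>m<Y. g m) \<le> norm (\<Sum>m<b*C. g m) + norm (\<Sum>m\<in>{b*C..<Y}. g m)"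
    by (simp add: norm_triangle_ineq)
  also have "norm (\<Sum>m\<in>{b*C..<Y}. g m) \<le> (\<Sum>m\<in>{b*C..<Y}. B)" by (intro sum_norm_le g)
  also have "\<dots> \<le> C*B"
  proof -
    have "Y - b*C \<le> C" using Yb mod_less_divisor[OF C, of Y] by linarith
    hence "real (Y - b*C) * B \<le> C*B" using B0 by (intro mult_right_mono) auto
    thus ?thesis by simp
  qed
  also have "norm (\<Sum>m<b*C. g m) \<le> (\<Sum>q<b. 7*real C*B*x)"
    unfolding sum_lessThan_mult
  proof (rule sum_norm_le)
    fix q assume "q \<in> {..<b}"
    hence "(q+1)*C \<le> b*C" by (intro mult_right_mono) auto
    hence "q*C + C \<le> Y" using Yb by simp
    thus "norm (\<Sum>t<C. g (q*C+t)) \<le> 7*real C*B*x" by (rule blk)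
  qed
  finally have *: "norm (\<Sum>m<Y. g m) \<le> 7*(real (b*C))*(B*x) + C*B" by (simp add: mult_ac)
  have "7*(real (b*C))*(B*x) \<le> 7*real Y*(B*x)" using Yb B0 x0 by (intro mult_right_mono mult_left_mono) (auto simp del: of_nat_mult)
  moreover have "C*B \<le> Y*(B*x)"
  proof -
    have "real (p^k*C) \<le> real Y" using d by (simp only: of_nat_le_iff)
    hence "real C \<le> Y * (1/p^k)" by (simp add: field_simps)
    also have "\<dots> \<le> Y*x" using x by (intro mult_left_mono) auto
    finally have "C*B \<le> (Y*x)*B" using B0 by (intro mult_right_mono) auto
    thus ?thesis by (simp add: mult_ac)
  qed
  ultimately show ?thesis using * by (simp add: mult_ac)
qed

text \<open>The shift r acts on n. The coefficients b n and cnj (b (n+r)) do not involve m and leave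
  the inner sum, which is why arbitrary bounded b are admissible; arbitrary coefficients in m are
  covered by the outer absolute values. The inner variable m is written as M0 + j*P0 + q*H + l, with
  j giving the second shift.\<close>

theorem bilinear_sum_le:
  fixes b :: "nat \<Rightarrow> complex"
  assumes Y: "p^(400*k) \<le> Y" and b: "\<And>n. norm (b n) \<le> 1" and \<chi>: "norm \<chi> = 1"
  shows "(\<Sum>m<Y. norm (\<Sum>n<p^(105*k). b n * F \<chi> (m*(N0+n)))) \<le> 8*Y*p^(105*k)*root_rate^k"
proof (cases "k = 0")
  case True
  have "(\<Sum>m<Y. norm (\<Sum>n<p^(105*k). b n * F \<chi> (m*(N0+n)))) \<le> (\<Sum>m<Y. 1)"
    using True b \<chi> by (intro sum_mono) (simp add: norm_mult)
  thus ?thesis using True by simp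
next
  case False
  hence k: "k \<ge> 1" by simp
  obtain K where K: "390*k \<le> K" "p^k*p^(K+6*k) \<le> Y" "Y \<le> p^(K+8*k)" using scale_ex[OF k Y] by blast
  define P0 where "P0 = p^K"
  define J where "J = p^(6*k)"
  define H where "H = p^(K-4*k)"
  define N where "N = p^(105*k)"
  define C where "C = J*P0"
  have Ceq: "C = p^(K+6*k)" by (simp add: C_def J_def P0_def power_add)
  have P0H: "P0 = p^(4*k) * H" using K by (simp add: P0_def H_def flip: power_add)
  have NN: "N = p^(103*k)*p^(2*k)" by (simp add: N_def flip: power_add)
  have blk: "(\<Sum>m\<in>{M0..<M0+C}. norm (\<Sum>n<N. b n * F \<chi> (m*(N0+n)))) \<le> 7*C*N*root_rate^k" if M0: "M0+C \<le> Y" for M0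
  proof -
    have "(\<Sum>m\<in>{M0..<M0+C}. norm (\<Sum>n<p^(103*k)*p^(2*k). b n * F \<chi> (m*(N0+n)))) \<le> 7 * card {M0..<M0+C} * (p^(103*k)*p^(2*k)) * root_rate^k"
    proof (rule block_bound)
      fix m n show "norm (b n * F \<chi> (m*(N0+n))) \<le> 1" using b \<chi> by (simp add: norm_mult)
    next
      fix r assume r: "1 \<le> r" "r < p^(2*k)"
      define g where "g m n = F \<chi> (m*(N0+n)) * cnj (F \<chi> (m*(N0+n+r)))" for m n
      have "(\<Sum>n<N. norm (\<Sum>m\<in>{M0..<M0+C}. (b n * F \<chi> (m*(N0+n))) * cnj (b (n+r) * F \<chi> (m*(N0+(n+r)))))) 
         \<le> (\<Sum>n<N. norm (\<Sum>m\<in>{M0..<M0+C}. g m n))"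
      proof (rule sum_mono)
        fix n
        have "(\<Sum>m\<in>{M0..<M0+C}. (b n * F \<chi> (m*(N0+n))) * cnj (b (n+r) * F \<chi> (m*(N0+(n+r))))) = (b n * cnj (b (n+r))) * (\<Sum>m\<in>{M0..<M0+C}. g m n)"
          unfolding sum_distrib_left by (rule sum.cong) (simp_all add: g_def mult_ac add.assoc)
        moreover have "norm (b n * cnj (b (n+r))) \<le> 1"
          using mult_mono[OF b[of n] b[of "n+r"]] by (simp add: norm_mult)
        ultimately show "norm (\<Sum>m\<in>{M0..<M0+C}. (b n * F \<chi> (m*(N0+n))) * cnj (b (n+r) * F \<chi> (m*(N0+(n+r))))) \<le> norm (\<Sum>m\<in>{M0..<M0+C}. g m n)"
          by (simp only: norm_mult[of "b n * cnj (b (n+r))"]) (rule mult_left_le_one_le, auto)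
      qed
      also have "\<dots> \<le> (\<Sum>n<N. \<Sum>i<P0. norm (\<Sum>j<J. g (M0+(j*P0+i)) n))"
      proof (rule sum_mono)
        fix n
        have "(\<Sum>m\<in>{M0..<M0+C}. g m n) = (\<Sum>t<J*P0. g (M0+t) n)"
          using sum.shift_bounds_nat_ivl[of "\<lambda>m. g m n" 0 M0 C] by (simp add: lessThan_atLeast0 C_def add.commute)
        also have "\<dots> = (\<Sum>j<J. \<Sum>i<P0. g (M0+(j*P0+i)) n)" by (rule sum_lessThan_mult)
        also have "\<dots> = (\<Sum>i<P0. \<Sum>j<J. g (M0+(j*P0+i)) n)" by (rule sum.swap)
        finally show "norm (\<Sum>m\<in>{M0..<M0+C}. g m n) \<le> (\<Sum>i<P0. norm (\<Sum>j<J. g (M0+(j*P0+i)) n))"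
          by (simp only: norm_sum)
      qed
      also have "\<dots> = (\<Sum>i<P0. \<Sum>n<N. norm (\<Sum>j<J. g (M0+(j*P0+i)) n))" by (rule sum.swap)
      also have "\<dots> = (\<Sum>q<p^(4*k). \<Sum>l<H. \<Sum>n<N. norm (\<Sum>j<J. g (M0+(j*P0+(q*H+l))) n))"
        unfolding P0H by (rule sum_lessThan_mult)
      also have "\<dots> \<le> (\<Sum>q<p^(4*k). 18*H*N*J*rate^k)"
      proof (rule sum_mono)
        fix q assume q: "q \<in> {..<p^(4*k)}"
        have "q*H \<le> P0" unfolding P0H using q by (intro mult_right_mono) auto
        also have "P0 \<le> C" by (simp add: C_def J_def)
        finally have i0: "M0+q*H \<le> p^(K+8*k)" using M0 K by linarith
        have "(\<Sum>l<H. \<Sum>n<N. norm (\<Sum>j<J. g (M0+q*H+l+j*P0) n)) \<le> 18*H*N*J*rate^k"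
          unfolding g_def N_def J_def P0_def
          using bilinear_correlation_le[OF k _ i0 r \<chi>, of N0, folded H_def] K by simp
        thus "(\<Sum>l<H. \<Sum>n<N. norm (\<Sum>j<J. g (M0+(j*P0+(q*H+l))) n)) \<le> 18*H*N*J*rate^k"
          by (simp only: ac_simps)
      qed
      also have "\<dots> = 18 * card {M0..<M0+C} * N * rate^k" by (simp add: C_def P0H)
      finally show "(\<Sum>n<p^(103*k)*p^(2*k). norm (\<Sum>m\<in>{M0..<M0+C}. (b n * F \<chi> (m*(N0+n))) * cnj (b (n+r) * F \<chi> (m*(N0+(n+r)))))) \<le> 18 * card {M0..<M0+C} * (p^(103*k)*p^(2*k)) * rate^k"
        unfolding NN by simp
    qed
    thus ?thesis unfolding NN by simp
  qed
  \<comment> \<open>\<open>sum_scale_le\<close> is stated for complex terms, so the absolute values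
    are embedded into the complex numbers.\<close>
  have "norm (\<Sum>m<Y. complex_of_real (norm (\<Sum>n<N. b n * F \<chi> (m*(N0+n))))) \<le> 8*real Y*real N*root_rate^k"
  proof (rule sum_scale_le)
    fix m
    have "norm (\<Sum>n<N. b n * F \<chi> (m*(N0+n))) \<le> (\<Sum>n<N. 1)"
      using b \<chi> by (intro sum_norm_le) (simp add: norm_mult)
    thus "norm (complex_of_real (norm (\<Sum>n<N. b n * F \<chi> (m*(N0+n))))) \<le> real N" by simp
  next
    fix M0 assume "M0 + C \<le> Y"
    from blk[OF this]
    have "(\<Sum>t<C. norm (\<Sum>n<N. b n * F \<chi> ((M0+t)*(N0+n)))) \<le> 7*C*N*root_rate^k"
      using sum.shift_bounds_nat_ivl[of "\<lambda>m. norm (\<Sum>n<N. b n * F \<chi> (m*(N0+n)))" 0 M0 C] by (simp add: lessThan_atLeast0 add.commute)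
    thus "norm (\<Sum>t<C. complex_of_real (norm (\<Sum>n<N. b n * F \<chi> ((M0+t)*(N0+n))))) \<le> 7*real C*real N*root_rate^k"
      by (simp flip: of_real_sum add: sum_nonneg)
  qed (use K inverse_p_power_le[OF root_rate_bounds(1)] in \<open>auto simp: Ceq\<close>)
  thus ?thesis by (simp flip: of_real_sum add: sum_nonneg N_def)
qed

text \<open>A single variable plays both roles: m = M0 + n + j*P0, where j is the outer variable of
  \<open>block_bound\<close> and n < P0 is the one shifted by r.\<close>

theorem square_sum_le:
  assumes Y: "p^(400*k) \<le> Y" and \<chi>: "norm \<chi> = 1"
  shows "norm (\<Sum>m<Y. f (m^2) * \<chi>^m) \<le> 8*Y*root_rate^k"
proof (cases "k = 0")
  case True
  have "norm (\<Sum>m<Y. f (m^2) * \<chi>^m) \<le> (\<Sum>m<Y. 1)"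
    using \<chi> by (intro sum_norm_le) (simp add: norm_mult norm_power)
  thus ?thesis using True by simp
next
  case False
  hence k: "k \<ge> 1" by simp
  obtain K where K: "390*k \<le> K" "p^k*p^(K+6*k) \<le> Y" "Y \<le> p^(K+8*k)" using scale_ex[OF k Y] by blast
  define P0 where "P0 = p^K"
  define J where "J = p^(6*k)"
  define H where "H = p^(K-4*k)"
  define C where "C = J*P0"
  have Ceq: "C = p^(K+6*k)" by (simp add: C_def J_def P0_def power_add)
  have P0H: "P0 = p^(4*k) * H" using K by (simp add: P0_def H_def flip: power_add)
  have NN: "P0 = p^(K-2*k)*p^(2*k)" using K by (simp add: P0_def flip: power_add)
  define g where "g m = f (m^2) * \<chi>^m" for m
  have ng: "norm (g m) = 1" for m by (simp add: g_def norm_mult norm_power \<chi>)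
  have blk: "norm (\<Sum>t<C. g (M0+t)) \<le> 7*real C*1*root_rate^k" if M0: "M0+C \<le> Y" for M0
  proof -
    have "(\<Sum>j<J. norm (\<Sum>n<p^(K-2*k)*p^(2*k). g (M0+n+j*P0))) \<le> 7 * card {..<J} * (p^(K-2*k)*p^(2*k)) * root_rate^k"
    proof (rule block_bound)
      fix m n show "norm (g (M0+n+m*P0)) \<le> 1" by (simp add: ng)
    next
      fix r assume r: "1 \<le> r" "r < p^(2*k)"
      have "(\<Sum>i<P0. norm (\<Sum>j<J. g (M0+i+j*P0) * cnj (g (M0+(i+r)+j*P0)))) = 
        (\<Sum>q<p^(4*k). \<Sum>l<H. norm (\<Sum>j<J. g (M0+q*H+l+j*P0) * cnj (g (M0+q*H+l+r+j*P0))))"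
        unfolding P0H sum_lessThan_mult by (simp add: add.assoc)
      also have "\<dots> \<le> (\<Sum>q<p^(4*k). 18*H*J*rate^k)"
      proof (rule sum_mono)
        fix q assume q: "q \<in> {..<p^(4*k)}"
        have "q*H \<le> P0" unfolding P0H using q by (intro mult_right_mono) auto
        also have "P0 \<le> C" by (simp add: C_def J_def)
        finally have i0: "M0+q*H \<le> p^(K+8*k)" using M0 K by linarith
        show "(\<Sum>l<H. norm (\<Sum>j<J. g (M0+q*H+l+j*P0) * cnj (g (M0+q*H+l+r+j*P0)))) \<le> 18*H*J*rate^k"
          unfolding g_def J_def P0_def
          using square_correlation_le[OF k _ i0 r \<chi>, folded H_def] K by simp
      qed
      also have "\<dots> = 18 * card {..<J} * P0 * rate^k" by (simp add: P0H)
      finally show "(\<Sum>n<p^(K-2*k)*p^(2*k). norm (\<Sum>j<J. g (M0+n+j*P0) * cnj (g (M0+(n+r)+j*P0)))) \<le> 18 * card {..<J} * (p^(K-2*k)*p^(2*k)) * rate^k"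
        unfolding NN[symmetric] by simp
    qed
    hence "(\<Sum>j<J. norm (\<Sum>n<P0. g (M0+n+j*P0))) \<le> 7*C*root_rate^k"
      unfolding NN[symmetric] by (simp add: C_def)
    moreover have "norm (\<Sum>t<C. g (M0+t)) \<le> (\<Sum>j<J. norm (\<Sum>n<P0. g (M0+n+j*P0)))"
    proof -
      have "(\<Sum>t<C. g (M0+t)) = (\<Sum>j<J. \<Sum>n<P0. g (M0+(j*P0+n)))" unfolding C_def by (rule sum_lessThan_mult)
      also have "\<dots> = (\<Sum>j<J. \<Sum>n<P0. g (M0+n+j*P0))" by (simp only: ac_simps)
      finally show ?thesis by (simp only: norm_sum)
    qed
    ultimately show ?thesis by simp
  qed
  have "norm (\<Sum>m<Y. g m) \<le> 8*real Y*1*root_rate^k"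
    by (rule sum_scale_le[OF _ _ _ blk]) (use K inverse_p_power_le[OF root_rate_bounds(1)] ng in \<open>auto simp: Ceq\<close>)
  thus ?thesis by (simp add: g_def)
qed

end

section \<open>Linear sums\<close>

lemma norm_one_plus_le:
  assumes "norm (\<zeta>::complex) = 1"
  shows "norm (1+\<zeta>) \<le> 2 - norm (1-\<zeta>)^2/4"
proof -
  have n: "(Re \<zeta>)^2 + (Im \<zeta>)^2 = 1" using assms by (simp add: cmod_def)
  have "norm (1+\<zeta>)^2 = (1 + Re \<zeta>)^2 + (Im \<zeta>)^2" "norm (1-\<zeta>)^2 = (1 - Re \<zeta>)^2 + (Im \<zeta>)^2"
    by (simp_all add: cmod_power2)
  hence s: "norm (1+\<zeta>)^2 + norm (1-\<zeta>)^2 = 4" using n by (simp add: power2_eq_square algebra_simps)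
  define x where "x = norm (1-\<zeta>)^2"
  have x: "0 \<le> x" "x \<le> 4" using s by (auto simp: x_def) (smt (verit) zero_le_power2)
  have "norm (1+\<zeta>)^2 = 4 - x" using s by (simp add: x_def)
  also have "\<dots> \<le> (2 - x/4)^2" by (simp add: power2_eq_square algebra_simps)
  finally have "norm (1+\<zeta>) \<le> 2 - x/4" by (rule power2_le_imp_le) (use x in simp)
  thus ?thesis by (simp add: x_def)
qed

lemma sum_roots_of_unity:
  fixes d n :: nat
  assumes d: "d \<ge> 1"
  shows "(\<Sum>h<d. cis (2*pi*h/d)^n) = (if d dvd n then of_nat d else 0)"
proof -
  define w where "w = cis (2*pi*n/d)"
  have pw: "cis (2*pi*h/d)^n = w^h" for h :: nat
    by (simp add: w_def DeMoivre mult_ac)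
  have wd: "w^d = 1"
  proof -
    have "w^d = cis (2*pi*n)" using d by (simp add: w_def DeMoivre)
    thus ?thesis by (simp add: cis_multiple_2pi)
  qed
  show ?thesis
  proof (cases "w = 1")
    case True
    have "d dvd n"
    proof -
      have "cos (2*pi*n/d) = 1" using True by (simp add: w_def complex_eq_iff)
      then obtain k :: int where k: "2*pi*n/d = of_int k * 2 * pi" by (auto simp: cos_one_2pi_int)
      hence "real n = of_int k * real d" using d by (simp add: field_simps)
      hence "int n = k * int d" by (metis of_int_eq_iff of_int_mult of_int_of_nat_eq)
      thus ?thesis by (metis dvd_triv_right of_nat_dvd_iff)
    qed
    thus ?thesis using True pw by simp
  next
    case False
    have "\<not> d dvd n"
    proof
      assume "d dvd n"
      then obtain k where n: "n = d*k" by blast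
      have "2*pi*n/d = 2*pi*k" using d by (simp add: n)
      hence "w = 1" unfolding w_def using cis_multiple_2pi[of "real k"] by simp
      thus False using False by simp
    qed
    moreover have "(\<Sum>h<d. w^h) = 0" using geometric_sum[OF False, of d] wd by simp
    ultimately show ?thesis using pw by simp
  qed
qed

context digital_phase begin

lemma sum_twist_Suc: "(\<Sum>n<p^Suc W. twist \<zeta> n) = (\<Sum>e<p. \<zeta>^e) * (\<Sum>n<p^W. twist (\<zeta>^p*\<omega>) n)"
proof -
  have "(\<Sum>n<p^Suc W. twist \<zeta> n) = (\<Sum>k<p^W. \<Sum>e<p. twist \<zeta> (k*p+e))"
    using sum_lessThan_mult[of "twist \<zeta>" "p^W" p] by (simp add: mult.commute)
  also have "\<dots> = (\<Sum>k<p^W. \<Sum>e<p. \<zeta>^e * twist (\<zeta>^p*\<omega>) k)"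
    by (intro sum.cong refl) (simp add: twist_digit)
  also have "\<dots> = (\<Sum>e<p. \<zeta>^e) * (\<Sum>n<p^W. twist (\<zeta>^p*\<omega>) n)"
    by (simp add: sum_distrib_left sum_distrib_right)
  finally show ?thesis .
qed

text \<open>The phases of two consecutive digits are \<zeta> and \<zeta>^p*\<omega>. They cannot
  both be closer than \<open>eps\<close> to 1, since this would give |1-\<omega>| < (p+1)*eps. Hence
  in any two digits one geometric sum loses a fixed factor.\<close>

definition eps :: real where "eps = norm (1-\<omega>) / (p+1)"
definition lin_rate :: real where "lin_rate = 1 - eps^2/(4*p)"

lemma eps_bounds: "0 < eps" "eps \<le> 1"
proof -
  show "0 < eps" using \<omega>_neq_1 by (simp add: eps_def)
  have "norm (1-\<omega>) \<le> norm (1::complex) + norm \<omega>" by (rule norm_triangle_ineq4)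
  hence "norm (1-\<omega>) \<le> real p + 1" using norm_\<omega> p_ge_2 by simp
  thus "eps \<le> 1" by (simp add: eps_def)
qed

lemma lin_rate_bounds: "0 < lin_rate" "lin_rate < 1"
proof -
  have "eps^2 \<le> 1" using eps_bounds by (simp add: power_le_one)
  moreover have "0 < eps^2" using eps_bounds by simp
  ultimately show "0 < lin_rate" "lin_rate < 1" using p_ge_2 by (auto simp: lin_rate_def field_simps)
qed

lemma norm_geometric_le:
  fixes \<zeta> :: complex
  assumes \<zeta>: "norm \<zeta> = 1"
  shows "norm (\<Sum>e<p. \<zeta>^e) \<le> p - norm (1-\<zeta>)^2/4" "norm (\<Sum>e<p. \<zeta>^e) \<le> p"
proof -
  have "(\<Sum>e<p. \<zeta>^e) = (\<Sum>e<2. \<zeta>^e) + (\<Sum>e\<in>{2..<p}. \<zeta>^e)"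
    using sum.atLeastLessThan_concat[of 0 2 p "\<lambda>e. \<zeta>^e"] p_ge_2 by (simp add: lessThan_atLeast0)
  also have "(\<Sum>e<2. \<zeta>^e) = 1+\<zeta>" by (simp add: numeral_2_eq_2)
  finally have "norm (\<Sum>e<p. \<zeta>^e) \<le> norm (1+\<zeta>) + norm (\<Sum>e\<in>{2..<p}. \<zeta>^e)" by (simp add: norm_triangle_ineq)
  moreover have "norm (\<Sum>e\<in>{2..<p}. \<zeta>^e) \<le> (\<Sum>e\<in>{2..<p}. 1)" by (intro sum_norm_le) (simp add: norm_power \<zeta>)
  ultimately show a: "norm (\<Sum>e<p. \<zeta>^e) \<le> p - norm (1-\<zeta>)^2/4"
    using norm_one_plus_le[OF \<zeta>] p_ge_2 by (simp add: of_nat_diff)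
  have "norm (1-\<zeta>)^2/4 \<ge> 0" by simp
  thus "norm (\<Sum>e<p. \<zeta>^e) \<le> p" using a by linarith
qed

lemma norm_one_minus_power_le: "norm (\<zeta>::complex) = 1 \<Longrightarrow> norm (1-\<zeta>^n) \<le> n * norm (1-\<zeta>)"
proof -
  assume \<zeta>: "norm \<zeta> = 1"
  have "1-\<zeta>^n = (1-\<zeta>) * (\<Sum>i<n. \<zeta>^i)" by (rule one_diff_power_eq)
  moreover have "norm (\<Sum>i<n. \<zeta>^i) \<le> (\<Sum>i<n. 1)" by (intro sum_norm_le) (simp add: norm_power \<zeta>)
  ultimately show ?thesis using mult_right_mono[of "norm (\<Sum>i<n. \<zeta>^i)" n "norm (1-\<zeta>)"] by (simp add: norm_mult mult.commute)
qed

lemma norm_two_digits_le: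
  fixes \<zeta> :: complex
  assumes \<zeta>: "norm \<zeta> = 1"
  shows "norm (\<Sum>e<p. \<zeta>^e) * norm (\<Sum>e<p. (\<zeta>^p*\<omega>)^e) \<le> p^2 * lin_rate"
proof -
  define \<zeta>' where "\<zeta>' = \<zeta>^p*\<omega>"
  have \<zeta>': "norm \<zeta>' = 1" using \<zeta> norm_\<omega> by (simp add: \<zeta>'_def norm_mult norm_power)
  have "\<zeta>^p * (1-\<omega>) = (1-\<zeta>') - (1-\<zeta>^p)" by (simp add: \<zeta>'_def algebra_simps)
  hence "norm (\<zeta>^p * (1-\<omega>)) \<le> norm (1-\<zeta>') + norm (1-\<zeta>^p)" using norm_triangle_ineq4 by metis
  hence "norm (1-\<omega>) \<le> norm (1-\<zeta>') + p * norm (1-\<zeta>)"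
    using norm_one_minus_power_le[OF \<zeta>, of p] \<zeta> by (simp add: norm_mult norm_power)
  hence "eps \<le> norm (1-\<zeta>) \<or> eps \<le> norm (1-\<zeta>')"
  proof (rule_tac ccontr)
    assume a: "norm (1-\<omega>) \<le> norm (1-\<zeta>') + p * norm (1-\<zeta>)" and "\<not> (eps \<le> norm (1-\<zeta>) \<or> eps \<le> norm (1-\<zeta>'))"
    hence "norm (1-\<zeta>) < eps" "norm (1-\<zeta>') < eps" by auto
    hence "norm (1-\<zeta>') + p * norm (1-\<zeta>) < eps + p * eps" using p_pos by (intro add_less_le_mono mult_left_mono) auto
    also have "\<dots> = (p+1)*eps" by (simp add: algebra_simps)
    also have "\<dots> = norm (1-\<omega>)" unfolding eps_def using p_pos by simp
    finally show False using a by simp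
  qed
  moreover have main: "x * y \<le> p^2 * lin_rate" if "x \<le> p - t^2/4" "y \<le> p" "eps \<le> t" "0 \<le> x" "0 \<le> y" for x y t :: real
  proof -
    have "eps^2 \<le> t^2" using that eps_bounds by (intro power_mono) auto
    hence "x \<le> p - eps^2/4" using that by simp
    hence "x * y \<le> (p - eps^2/4) * p" using that by (intro mult_mono) auto
    also have "\<dots> = p^2 * lin_rate" by (simp add: lin_rate_def field_simps power2_eq_square)
    finally show ?thesis .
  qed
  ultimately show ?thesis
    using main[of "norm (\<Sum>e<p. \<zeta>^e)" "norm (1-\<zeta>)" "norm (\<Sum>e<p. \<zeta>'^e)"] main[of "norm (\<Sum>e<p. \<zeta>'^e)" "norm (1-\<zeta>')" "norm (\<Sum>e<p. \<zeta>^e)"]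
      norm_geometric_le[OF \<zeta>] norm_geometric_le[OF \<zeta>']
    unfolding \<zeta>'_def[symmetric] by (auto simp: mult.commute)
qed

lemma norm_sum_twist_le: "norm \<zeta> = 1 \<Longrightarrow> norm (\<Sum>n<p^(2*k). twist \<zeta> n) \<le> p^(2*k) * lin_rate^k"
proof (induction k arbitrary: \<zeta>)
  case 0 thus ?case by simp
next
  case (Suc k)
  define \<zeta>1 where "\<zeta>1 = \<zeta>^p*\<omega>"
  define \<zeta>2 where "\<zeta>2 = \<zeta>1^p*\<omega>"
  have n1: "norm \<zeta>1 = 1" using Suc.prems norm_\<omega> by (simp add: \<zeta>1_def norm_mult norm_power)
  have n2: "norm \<zeta>2 = 1" using n1 norm_\<omega> by (simp add: \<zeta>2_def norm_mult norm_power)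
  have "2 * Suc k = Suc (Suc (2*k))" by simp
  hence "(\<Sum>n<p^(2*Suc k). twist \<zeta> n) = (\<Sum>e<p. \<zeta>^e) * ((\<Sum>e<p. \<zeta>1^e) * (\<Sum>n<p^(2*k). twist \<zeta>2 n))"
    by (simp only: sum_twist_Suc \<zeta>1_def \<zeta>2_def)
  hence "norm (\<Sum>n<p^(2*Suc k). twist \<zeta> n) = (norm (\<Sum>e<p. \<zeta>^e) * norm (\<Sum>e<p. \<zeta>1^e)) * norm (\<Sum>n<p^(2*k). twist \<zeta>2 n)"
    by (simp add: norm_mult)
  also have "\<dots> \<le> (p^2 * lin_rate) * (p^(2*k) * lin_rate^k)"
    using norm_two_digits_le[OF Suc.prems] Suc.IH[OF n2] lin_rate_bounds unfolding \<zeta>1_def[symmetric]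
    by (intro mult_mono[of "_ * _"]) auto
  also have "\<dots> = p^(2*Suc k) * lin_rate^Suc k" by (simp add: power_add power2_eq_square)
  finally show ?case .
qed

lemma norm_sum_F_le:
  assumes \<chi>: "norm \<chi> = 1"
  shows "norm (\<Sum>n<X. F \<chi> n) \<le> X * lin_rate^k + p^(2*k)"
proof -
  define C where "C = p^(2*k)"
  have C0: "C > 0" by (simp add: C_def)
  define b where "b = X div C"
  have Xb: "b*C \<le> X" "X = b*C + X mod C" by (simp_all add: b_def)
  have "(\<Sum>n<X. F \<chi> n) = (\<Sum>n<b*C. F \<chi> n) + (\<Sum>n\<in>{b*C..<X}. F \<chi> n)"
    using sum.atLeastLessThan_concat[of 0 "b*C" X "F \<chi>"] Xb(1) by (simp add: lessThan_atLeast0)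
  hence "norm (\<Sum>n<X. F \<chi> n) \<le> norm (\<Sum>n<b*C. F \<chi> n) + norm (\<Sum>n\<in>{b*C..<X}. F \<chi> n)"
    by (simp add: norm_triangle_ineq)
  moreover have "norm (\<Sum>n\<in>{b*C..<X}. F \<chi> n) \<le> C"
  proof -
    have "norm (\<Sum>n\<in>{b*C..<X}. F \<chi> n) \<le> (\<Sum>n\<in>{b*C..<X}. 1)" by (intro sum_norm_le) (simp add: \<chi>)
    also have "\<dots> = real (X - b*C)" by simp
    also have "\<dots> \<le> C"
    proof -
      have "X - b*C \<le> C" using Xb mod_less_divisor[OF C0, of X] by linarith
      thus ?thesis by simp
    qed
    finally show ?thesis .
  qed
  moreover have "norm (\<Sum>n<b*C. F \<chi> n) \<le> X * lin_rate^k"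
  proof -
    have "norm (\<Sum>n<b*C. F \<chi> n) \<le> (\<Sum>q<b. C * lin_rate^k)"
      unfolding sum_lessThan_mult
    proof (rule sum_norm_le)
      fix q
      define u where "u = (\<omega>^repunit (2*k))^q * f q * \<chi>^(q*C)"
      have nu: "norm u = 1" by (simp add: u_def norm_mult norm_power \<chi> norm_\<omega>)
      have "(\<Sum>e<C. F \<chi> (q*C+e)) = (\<Sum>e<C. u * twist \<chi> e)"
      proof (rule sum.cong[OF refl])
        fix e assume "e \<in> {..<C}"
        hence "f (e + C*q) = f e * (\<omega>^repunit (2*k))^q * f q" unfolding C_def by (intro f_split) auto
        moreover have "q*C+e = e + C*q" by (simp add: mult.commute)
        moreover have "\<chi>^(q*C+e) = \<chi>^e * \<chi>^(q*C)" by (simp add: power_add)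
        ultimately show "F \<chi> (q*C+e) = u * twist \<chi> e" unfolding F_def twist_def u_def by (metis mult.assoc mult.commute)
      qed
      also have "norm \<dots> = norm (\<Sum>e<C. twist \<chi> e)" by (simp add: sum_distrib_left[symmetric] norm_mult nu)
      also have "\<dots> \<le> C * lin_rate^k" using norm_sum_twist_le[OF \<chi>, of k] by (simp add: C_def)
      finally show "norm (\<Sum>e<C. F \<chi> (q*C+e)) \<le> C * lin_rate^k" .
    qed
    also have "\<dots> = real (b*C) * lin_rate^k" by simp
    also have "\<dots> \<le> X * lin_rate^k" using Xb lin_rate_bounds by (intro mult_right_mono) (auto simp del: of_nat_mult)
    finally show ?thesis .
  qed
  ultimately show ?thesis by (simp add: C_def)
qed

lemma F_mult: "F (\<chi>*\<xi>) n = F \<chi> n * \<xi>^n" by (simp add: F_def power_mult_distrib)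

text \<open>Divisibility by d is detected with d-th roots of unity. Each twisted \<chi> is again
  unimodular, so \<open>norm_sum_F_le\<close> holds for all of them, and their number cancels
  against the factor d on the left.\<close>

lemma norm_sum_F_multiples_le:
  assumes \<chi>: "norm \<chi> = 1" and d: "d \<ge> 1"
  shows "norm (\<Sum>e<Z. F \<chi> (d*e)) \<le> d*Z * lin_rate^k + p^(2*k)"
proof -
  have "of_nat d * (\<Sum>e<Z. F \<chi> (d*e)) = (\<Sum>n<Z*d. F \<chi> n * (if d dvd n then of_nat d else 0))"
  proof -
    have "(\<Sum>n<Z*d. F \<chi> n * (if d dvd n then of_nat d else 0)) = (\<Sum>e<Z. \<Sum>i<d. F \<chi> (e*d+i) * (if d dvd e*d+i then of_nat d else 0))"
      by (rule sum_lessThan_mult)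
    also have "\<dots> = (\<Sum>e<Z. \<Sum>i<d. if i = 0 then F \<chi> (e*d) * of_nat d else 0)"
      by (intro sum.cong refl) (auto simp: dvd_add_right_iff dest: nat_dvd_not_less)
    also have "\<dots> = (\<Sum>e<Z. F \<chi> (e*d) * of_nat d)" using d by (simp add: sum.delta)
    finally show ?thesis by (simp add: sum_distrib_left mult.commute)
  qed
  also have "\<dots> = (\<Sum>n<Z*d. \<Sum>h<d. F (\<chi> * cis (2*pi*h/d)) n)"
    by (intro sum.cong refl) (simp add: sum_roots_of_unity[OF d, symmetric] sum_distrib_left F_mult)
  also have "\<dots> = (\<Sum>h<d. \<Sum>n<Z*d. F (\<chi> * cis (2*pi*h/d)) n)" by (rule sum.swap)
  also have "norm \<dots> \<le> (\<Sum>h<d. real (Z*d) * lin_rate^k + p^(2*k))"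
    by (intro sum_norm_le norm_sum_F_le) (simp add: norm_mult \<chi>)
  finally have "d * norm (\<Sum>e<Z. F \<chi> (d*e)) \<le> d * (real (d*Z) * lin_rate^k + p^(2*k))"
    by (simp add: norm_mult mult_ac)
  thus ?thesis using d by simp
qed

end

section \<open>A combinatorial identity for the von Mangoldt function\<close>

definition mob :: "nat \<Rightarrow> real" where
  "mob n = (if squarefree n then (-1) ^ card (prime_factors n) else 0)"

lemma abs_mob_le_1: "\<bar>mob n\<bar> \<le> 1" by (simp add: mob_def power_abs)

lemma mob_mult_prime:
  assumes q: "prime q" and nd: "\<not> q dvd d"
  shows "mob (q*d) = - mob d"
proof -
  have d0: "d \<noteq> 0" using nd by (intro notI) simp
  have cop: "coprime q d" using q nd by (rule prime_imp_coprime)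
  have "squarefree (q*d) \<longleftrightarrow> squarefree d"
    using squarefree_mult_coprime[OF cop squarefree_prime[OF q]] squarefree_multD(2) by blast
  moreover have "prime_factors (q*d) = insert q (prime_factors d)"
    using q d0 by (subst prime_factors_product) (auto simp: prime_factorization_prime)
  moreover have "q \<notin> prime_factors d" using nd by auto
  ultimately show ?thesis by (simp add: mob_def)
qed

text \<open>For a prime q dividing n, multiplication by q pairs the squarefree divisors prime to q
  with those divisible by q, and reverses the sign.\<close>

lemma sum_mob:
  assumes n: "n \<ge> 1"
  shows "(\<Sum>d | d dvd n. mob d) = (if n = 1 then 1 else 0)"
proof (cases "n = 1")
  case True
  have "{d. d dvd (1::nat)} = {1}" by auto
  thus ?thesis using True by (simp add: mob_def)
next
  case False
  then obtain q where q: "prime q" "q dvd n" using prime_factor_nat by blast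
  define A where "A = {d. d dvd n \<and> squarefree d \<and> \<not> q dvd d}"
  define B where "B = {d. d dvd n \<and> squarefree d \<and> q dvd d}"
  have fin: "finite {d. d dvd n}" using n by (intro finite_divisors_nat) auto
  have finA: "finite A" by (rule finite_subset[OF _ fin]) (auto simp: A_def)
  have finB: "finite B" by (rule finite_subset[OF _ fin]) (auto simp: B_def)
  have img: "B = (\<lambda>d. q*d) ` A"
  proof (intro subset_antisym subsetI)
    fix d assume d: "d \<in> B"
    then obtain e where e: "d = q*e" by (auto simp: B_def)
    have "\<not> q dvd e"
    proof
      assume "q dvd e"
      hence "q^2 dvd d" by (auto simp: e power2_eq_square)
      moreover have "squarefree d" using d by (simp add: B_def)
      ultimately have "q dvd 1" by (rule squarefreeD[rotated])
      thus False using q by (metis not_prime_unit)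
    qed
    moreover have "squarefree e" using d unfolding B_def e by (auto dest: squarefree_multD(2))
    moreover have "e dvd n" using d unfolding B_def e by (auto dest: dvd_mult_right)
    ultimately show "d \<in> (\<lambda>d. q*d) ` A" using e by (auto simp: A_def)
  next
    fix d assume "d \<in> (\<lambda>d. q*d) ` A"
    then obtain e where e: "d = q*e" "e dvd n" "squarefree e" "\<not> q dvd e" by (auto simp: A_def)
    have cop: "coprime q e" using q(1) e(4) by (rule prime_imp_coprime)
    have "squarefree d" unfolding e(1) using squarefree_mult_coprime[OF cop squarefree_prime[OF q(1)] e(3)] .
    moreover have "d dvd n" unfolding e(1) using divides_mult[OF q(2) e(2) cop] .
    ultimately show "d \<in> B" using e(1) by (auto simp: B_def)
  qed
  have "(\<Sum>d | d dvd n. mob d) = (\<Sum>d\<in>A \<union> B. mob d)"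
    by (rule sum.mono_neutral_right[OF fin]) (auto simp: A_def B_def mob_def)
  also have "\<dots> = (\<Sum>d\<in>A. mob d) + (\<Sum>d\<in>B. mob d)"
    by (rule sum.union_disjoint[OF finA finB]) (auto simp: A_def B_def)
  also have "(\<Sum>d\<in>B. mob d) = (\<Sum>d\<in>A. mob (q*d))"
    unfolding img using q(1) by (subst sum.reindex) (auto simp: inj_on_def prime_gt_0_nat)
  also have "\<dots> = (\<Sum>d\<in>A. - mob d)" by (rule sum.cong) (auto simp: A_def mob_mult_prime[OF q(1)])
  finally show ?thesis using False by (simp add: sum_negf)
qed

lemma sum_divisor_convolution:
  fixes H :: "nat \<Rightarrow> nat \<Rightarrow> 'a::comm_monoid_add"
  shows "(\<Sum>n\<in>{1..X}. \<Sum>d | d dvd n. H d (n div d)) = (\<Sum>d\<in>{1..X}. \<Sum>m\<in>{1..X div d}. H d m)"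
proof -
  have "(\<Sum>n\<in>{1..X}. \<Sum>d | d dvd n. H d (n div d)) = (\<Sum>(n,d)\<in>(SIGMA n:{1..X}. {d. d dvd n}). H d (n div d))"
    by (rule sum.Sigma) auto
  also have "\<dots> = (\<Sum>(d,m)\<in>(SIGMA d:{1..X}. {1..X div d}). H d m)"
  proof (rule sum.reindex_bij_witness[of _ "\<lambda>(d,m). (d*m,d)" "\<lambda>(n,d). (d, n div d)"])
    fix a assume a: "a \<in> (SIGMA n:{1..X}. {d. d dvd n})"
    then obtain n d where nd: "a = (n,d)" "1 \<le> n" "n \<le> X" "d dvd n" by auto
    have d0: "1 \<le> d" using nd by (auto intro: Nat.gr0I simp: Suc_le_eq)
    show "(case case a of (n,d) \<Rightarrow> (d, n div d) of (d,m) \<Rightarrow> (d*m,d)) = a" using nd by simp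
    have "d \<le> n" using nd by (auto intro: dvd_imp_le)
    moreover have "n div d \<le> X div d" using nd by (intro div_le_mono)
    moreover have "1 \<le> n div d" using nd d0 calculation(1) by (simp add: Suc_le_eq div_greater_zero_iff)
    ultimately show "(case a of (n,d) \<Rightarrow> (d, n div d)) \<in> (SIGMA d:{1..X}. {1..X div d})"
      using nd d0 by auto
  next
    fix b assume "b \<in> (SIGMA d:{1..X}. {1..X div d})"
    then obtain d m where dm: "b = (d,m)" "1 \<le> d" "d \<le> X" "1 \<le> m" "m \<le> X div d" by auto
    show "(case case b of (d,m) \<Rightarrow> (d*m,d) of (n,d) \<Rightarrow> (d, n div d)) = b" using dm by simp
    have "d*m \<le> d*(X div d)" using dm by (intro mult_left_mono) auto
    also have "\<dots> \<le> X" by simp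
    finally show "(case b of (d,m) \<Rightarrow> (d*m,d)) \<in> (SIGMA n:{1..X}. {d. d dvd n})"
      using dm by auto
  qed auto
  also have "\<dots> = (\<Sum>d\<in>{1..X}. \<Sum>m\<in>{1..X div d}. H d m)" by (rule sum.Sigma[symmetric]) auto
  finally show ?thesis .
qed

lemma sum_hyperbola_swap:
  fixes H :: "nat \<Rightarrow> nat \<Rightarrow> 'a::comm_monoid_add"
  shows "(\<Sum>d\<in>{1..X}. \<Sum>m\<in>{1..X div d}. H d m) = (\<Sum>m\<in>{1..X}. \<Sum>d\<in>{1..X div m}. H d m)"
proof -
  have le: "m \<le> X div d \<longleftrightarrow> d*m \<le> X" if "1 \<le> d" for d m
    using that by (simp add: less_eq_div_iff_mult_less_eq mult.commute)
  have "(\<Sum>d\<in>{1..X}. \<Sum>m\<in>{1..X div d}. H d m) = (\<Sum>(d,m)\<in>(SIGMA d:{1..X}. {1..X div d}). H d m)"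
    by (rule sum.Sigma) auto
  also have "\<dots> = (\<Sum>(m,d)\<in>(SIGMA m:{1..X}. {1..X div m}). H d m)"
  proof (rule sum.reindex_bij_witness[of _ "\<lambda>(m,d). (d,m)" "\<lambda>(d,m). (m,d)"])
    fix a assume "a \<in> (SIGMA d:{1..X}. {1..X div d})"
    then obtain d m where dm: "a = (d,m)" "1 \<le> d" "d \<le> X" "1 \<le> m" "m \<le> X div d" by auto
    hence "d*m \<le> X" using le by simp
    moreover from this have "m \<le> X" using dm(2) by (metis le_trans mult_le_mono1 nat_mult_1)
    ultimately show "(case a of (d,m) \<Rightarrow> (m,d)) \<in> (SIGMA m:{1..X}. {1..X div m})"
      using dm le[of m d] by (simp add: mult.commute)
  next
    fix a assume "a \<in> (SIGMA m:{1..X}. {1..X div m})"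
    then obtain d m where dm: "a = (m,d)" "1 \<le> m" "m \<le> X" "1 \<le> d" "d \<le> X div m" by auto
    hence "m*d \<le> X" using le by simp
    moreover from this have "d \<le> X" using dm(2) by (metis le_trans mult_le_mono1 nat_mult_1)
    ultimately show "(case a of (m,d) \<Rightarrow> (d,m)) \<in> (SIGMA d:{1..X}. {1..X div d})"
      using dm le[of d m] by (simp add: mult.commute)
  qed auto
  also have "\<dots> = (\<Sum>m\<in>{1..X}. \<Sum>d\<in>{1..X div m}. H d m)" by (rule sum.Sigma[symmetric]) auto
  finally show ?thesis .
qed

text \<open>The divisor sum of the von Mangoldt function above V. Moebius inversion recovers
  mangoldt on n > V. It vanishes up to V and lies between 0 and ln m, which is what the bilinear
  estimate needs of a coefficient.\<close>

definition tail_log :: "nat \<Rightarrow> nat \<Rightarrow> real" where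
  "tail_log V m = (\<Sum>k | k dvd m \<and> V < k. mangoldt k)"

lemma tail_log_eq:
  assumes m: "m \<ge> 1"
  shows "tail_log V m = ln m - (\<Sum>k | k dvd m \<and> k \<le> V. mangoldt k)"
proof -
  have fin: "finite {k. k dvd m}" using m by (intro finite_divisors_nat) auto
  have "(\<Sum>k | k dvd m. mangoldt k) = (\<Sum>k\<in>{k. k dvd m \<and> k \<le> V} \<union> {k. k dvd m \<and> V < k}. mangoldt k :: real)"
    by (rule sum.cong) auto
  also have "\<dots> = (\<Sum>k | k dvd m \<and> k \<le> V. mangoldt k) + (\<Sum>k | k dvd m \<and> V < k. mangoldt k)"
    by (rule sum.union_disjoint) (auto intro: finite_subset[OF _ fin])
  finally show ?thesis using mangoldt_sum[of m, where ?'a = real] m by (simp add: tail_log_def)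
qed

lemma tail_log_bounds:
  assumes "m \<ge> 1"
  shows "0 \<le> tail_log V m" "tail_log V m \<le> ln m"
proof -
  show "0 \<le> tail_log V m" unfolding tail_log_def by (intro sum_nonneg mangoldt_nonneg)
  have "0 \<le> (\<Sum>k | k dvd m \<and> k \<le> V. mangoldt k :: real)" by (intro sum_nonneg mangoldt_nonneg)
  thus "tail_log V m \<le> ln m" using tail_log_eq[OF assms] by simp
qed

lemma tail_log_eq_0: "1 \<le> m \<Longrightarrow> m \<le> V \<Longrightarrow> tail_log V m = 0"
  unfolding tail_log_def by (rule sum.neutral) (auto dest: dvd_imp_le)

lemma sum_mob_tail_log:
  assumes n: "n \<ge> 1"
  shows "(\<Sum>d | d dvd n. mob d * tail_log V (n div d)) = (if V < n then mangoldt n else 0)"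
proof -
  have fin: "finite {d. d dvd n}" using n by (intro finite_divisors_nat) auto
  have div_le: "finite {k. k dvd n div d \<and> V < k}" if "d dvd n" for d
  proof (rule finite_subset[OF _ fin])
    have "n div d dvd n" using that by (metis dvd_div_mult_self dvd_triv_left)
    thus "{k. k dvd n div d \<and> V < k} \<subseteq> {k. k dvd n}" by (auto intro: dvd_trans)
  qed
  have finS: "finite {k. k dvd n \<and> V < k}" by (rule finite_subset[OF _ fin]) auto
  have finD: "finite {d. d dvd n div k}" if "k dvd n" for k
  proof (rule finite_subset[OF _ fin])
    have "n div k dvd n" using that by (metis dvd_div_mult_self dvd_triv_left)
    thus "{d. d dvd n div k} \<subseteq> {k. k dvd n}" by (auto intro: dvd_trans)
  qed
  have iff: "d dvd n \<and> k dvd n div d \<longleftrightarrow> k*d dvd n" for d k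
  proof (cases "d dvd n")
    case True
    moreover have "d \<noteq> 0" using True n by (intro notI) simp
    ultimately show ?thesis using dvd_div_iff_mult[of d n k] by simp
  next
    case False thus ?thesis by (auto dest: dvd_mult_right)
  qed
  have sw: "d dvd n \<and> k dvd n div d \<longleftrightarrow> k dvd n \<and> d dvd n div k" for d k
    using iff[of d k] iff[of k d] by (simp add: mult.commute)
  have "(\<Sum>d | d dvd n. mob d * tail_log V (n div d)) = (\<Sum>d | d dvd n. \<Sum>k | k dvd n div d \<and> V < k. mob d * mangoldt k)"
    by (simp add: tail_log_def sum_distrib_left)
  also have "\<dots> = (\<Sum>(d,k)\<in>(SIGMA d:{d. d dvd n}. {k. k dvd n div d \<and> V < k}). mob d * mangoldt k)"
    by (rule sum.Sigma) (use fin div_le in auto)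
  also have "\<dots> = (\<Sum>(k,d)\<in>(SIGMA k:{k. k dvd n \<and> V < k}. {d. d dvd n div k}). mob d * mangoldt k)"
    by (rule sum.reindex_bij_witness[of _ "\<lambda>(k,d). (d,k)" "\<lambda>(d,k). (k,d)"]) (use sw in auto)
  also have "\<dots> = (\<Sum>k | k dvd n \<and> V < k. \<Sum>d | d dvd n div k. mob d * mangoldt k)"
    by (rule sum.Sigma[symmetric]) (use finS finD in auto)
  also have "\<dots> = (\<Sum>k | k dvd n \<and> V < k. if k = n then mangoldt n else 0)"
  proof (rule sum.cong[OF refl])
    fix k assume k: "k \<in> {k. k dvd n \<and> V < k}"
    have "n div k \<ge> 1" using k n by (auto simp: Suc_le_eq div_greater_zero_iff intro!: dvd_imp_le Nat.gr0I)
    hence "(\<Sum>d | d dvd n div k. mob d) = (if n div k = 1 then 1 else 0)" by (rule sum_mob)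
    moreover have "n div k = 1 \<longleftrightarrow> k = n" using k n by (auto elim!: dvdE)
    ultimately show "(\<Sum>d | d dvd n div k. mob d * mangoldt k) = (if k = n then mangoldt n else 0)"
      by (simp add: sum_distrib_right[symmetric])
  qed
  also have "\<dots> = (if V < n then mangoldt n else 0)"
    using finS by (simp add: sum.delta)
  finally show ?thesis .
qed

section \<open>Partial summation\<close>

lemma norm_sum_decreasing_weights:
  fixes g :: "nat \<Rightarrow> complex" and w :: "nat \<Rightarrow> real"
  assumes dec: "\<And>i. w (Suc i) \<le> w i" and w0: "\<And>i. 0 \<le> w i"
    and E: "\<And>j. j \<le> M \<Longrightarrow> norm (\<Sum>i<j. g i) \<le> E"
  shows "norm (\<Sum>i<M. of_real (w i) * g i) \<le> w 0 * E"
proof -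
  define S where "S j = (\<Sum>i<j. g i)" for j
  have id: "(\<Sum>i<M. of_real (w i) * g i) = of_real (w M) * S M + (\<Sum>i<M. of_real (w i - w (Suc i)) * S (Suc i))" for M
    by (induction M) (simp_all add: S_def algebra_simps)
  have "norm (\<Sum>i<M. of_real (w i) * g i) \<le> norm (of_real (w M) * S M) + norm (\<Sum>i<M. of_real (w i - w (Suc i)) * S (Suc i))"
    unfolding id by (rule norm_triangle_ineq)
  also have "norm (\<Sum>i<M. of_real (w i - w (Suc i)) * S (Suc i)) \<le> (\<Sum>i<M. (w i - w (Suc i)) * E)"
  proof (rule sum_norm_le)
    fix i assume "i \<in> {..<M}"
    hence "norm (S (Suc i)) \<le> E" unfolding S_def by (intro E) auto
    thus "norm (of_real (w i - w (Suc i)) * S (Suc i)) \<le> (w i - w (Suc i)) * E"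
      using dec[of i] by (simp add: norm_mult mult_left_mono del: of_real_diff)
  qed
  also have "norm (of_real (w M) * S M) \<le> w M * E"
    using E[of M] w0[of M] by (simp add: norm_mult S_def mult_left_mono)
  also have "(\<Sum>i<M. (w i - w (Suc i)) * E) = (w 0 - w M) * E"
    by (simp add: sum_distrib_right[symmetric] sum_lessThan_telescope')
  finally show ?thesis by (simp add: algebra_simps)
qed

lemma norm_sum_log_weights:
  fixes g :: "nat \<Rightarrow> complex"
  assumes E: "\<And>j. j \<le> M \<Longrightarrow> norm (\<Sum>i\<in>{1..j}. g i) \<le> E" and M: "M \<ge> 1"
  shows "norm (\<Sum>i\<in>{1..M}. of_real (ln i) * g i) \<le> 2 * ln M * E"
proof -
  \<comment> \<open>The logarithm increases, so partial summation is applied to its complement ln M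
    - ln i; the cut at 0 keeps the weights nonnegative and decreasing beyond M.\<close>
  define w where "w i = max 0 (ln (real M) - ln (real (Suc i)))" for i
  define G where "G i = g (Suc i)" for i
  have sh: "(\<Sum>i\<in>{1..j}. h i) = (\<Sum>i<j. h (Suc i))" for h :: "nat \<Rightarrow> complex" and j
    by (simp add: sum.atLeast1_atMost_eq)
  have E': "norm (\<Sum>i<j. G i) \<le> E" if "j \<le> M" for j using E[OF that] unfolding sh G_def .
  have "norm (\<Sum>i<M. of_real (w i) * G i) \<le> w 0 * E"
  proof (rule norm_sum_decreasing_weights)
    show "w (Suc i) \<le> w i" for i unfolding w_def by (intro max.mono diff_mono order.refl ln_mono) auto
  qed (use E' in \<open>auto simp: w_def\<close>)
  moreover have "w 0 = ln M" using M by (simp add: w_def)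
  moreover have "(\<Sum>i\<in>{1..M}. of_real (ln i) * g i) = of_real (ln M) * (\<Sum>i<M. G i) - (\<Sum>i<M. of_real (w i) * G i)"
  proof -
    have "(\<Sum>i<M. of_real (w i) * G i) = (\<Sum>i<M. of_real (ln M) * G i - of_real (ln (real (Suc i))) * G i)"
    proof (rule sum.cong[OF refl])
      fix i assume "i \<in> {..<M}"
      hence "w i = ln M - ln (real (Suc i))" by (simp add: w_def)
      thus "of_real (w i) * G i = of_real (ln M) * G i - of_real (ln (real (Suc i))) * G i"
        by (simp add: left_diff_distrib del: of_nat_Suc)
    qed
    thus ?thesis unfolding sh by (simp add: sum_subtractf sum_distrib_left G_def del: of_nat_Suc)
  qed
  moreover have "norm (of_real (ln M) * (\<Sum>i<M. G i)) \<le> ln M * E"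
    using E'[of M] M by (simp add: norm_mult mult_left_mono)
  ultimately show ?thesis
    using norm_triangle_ineq4[of "of_real (ln M) * (\<Sum>i<M. G i)" "\<Sum>i<M. of_real (w i) * G i"] by simp
qed

lemma sum_inverse_le_ln: "Q \<ge> 1 \<Longrightarrow> (\<Sum>q<Q. 1 / real (q+1)) \<le> 1 + ln Q"
proof (induction Q rule: nat_induct_at_least)
  case (Suc n)
  have "1 / real (n+1) \<le> ln (real (Suc n)) - ln (real n)"
  proof -
    have "ln (real n / real (Suc n)) \<le> real n / real (Suc n) - 1" using Suc by (intro ln_le_minus_one) auto
    moreover have "ln (real n / real (Suc n)) = ln (real n) - ln (real (Suc n))" using Suc by (simp add: ln_div)
    moreover have "real n / real (Suc n) - 1 = - (1 / real (n+1))" by (simp add: field_simps)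
    ultimately show ?thesis by linarith
  qed
  thus ?case using Suc by simp
qed simp

section \<open>Sums over prime powers and primes\<close>

context digital_phase begin

lemma norm_sum_multiples_le:
  fixes D Z X k :: nat
  assumes \<chi>: "norm \<chi> = 1" and D: "D \<ge> 1" and DZ: "D*Z \<le> X"
  shows "norm (\<Sum>e\<in>{1..Z}. F \<chi> (D*e)) \<le> 2*X*lin_rate^k + p^(2*k) + 1"
proof (cases "Z = 0")
  case True thus ?thesis using lin_rate_bounds by (simp add: add_nonneg_nonneg)
next
  case False
  have eq: "(\<Sum>e<Suc Z. F \<chi> (D*e)) = F \<chi> 0 + (\<Sum>e\<in>{1..Z}. F \<chi> (D*e))"
    by (subst sum.lessThan_Suc_shift) (simp add: sum.atLeast1_atMost_eq)
  have "norm (\<Sum>e\<in>{1..Z}. F \<chi> (D*e)) \<le> norm (\<Sum>e<Suc Z. F \<chi> (D*e)) + norm (F \<chi> 0)"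
    unfolding eq using norm_triangle_ineq4[of "F \<chi> 0 + (\<Sum>e\<in>{1..Z}. F \<chi> (D*e))" "F \<chi> 0"] by simp
  also have "norm (\<Sum>e<Suc Z. F \<chi> (D*e)) \<le> real (D*Suc Z) * lin_rate^k + p^(2*k)"
    using norm_sum_F_multiples_le[OF \<chi> D, of "Suc Z" k] by (simp only: of_nat_mult)
  also have "real (D*Suc Z) * lin_rate^k \<le> real (2*X) * lin_rate^k"
  proof -
    have "D*1 \<le> D*Z" using False by (intro mult_left_mono) auto
    hence "D*Suc Z \<le> 2*X" using DZ unfolding mult_Suc_right by linarith
    hence "real (D*Suc Z) \<le> real (2*X)" by (simp only: of_nat_le_iff)
    thus ?thesis using lin_rate_bounds by (intro mult_right_mono) auto
  qed
  finally show ?thesis by (simp add: \<chi>)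
qed

text \<open>For bounded d the coefficient is replaced by ln m minus the mangoldt sum over divisors k
  \<le> V. The first part is handled by partial summation, the second becomes sums over the
  multiples of d*k. In all, about V^2 linear sums occur, each at most E.\<close>

lemma norm_type_I_le:
  fixes V X k :: nat
  defines "E \<equiv> 2*X*lin_rate^k + p^(2*k) + 1"
  assumes \<chi>: "norm \<chi> = 1" and V: "V \<ge> 1" and X: "X \<ge> 1"
  shows "norm (\<Sum>d\<in>{1..V}. of_real (mob d) * (\<Sum>m\<in>{1..X div d}. of_real (tail_log V m) * F \<chi> (d*m))) \<le> 3*V^2*ln X*E"
proof -
  have E0: "E \<ge> 0" using lin_rate_bounds by (simp add: E_def)
  have mult: "norm (\<Sum>e\<in>{1..Z}. F \<chi> (D*e)) \<le> E" if "D \<ge> 1" "D*Z \<le> X" for D Z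
    unfolding E_def using norm_sum_multiples_le[OF \<chi> that] by simp
  have inner: "norm (\<Sum>m\<in>{1..X div d}. of_real (tail_log V m) * F \<chi> (d*m)) \<le> 3*V*ln X*E" if d: "d \<ge> 1" for d
  proof -
    define M where "M = X div d"
    have dM: "d*M \<le> X" by (simp add: M_def)
    have MX: "M \<le> X" by (simp add: M_def)
    have "(\<Sum>m\<in>{1..M}. of_real (tail_log V m) * F \<chi> (d*m)) = (\<Sum>m\<in>{1..M}. of_real (ln m) * F \<chi> (d*m))
       - (\<Sum>m\<in>{1..M}. of_real (\<Sum>k | k dvd m \<and> k \<le> V. mangoldt k) * F \<chi> (d*m))"
      unfolding sum_subtractf[symmetric]
      by (rule sum.cong[OF refl]) (simp add: tail_log_eq left_diff_distrib)
    moreover have "norm (\<Sum>m\<in>{1..M}. of_real (ln m) * F \<chi> (d*m)) \<le> 2 * ln X * E"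
    proof (cases "M = 0")
      case True thus ?thesis using E0 X by simp
    next
      case False
      have "norm (\<Sum>m\<in>{1..M}. of_real (ln m) * F \<chi> (d*m)) \<le> 2 * ln M * E"
      proof (rule norm_sum_log_weights)
        fix j assume "j \<le> M"
        hence "d*j \<le> d*M" by simp
        hence "d*j \<le> X" using dM by linarith
        thus "norm (\<Sum>i\<in>{1..j}. F \<chi> (d*i)) \<le> E" using d by (intro mult)
      qed (use False in simp)
      also have "\<dots> \<le> 2 * ln X * E" using False MX E0 by (intro mult_right_mono mult_left_mono) auto
      finally show ?thesis .
    qed
    moreover have "norm (\<Sum>m\<in>{1..M}. of_real (\<Sum>k | k dvd m \<and> k \<le> V. mangoldt k) * F \<chi> (d*m)) \<le> V * ln X * E"
    proof -
      define H where "H k e = (if k \<le> V then of_real (mangoldt k) * F \<chi> (d*(k*e)) else 0)" for k e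
      have "(\<Sum>m\<in>{1..M}. of_real (\<Sum>k | k dvd m \<and> k \<le> V. mangoldt k) * F \<chi> (d*m)) = (\<Sum>m\<in>{1..M}. \<Sum>k | k dvd m. H k (m div k))"
      proof (rule sum.cong[OF refl])
        fix m assume m: "m \<in> {1..M}"
        have fin: "finite {k. k dvd m}" using m by (intro finite_divisors_nat) auto
        have "(\<Sum>k | k dvd m. H k (m div k)) = (\<Sum>k | k dvd m \<and> k \<le> V. of_real (mangoldt k) * F \<chi> (d*m))"
          by (rule sum.mono_neutral_cong_right[OF fin]) (auto simp: H_def)
        thus "of_real (\<Sum>k | k dvd m \<and> k \<le> V. mangoldt k) * F \<chi> (d*m) = (\<Sum>k | k dvd m. H k (m div k))"
          by (simp add: sum_distrib_right)
      qed
      also have "\<dots> = (\<Sum>k\<in>{1..M}. \<Sum>e\<in>{1..M div k}. H k e)" by (rule sum_divisor_convolution)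
      also have "norm \<dots> \<le> (\<Sum>k\<in>{1..M}. if k \<le> V then ln X * E else 0)"
      proof (rule sum_norm_le)
        fix k assume k: "k \<in> {1..M}"
        show "norm (\<Sum>e\<in>{1..M div k}. H k e) \<le> (if k \<le> V then ln X * E else 0)"
        proof (cases "k \<le> V")
          case True
          have "(\<Sum>e\<in>{1..M div k}. H k e) = of_real (mangoldt k) * (\<Sum>e\<in>{1..M div k}. F \<chi> (d*k*e))"
            using True by (simp add: H_def sum_distrib_left mult.assoc)
          moreover have "norm (\<Sum>e\<in>{1..M div k}. F \<chi> (d*k*e)) \<le> E"
          proof (rule mult)
            have "k*(M div k) \<le> M" by simp
            hence "d*(k*(M div k)) \<le> d*M" by (intro mult_left_mono) auto
            hence "d*(k*(M div k)) \<le> X" using dM by (rule order.trans)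
            thus "d*k*(M div k) \<le> X" by (simp only: mult.assoc)
          qed (use d k in simp)
          moreover have "mangoldt k \<le> ln X"
          proof -
            have "mangoldt k \<le> ln k" using k by (intro mangoldt_le) auto
            also have "\<dots> \<le> ln X" using k MX by (intro ln_mono) auto
            finally show ?thesis .
          qed
          ultimately show ?thesis using True mangoldt_nonneg[of k]
            by (simp add: norm_mult mult_mono)
        qed (simp add: H_def)
      qed
      also have "\<dots> = (\<Sum>k\<in>{k\<in>{1..M}. k \<le> V}. ln X * E)" by (rule sum.inter_filter[symmetric]) simp
      also have "\<dots> = card {k\<in>{1..M}. k \<le> V} * (ln X * E)" by simp
      also have "\<dots> \<le> V * (ln X * E)"
      proof -
        have "card {k\<in>{1..M}. k \<le> V} \<le> card {1..V}" by (rule card_mono) auto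
        thus ?thesis using E0 X by (intro mult_right_mono mult_nonneg_nonneg) auto
      qed
      finally show ?thesis by (simp add: mult.assoc)
    qed
    ultimately have "norm (\<Sum>m\<in>{1..M}. of_real (tail_log V m) * F \<chi> (d*m)) \<le> 2 * ln X * E + V * ln X * E"
      using norm_triangle_ineq4[of "\<Sum>m\<in>{1..M}. of_real (ln m) * F \<chi> (d*m)" "\<Sum>m\<in>{1..M}. of_real (\<Sum>k | k dvd m \<and> k \<le> V. mangoldt k) * F \<chi> (d*m)"]
      by simp
    also have "2 * ln X * E \<le> V * (2 * ln X * E)"
    proof -
      have "1 * (2 * ln X * E) \<le> V * (2 * ln X * E)" using V E0 X by (intro mult_right_mono) auto
      thus ?thesis by simp
    qed
    finally show ?thesis by (simp add: M_def algebra_simps)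
  qed
  have "norm (\<Sum>d\<in>{1..V}. of_real (mob d) * (\<Sum>m\<in>{1..X div d}. of_real (tail_log V m) * F \<chi> (d*m))) \<le> (\<Sum>d\<in>{1..V}. 3*V*ln X*E)"
  proof (rule sum_norm_le)
    fix d assume "d \<in> {1..V}"
    hence i: "norm (\<Sum>m\<in>{1..X div d}. of_real (tail_log V m) * F \<chi> (d*m)) \<le> 3*V*ln X*E" by (intro inner) auto
    have "norm (of_real (mob d) * (\<Sum>m\<in>{1..X div d}. of_real (tail_log V m) * F \<chi> (d*m))) \<le> 1 * norm (\<Sum>m\<in>{1..X div d}. of_real (tail_log V m) * F \<chi> (d*m))"
      unfolding norm_mult using abs_mob_le_1[of d] by (intro mult_right_mono) auto
    thus "norm (of_real (mob d) * (\<Sum>m\<in>{1..X div d}. of_real (tail_log V m) * F \<chi> (d*m))) \<le> 3*V*ln X*E" using i by simp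
  qed
  thus ?thesis by (simp add: power2_eq_square mult.assoc)
qed

text \<open>The range of d depends on n through X div (N0+n) and is replaced by the common Y. The
  difference is small because N/N0 \<le> 1/p^k, as N0 exceeds p^(400*k). If Y \<le> V nothing
  remains, otherwise \<open>bilinear_sum_le\<close> applies. The factor 1/(q+1) comes from (q+1)*N
  \<le> N0+N.\<close>

lemma norm_type_II_block_le:
  fixes k X V N N0 q :: nat and a :: "nat \<Rightarrow> complex" and b :: "nat \<Rightarrow> real"
  defines "V \<equiv> p^(400*k)" and "N \<equiv> p^(105*k)"
  assumes \<chi>: "norm \<chi> = 1" and X: "X \<ge> 2" and a1: "\<And>d. norm (a d) \<le> 1" and aV: "\<And>d. d \<le> V \<Longrightarrow> a d = 0"
    and b: "\<And>m. 1 \<le> m \<Longrightarrow> m \<le> X \<Longrightarrow> \<bar>b m\<bar> \<le> ln X" and N0: "V < N0" "(q+1)*N \<le> N0 + N"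
  shows "norm (\<Sum>n<N. \<Sum>d\<in>{1..X div (N0+n)}. a d * of_real (b (N0+n)) * F \<chi> (d*(N0+n)))
     \<le> ln X * (17*root_rate^k * X * (1/real (q+1)) + N)"
proof -
  define Y where "Y = X div (N0+N)"
  define G where "G d m = a d * of_real (b m) * F \<chi> (d*m)" for d m
  define R where "R = root_rate^k"
  have R0: "R > 0" using root_rate_bounds by (simp add: R_def)
  have lX: "ln X > 0" using X by simp
  have N1: "N \<ge> 1" by (simp add: N_def)
  have NN: "real (q+1) * N \<le> N0 + N" using N0(2) by (metis of_nat_le_iff of_nat_mult)
  have Yle: "real Y \<le> X / (N0+N)" unfolding Y_def by (rule of_nat_div_le_of_nat)
  have frac: "X / (N0+N) * N \<le> X * (1/real (q+1))"
  proof -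
    have "N / (N0+N) \<le> 1/real (q+1)" using NN N1 by (simp add: field_simps del: of_nat_Suc)
    hence "X * (N / (N0+N)) \<le> X * (1/real (q+1))" by (intro mult_left_mono) auto
    thus ?thesis by simp
  qed
  have NV: "N / N0 \<le> R"
  proof -
    have "N * p^k \<le> V" unfolding N_def V_def power_add[symmetric] by (intro power_increasing) auto
    hence "N * p^k \<le> N0" using N0 by linarith
    hence "real N * p^k \<le> N0" by (metis of_nat_le_iff of_nat_mult)
    hence "N / N0 \<le> 1/p^k" using N0 by (simp add: field_simps)
    also have "\<dots> \<le> R" unfolding R_def using inverse_p_power_le[OF root_rate_bounds(1), of k] by simp
    finally show ?thesis .
  qed
  have "(\<Sum>n<N. \<Sum>d\<in>{1..X div (N0+n)}. G d (N0+n)) = (\<Sum>n<N. \<Sum>d\<in>{1..Y}. G d (N0+n)) + (\<Sum>n<N. \<Sum>d\<in>{Y<..X div (N0+n)}. G d (N0+n))"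
    unfolding sum.distrib[symmetric]
  proof (rule sum.cong[OF refl])
    fix n assume n: "n \<in> {..<N}"
    have "Y \<le> X div (N0+n)" unfolding Y_def using n N0 by (intro div_le_mono2) auto
    hence "{1..X div (N0+n)} = {1..Y} \<union> {Y<..X div (N0+n)}" by auto
    thus "(\<Sum>d\<in>{1..X div (N0+n)}. G d (N0+n)) = (\<Sum>d\<in>{1..Y}. G d (N0+n)) + (\<Sum>d\<in>{Y<..X div (N0+n)}. G d (N0+n))"
      by (simp only:) (rule sum.union_disjoint, auto)
  qed
  hence "norm (\<Sum>n<N. \<Sum>d\<in>{1..X div (N0+n)}. G d (N0+n)) \<le> norm (\<Sum>n<N. \<Sum>d\<in>{1..Y}. G d (N0+n)) + norm (\<Sum>n<N. \<Sum>d\<in>{Y<..X div (N0+n)}. G d (N0+n))"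
    by (simp add: norm_triangle_ineq)
  moreover have "norm (\<Sum>n<N. \<Sum>d\<in>{Y<..X div (N0+n)}. G d (N0+n)) \<le> ln X * (X * (1/real (q+1)) * R + N)"
  proof -
    have "norm (\<Sum>n<N. \<Sum>d\<in>{Y<..X div (N0+n)}. G d (N0+n)) \<le> (\<Sum>n<N. (X / (N0+N) * R + 1) * ln X)"
    proof (rule sum_norm_le)
      fix n assume n: "n \<in> {..<N}"
      have "norm (\<Sum>d\<in>{Y<..X div (N0+n)}. G d (N0+n)) \<le> (\<Sum>d\<in>{Y<..X div (N0+n)}. ln X)"
      proof (rule sum_norm_le)
        fix d assume d: "d \<in> {Y<..X div (N0+n)}"
        hence "X div (N0+n) > 0" by auto
        hence "N0+n \<le> X" using div_less[of X "N0+n"] by (metis less_irrefl not_less)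
        hence "\<bar>b (N0+n)\<bar> \<le> ln X" using N0 by (intro b) auto
        hence "norm (a d) * \<bar>b (N0+n)\<bar> \<le> 1 * ln X" using a1 by (intro mult_mono) auto
        thus "norm (G d (N0+n)) \<le> ln X" by (simp add: G_def norm_mult \<chi>)
      qed
      also have "\<dots> = real (X div (N0+n) - Y) * ln X" by simp
      also have "\<dots> \<le> (X / (N0+N) * R + 1) * ln X"
      proof (rule mult_right_mono)
        have "real (X div (N0+n)) \<le> X / (N0+n)" by (rule of_nat_div_le_of_nat)
        also have "\<dots> \<le> X / N0" using N0 by (intro divide_left_mono) auto
        finally have 1: "real (X div (N0+n)) \<le> X / N0" .
        have 2: "real Y \<ge> X / (N0+N) - 1"
        proof -
          have "X < (Y+1) * (N0+N)" unfolding Y_def using N0 by (metis Suc_eq_plus1 add_gr_0 dividend_less_div_times gr_implies_not0 less_nat_zero_code mult_Suc neq0_conv add.commute)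
          hence "real X < real ((Y+1) * (N0+N))" by (simp only: of_nat_less_iff)
          hence "real X < (real Y+1) * (real (N0+N))" by (simp only: of_nat_mult of_nat_add of_nat_1)
          hence "real X / real (N0+N) < real Y + 1" using N0 by (simp add: divide_less_eq)
          thus ?thesis by simp
        qed
        have "real (X div (N0+n) - Y) \<le> X / N0 - X / (N0+N) + 1"
        proof (cases "Y \<le> X div (N0+n)")
          case True thus ?thesis using 1 2 by (simp add: of_nat_diff)
        next
          case False
          have "X / (N0+N) \<le> X / N0" using N0 by (intro divide_left_mono) auto
          thus ?thesis using False by simp
        qed
        also have "X / N0 - X / (N0+N) = X / (N0+N) * (N / N0)" using N0 by (simp add: field_simps)
        also have "\<dots> \<le> X / (N0+N) * R" using NV by (intro mult_left_mono) auto
        finally show "real (X div (N0+n) - Y) \<le> X / (N0+N) * R + 1" by simp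
      qed (use lX in simp)
      finally show "norm (\<Sum>d\<in>{Y<..X div (N0+n)}. G d (N0+n)) \<le> (X / (N0+N) * R + 1) * ln X" .
    qed
    also have "\<dots> = ln X * ((X / (N0+N) * N) * R + N)" by (simp add: algebra_simps)
    also have "\<dots> \<le> ln X * (X * (1/real (q+1)) * R + N)"
      using frac lX R0 by (intro mult_left_mono add_right_mono mult_right_mono) auto
    finally show ?thesis .
  qed
  moreover have "norm (\<Sum>n<N. \<Sum>d\<in>{1..Y}. G d (N0+n)) \<le> ln X * (16 * R * X * (1/real (q+1)))"
  proof (cases "Y \<le> V")
    case True
    hence "(\<Sum>n<N. \<Sum>d\<in>{1..Y}. G d (N0+n)) = 0" using aV by (intro sum.neutral ballI) (auto simp: G_def)
    thus ?thesis using lX R0 by simp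
  next
    case False
    hence Y1: "Y \<ge> 1" by simp
    have NX: "N0+N \<le> X" using Y1 unfolding Y_def by (metis div_less not_less not_one_le_zero)
    \<comment> \<open>Normalised by ln X and cut off outside the block, since the bilinear estimate
      asks for coefficients bounded by 1 everywhere.\<close>
    define b' where "b' n = (if n < N then complex_of_real (b (N0+n) / ln X) else 0)" for n
    have b'1: "norm (b' n) \<le> 1" for n
    proof (cases "n < N")
      case True
      hence "\<bar>b (N0+n)\<bar> \<le> ln X" using N0 NX by (intro b) auto
      thus ?thesis using True lX by (simp add: b'_def norm_divide)
    qed (simp add: b'_def)
    have "(\<Sum>n<N. \<Sum>d\<in>{1..Y}. G d (N0+n)) = (\<Sum>d\<in>{1..Y}. \<Sum>n<N. G d (N0+n))" by (rule sum.swap)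
    also have "\<dots> = (\<Sum>d\<in>{1..Y}. (of_real (ln X) * a d) * (\<Sum>n<N. b' n * F \<chi> (d*(N0+n))))"
      unfolding sum_distrib_left
    proof (intro sum.cong refl)
      fix d n assume "n \<in> {..<N}"
      hence "complex_of_real (b (N0+n)) = of_real (ln X) * b' n" using lX by (simp add: b'_def)
      thus "G d (N0+n) = (of_real (ln X) * a d) * (b' n * F \<chi> (d*(N0+n)))" by (simp add: G_def mult_ac)
    qed
    also have "norm \<dots> \<le> (\<Sum>d\<in>{1..Y}. ln X * norm (\<Sum>n<N. b' n * F \<chi> (d*(N0+n))))"
    proof (rule sum_norm_le)
      fix d
      have "ln X * norm (a d) \<le> ln X * 1" using lX a1 by (intro mult_left_mono) auto
      hence "ln X * norm (a d) * norm (\<Sum>n<N. b' n * F \<chi> (d*(N0+n))) \<le> ln X * norm (\<Sum>n<N. b' n * F \<chi> (d*(N0+n)))"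
        by (intro mult_right_mono) auto
      thus "norm ((of_real (ln X) * a d) * (\<Sum>n<N. b' n * F \<chi> (d*(N0+n)))) \<le> ln X * norm (\<Sum>n<N. b' n * F \<chi> (d*(N0+n)))"
        using lX by (simp add: norm_mult)
    qed
    also have "\<dots> = ln X * (\<Sum>d\<in>{1..Y}. norm (\<Sum>n<N. b' n * F \<chi> (d*(N0+n))))" by (simp add: sum_distrib_left)
    also have "\<dots> \<le> ln X * (\<Sum>d<Suc Y. norm (\<Sum>n<N. b' n * F \<chi> (d*(N0+n))))"
      using lX by (intro mult_left_mono sum_mono2) auto
    also have "\<dots> \<le> ln X * (8*Suc Y*N*R)"
    proof -
      have "p^(400*k) \<le> Suc Y" using False by (simp add: V_def)
      from bilinear_sum_le[of k "Suc Y" b' \<chi> N0, OF this b'1 \<chi>] show ?thesis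
        using lX unfolding N_def R_def by (intro mult_left_mono) auto
    qed
    also have "\<dots> \<le> ln X * (16*real Y*N*R)"
    proof -
      have "real (8*Suc Y) \<le> 16*real Y" using Y1 by simp
      hence "real (8*Suc Y)*(N*R) \<le> 16*real Y*(N*R)" using R0 by (intro mult_right_mono) auto
      thus ?thesis using lX by (intro mult_left_mono) (auto simp: mult.assoc)
    qed
    also have "16*real Y*N*R \<le> 16*(X / (N0+N))*N*R"
      using Yle R0 by (intro mult_right_mono mult_left_mono) auto
    also have "\<dots> = 16*R*(X / (N0+N)*N)" by simp
    also have "\<dots> \<le> 16*R*(X * (1/real (q+1)))" using frac R0 by (intro mult_left_mono) auto
    finally show ?thesis using lX by (simp add: mult.assoc mult_left_mono)
  qed
  ultimately have "norm (\<Sum>n<N. \<Sum>d\<in>{1..X div (N0+n)}. G d (N0+n)) \<le> ln X * (16 * R * X * (1/real (q+1))) + ln X * (X * (1/real (q+1)) * R + N)"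
    by linarith
  also have "\<dots> = ln X * (17 * R * X * (1/real (q+1)) + N)" by (simp add: algebra_simps)
  finally show ?thesis by (simp only: G_def R_def)
qed

text \<open>The supports of a and b force V < m \<le> X div V. Cutting this range into blocks of
  length N and adding the block bounds yields a harmonic sum over q, hence the second
  logarithm.\<close>

lemma norm_type_II_le:
  fixes k X :: nat and a :: "nat \<Rightarrow> complex" and b :: "nat \<Rightarrow> real"
  defines "V \<equiv> p^(400*k)" and "N \<equiv> p^(105*k)"
  assumes k: "k \<ge> 1" and \<chi>: "norm \<chi> = 1" and X: "V \<le> X" and a1: "\<And>d. norm (a d) \<le> 1" and aV: "\<And>d. d \<le> V \<Longrightarrow> a d = 0"
    and b: "\<And>m. 1 \<le> m \<Longrightarrow> m \<le> X \<Longrightarrow> \<bar>b m\<bar> \<le> ln X" and bV: "\<And>m. 1 \<le> m \<Longrightarrow> m \<le> V \<Longrightarrow> b m = 0"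
  shows "norm (\<Sum>d\<in>{1..X}. \<Sum>m\<in>{1..X div d}. a d * of_real (b m) * F \<chi> (d*m)) \<le> 19*ln X*(1+ln X)*X*root_rate^k"
proof -
  define G where "G d m = a d * of_real (b m) * F \<chi> (d*m)" for d m
  define U where "U m = (\<Sum>d\<in>{1..X div m}. G d m)" for m
  define Qn where "Qn = X div V div N + 1"
  define R where "R = root_rate^k"
  have R0: "R > 0" using root_rate_bounds by (simp add: R_def)
  have V2: "V \<ge> 2" using p_power_ge_2[of "400*k"] k by (simp add: V_def)
  have X2: "X \<ge> 2" using V2 X by simp
  have lX: "ln X > 0" using X2 by simp
  have N1: "N \<ge> 1" by (simp add: N_def)
  have "(\<Sum>d\<in>{1..X}. \<Sum>m\<in>{1..X div d}. G d m) = (\<Sum>m\<in>{1..X}. U m)"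
    unfolding U_def by (rule sum_hyperbola_swap)
  also have "\<dots> = (\<Sum>m\<in>{V<..X div V}. U m)"
  proof (rule sum.mono_neutral_right)
    show "{V<..X div V} \<subseteq> {1..X}"
    proof
      fix m assume "m \<in> {V<..X div V}"
      thus "m \<in> {1..X}" using div_le_dividend[of X V] unfolding greaterThanAtMost_iff atLeastAtMost_iff by linarith
    qed
    show "\<forall>m\<in>{1..X}-{V<..X div V}. U m = 0"
    proof
      fix m assume m: "m \<in> {1..X}-{V<..X div V}"
      show "U m = 0"
      proof (cases "m \<le> V")
        case True thus ?thesis using m bV by (simp add: U_def G_def)
      next
        case False
        hence "X div V < m" using m by auto
        hence "X < m*V" using V2 by (simp add: div_less_iff_less_mult)
        hence "X div m \<le> V" using m by (simp add: less_mult_imp_div_less mult.commute less_imp_le)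
        thus ?thesis using aV unfolding U_def G_def by (intro sum.neutral ballI) auto
      qed
    qed
  qed simp
  \<comment> \<open>The range is extended to whole blocks. For m beyond X div V only d \<le> V
    occur, where a vanishes.\<close>
  also have "\<dots> = (\<Sum>m\<in>{V+1..<V+1+Qn*N}. U m)"
  proof (rule sum.mono_neutral_left)
    have "X div V < Qn*N" unfolding Qn_def using N1 
      by (metis Suc_eq_plus1 dividend_less_div_times add.commute mult_Suc less_le_trans zero_less_one)
    thus "{V<..X div V} \<subseteq> {V+1..<V+1+Qn*N}" by auto
    show "\<forall>m\<in>{V+1..<V+1+Qn*N}-{V<..X div V}. U m = 0"
    proof
      fix m assume m: "m \<in> {V+1..<V+1+Qn*N}-{V<..X div V}"
      hence "X div V < m" by auto
      hence "X < m*V" using V2 by (simp add: div_less_iff_less_mult)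
      hence "X div m \<le> V" using m by (simp add: less_mult_imp_div_less mult.commute less_imp_le)
      thus "U m = 0" using aV unfolding U_def G_def by (intro sum.neutral ballI) auto
    qed
  qed simp
  also have "\<dots> = (\<Sum>t<Qn*N. U (V+1+t))"
    using sum.shift_bounds_nat_ivl[of U 0 "V+1" "Qn*N"] by (simp add: lessThan_atLeast0 add.commute)
  also have "\<dots> = (\<Sum>q<Qn. \<Sum>n<N. U (V+1+(q*N+n)))" by (rule sum_lessThan_mult)
  also have "norm \<dots> \<le> (\<Sum>q<Qn. ln X * (17*R*X*(1/real (q+1)) + N))"
  proof (rule sum_norm_le)
    fix q
    have "N \<le> V" unfolding N_def V_def by (intro power_increasing) auto
    hence "norm (\<Sum>n<N. \<Sum>d\<in>{1..X div (V+1+q*N+n)}. a d * of_real (b (V+1+q*N+n)) * F \<chi> (d*(V+1+q*N+n)))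
        \<le> ln X * (17*root_rate^k*X*(1/real (q+1)) + N)"
      unfolding N_def
      by (intro norm_type_II_block_le) (use \<chi> X2 a1 aV b in \<open>auto simp: V_def N_def\<close>)
    thus "norm (\<Sum>n<N. U (V+1+(q*N+n))) \<le> ln X * (17*R*X*(1/real (q+1)) + N)"
      by (simp only: U_def G_def R_def add.assoc)
  qed
  also have "\<dots> = ln X * (17*R*X*(\<Sum>q<Qn. 1/real (q+1)) + Qn*N)"
    by (simp only: sum_distrib_left[symmetric] sum.distrib) simp
  also have "\<dots> \<le> ln X * (17*R*X*(1+ln X) + 2*R*X*(1+ln X))"
  proof (intro mult_left_mono add_mono)
    have "X div V \<le> X div 2" using V2 by (intro div_le_mono2) auto
    hence "X div V div N \<le> X div 2" using div_le_dividend[of "X div V" N] by linarith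
    hence QX: "Qn \<le> X" unfolding Qn_def using X2 by linarith
    have "(\<Sum>q<Qn. 1/real (q+1)) \<le> 1 + ln Qn" by (rule sum_inverse_le_ln) (simp add: Qn_def)
    also have "ln Qn \<le> ln X" using QX by (intro ln_mono) (auto simp: Qn_def)
    finally show "(\<Sum>q<Qn. 1/real (q+1)) \<le> 1 + ln X" by simp
    have "Qn*N \<le> X div V + N" unfolding Qn_def by (simp add: add_mult_distrib)
    hence "real (Qn*N) \<le> real (X div V) + real N" by (metis of_nat_le_iff of_nat_add)
    moreover have ip: "1/p^k \<le> R" unfolding R_def using inverse_p_power_le[OF root_rate_bounds(1), of k] by simp
    moreover have "real (X div V) \<le> X*R"
    proof -
      have "real (X div V) \<le> X/V" by (rule of_nat_div_le_of_nat)
      also have "\<dots> \<le> X/p^k"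
      proof -
        have "p^k \<le> V" unfolding V_def by (intro power_increasing) auto
        hence "real (p^k) \<le> V" by (simp only: of_nat_le_iff)
        thus ?thesis using p_pos V2 by (intro divide_left_mono mult_pos_pos) auto
      qed
      also have "\<dots> = X*(1/p^k)" by simp
      also have "\<dots> \<le> X*R" using ip by (intro mult_left_mono) auto
      finally show ?thesis .
    qed
    moreover have "real N \<le> X*R"
    proof -
      have "N*p^k \<le> V" unfolding N_def V_def power_add[symmetric] by (intro power_increasing) auto
      hence "N*p^k \<le> X" using X by linarith
      hence "real (N*p^k) \<le> X" by (simp only: of_nat_le_iff)
      hence "N \<le> X*(1/p^k)" by (simp add: field_simps)
      also have "\<dots> \<le> X*R" using ip by (intro mult_left_mono) auto
      finally show ?thesis .
    qed
    ultimately have "real (Qn*N) \<le> X*R + X*R" by linarith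
    hence "real (Qn*N) \<le> 2*R*X*1" by (simp add: mult_ac)
    also have "\<dots> \<le> 2*R*X*(1+ln X)" using R0 lX by (intro mult_left_mono) auto
    finally show "real (Qn*N) \<le> 2*R*X*(1+ln X)" .
  qed (use R0 lX in auto)
  also have "\<dots> = 19*ln X*(1+ln X)*X*R" by (simp add: algebra_simps)
  finally show ?thesis by (simp add: G_def R_def)
qed

end

text \<open>A proper prime power q^a is determined by s = q^(a div 2) and the parity of a, being s^2
  or s^2*q with q recovered as the prime divisor of s; moreover s^2 does not exceed it.\<close>

lemma card_nonprime_primepow_le:
  fixes Y :: nat
  shows
  "real (card {n\<in>{1..Y}. primepow n \<and> \<not> prime n}) \<le> 2 * (sqrt Y + 1)"
proof -
  define S where "S = {s::nat. s \<le> nat \<lfloor>sqrt Y\<rfloor>}"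
  have finS: "finite S" by (simp add: S_def)
  have inS: "s \<in> S" if "s^2 \<le> Y" for s
  proof -
    have "real (s^2) \<le> real Y" using that by (simp only: of_nat_le_iff)
    hence "real s \<le> sqrt Y" by (intro real_le_rsqrt) simp
    thus ?thesis by (simp add: S_def le_nat_floor)
  qed
  have "{n\<in>{1..Y}. primepow n \<and> \<not> prime n} \<subseteq> (\<lambda>s. s^2) ` S \<union> (\<lambda>s. s^2 * aprimedivisor s) ` S"
  proof
    fix n assume n: "n \<in> {n\<in>{1..Y}. primepow n \<and> \<not> prime n}"
    then obtain q a where q: "prime q" "a > 0" "n = q^a" by (auto simp: primepow_def)
    have "a \<noteq> 1" using n q by auto
    hence a2: "a div 2 > 0" using q by auto
    define s where "s = q^(a div 2)"
    have ap: "aprimedivisor s = q" unfolding s_def using q a2 by (intro aprimedivisor_prime_power)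
    have q0: "q \<ge> 1" using prime_ge_1_nat[OF q(1)] .
    show "n \<in> (\<lambda>s. s^2) ` S \<union> (\<lambda>s. s^2 * aprimedivisor s) ` S"
    proof (cases "even a")
      case True
      hence "n = s^2" using q by (simp add: s_def flip: power_mult)
      thus ?thesis using n inS[of s] by auto
    next
      case False
      hence "a = a div 2 * 2 + 1" by presburger
      hence "n = q^(a div 2 * 2 + 1)" using q by metis
      hence e: "n = s^2 * q" by (simp add: s_def power_mult)
      have "s^2*1 \<le> s^2*q" using q0 by (intro mult_left_mono) auto
      hence "s^2 \<le> n" by (simp add: e)
      hence "s \<in> S" using n by (intro inS) auto
      thus ?thesis using e ap by auto
    qed
  qed
  hence "card {n\<in>{1..Y}. primepow n \<and> \<not> prime n} \<le> card ((\<lambda>s. s^2) ` S \<union> (\<lambda>s. s^2 * aprimedivisor s) ` S)"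
    using finS by (intro card_mono) auto
  also have "\<dots> \<le> card ((\<lambda>s. s^2) ` S) + card ((\<lambda>s. s^2 * aprimedivisor s) ` S)" by (rule card_Un_le)
  also have "\<dots> \<le> card S + card S" by (intro add_mono card_image_le finS)
  finally have "real (card {n\<in>{1..Y}. primepow n \<and> \<not> prime n}) \<le> 2 * real (card S)" by simp
  also have "real (card S) \<le> sqrt Y + 1"
  proof -
    have "card S = nat \<lfloor>sqrt Y\<rfloor> + 1" by (simp add: S_def)
    moreover have "real (nat \<lfloor>sqrt Y\<rfloor>) \<le> sqrt Y" by simp
    ultimately show ?thesis by simp
  qed
  finally show ?thesis by simp
qed

context digital_phase begin

section \<open>From the von Mangoldt function to primes\<close>

definition psi_sum :: "complex \<Rightarrow> nat \<Rightarrow> complex" where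
  "psi_sum \<chi> X = (\<Sum>n\<in>{1..X}. of_real (mangoldt n) * F \<chi> n)"

lemma norm_psi_sum_trivial:
  fixes X Y :: nat
  assumes \<chi>: "norm \<chi> = 1" and Y: "Y \<le> X" and X: "X \<ge> 1"
  shows "norm (psi_sum \<chi> Y) \<le> Y * ln X"
proof -
  have "norm (psi_sum \<chi> Y) \<le> (\<Sum>n\<in>{1..Y}. ln X)"
    unfolding psi_sum_def
  proof (rule sum_norm_le)
    fix n assume n: "n \<in> {1..Y}"
    have "mangoldt n \<le> ln n" using n by (intro mangoldt_le) auto
    also have "\<dots> \<le> ln X" using n Y by (intro ln_mono) auto
    finally show "norm (of_real (mangoldt n) * F \<chi> n) \<le> ln X"
      using mangoldt_nonneg[of n] by (simp add: norm_mult \<chi>)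
  qed
  thus ?thesis by simp
qed

text \<open>In the last sum both variables effectively exceed V: d by the restriction, m because
  \<open>tail_log\<close> vanishes up to V.\<close>

lemma psi_sum_decompose:
  assumes V: "V \<le> X"
  shows "psi_sum \<chi> X = psi_sum \<chi> V 
     + (\<Sum>d\<in>{1..V}. of_real (mob d) * (\<Sum>m\<in>{1..X div d}. of_real (tail_log V m) * F \<chi> (d*m)))
     + (\<Sum>d\<in>{1..X}. \<Sum>m\<in>{1..X div d}. (if V < d then of_real (mob d) else 0) * of_real (tail_log V m) * F \<chi> (d*m))"
proof -
  define H where "H d m = of_real (mob d) * of_real (tail_log V m) * F \<chi> (d*m)" for d m
  have "psi_sum \<chi> X = (\<Sum>n\<in>{1..X}. (if n \<le> V then of_real (mangoldt n) * F \<chi> n else 0) + of_real (if V < n then mangoldt n else 0) * F \<chi> n)"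
    unfolding psi_sum_def by (rule sum.cong) auto
  also have "\<dots> = (\<Sum>n\<in>{1..X}. if n \<le> V then of_real (mangoldt n) * F \<chi> n else 0) + (\<Sum>n\<in>{1..X}. of_real (if V < n then mangoldt n else 0) * F \<chi> n)"
    by (rule sum.distrib)
  also have "(\<Sum>n\<in>{1..X}. if n \<le> V then of_real (mangoldt n) * F \<chi> n else 0) = psi_sum \<chi> V"
    unfolding psi_sum_def using V by (intro sum.mono_neutral_cong_right) auto
  also have "(\<Sum>n\<in>{1..X}. of_real (if V < n then mangoldt n else 0) * F \<chi> n) = (\<Sum>n\<in>{1..X}. \<Sum>d | d dvd n. H d (n div d))"
  proof (rule sum.cong[OF refl])
    fix n assume n: "n \<in> {1..X}"
    have "complex_of_real (if V < n then mangoldt n else 0) * F \<chi> n = of_real (\<Sum>d | d dvd n. mob d * tail_log V (n div d)) * F \<chi> n"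
      using sum_mob_tail_log[of n V] n by simp
    also have "\<dots> = (\<Sum>d | d dvd n. H d (n div d))"
      unfolding of_real_sum sum_distrib_right by (rule sum.cong) (auto simp: H_def)
    finally show "complex_of_real (if V < n then mangoldt n else 0) * F \<chi> n = (\<Sum>d | d dvd n. H d (n div d))" .
  qed
  also have "\<dots> = (\<Sum>d\<in>{1..X}. \<Sum>m\<in>{1..X div d}. H d m)" by (rule sum_divisor_convolution)
  also have "\<dots> = (\<Sum>d\<in>{1..X}. (if d \<le> V then \<Sum>m\<in>{1..X div d}. H d m else 0) + (\<Sum>m\<in>{1..X div d}. if V < d then H d m else 0))"
    by (rule sum.cong) auto
  also have "\<dots> = (\<Sum>d\<in>{1..X}. if d \<le> V then \<Sum>m\<in>{1..X div d}. H d m else 0) + (\<Sum>d\<in>{1..X}. \<Sum>m\<in>{1..X div d}. if V < d then H d m else 0)"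
    by (rule sum.distrib)
  also have "(\<Sum>d\<in>{1..X}. if d \<le> V then \<Sum>m\<in>{1..X div d}. H d m else 0) = (\<Sum>d\<in>{1..V}. \<Sum>m\<in>{1..X div d}. H d m)"
    using V by (intro sum.mono_neutral_cong_right) auto
  also have "(\<Sum>d\<in>{1..V}. \<Sum>m\<in>{1..X div d}. H d m) = (\<Sum>d\<in>{1..V}. of_real (mob d) * (\<Sum>m\<in>{1..X div d}. of_real (tail_log V m) * F \<chi> (d*m)))"
    by (simp add: H_def sum_distrib_left mult.assoc)
  also have "(\<Sum>d\<in>{1..X}. \<Sum>m\<in>{1..X div d}. if V < d then H d m else 0) = (\<Sum>d\<in>{1..X}. \<Sum>m\<in>{1..X div d}. (if V < d then of_real (mob d) else 0) * of_real (tail_log V m) * F \<chi> (d*m))"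
    by (intro sum.cong refl) (simp add: H_def)
  finally show ?thesis by (simp add: add.assoc)
qed

text \<open>The exponent \<open>A\<close> below makes the saving in the linear sums beat the square of the level \<open>V = p^(400*k)\<close>.\<close>

lemma psi_sum_le:
  obtains D where "D \<ge> 400" and
    "\<And>k X \<chi>. k \<ge> 1 \<Longrightarrow> norm \<chi> = 1 \<Longrightarrow> p^(D*k) \<le> X \<Longrightarrow> norm (psi_sum \<chi> X) \<le> 32*(1+ln X)^2*X*root_rate^k"
proof -
  have "1 / real p^801 > 0" by simp
  then obtain A where A: "lin_rate^A < 1 / real p^801"
    using real_arch_pow_inv[OF _ lin_rate_bounds(2)] by blast
  \<comment> \<open>p^(D*k) is the product of V^2 = p^(800*k), the error p^(2*A*k) of each linear
    sum, and one p^k to be gained.\<close>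
  define D where "D = 801+2*A"
  have "norm (psi_sum \<chi> X) \<le> 32*(1+ln X)^2*X*root_rate^k" if k: "k \<ge> 1" and \<chi>: "norm \<chi> = 1" and X: "p^(D*k) \<le> X" for k X \<chi>
  proof -
    define V where "V = p^(400*k)"
    define R where "R = root_rate^k"
    define l where "l = ln (real X)"
    define E where "E = 2*X*lin_rate^(A*k) + p^(2*(A*k)) + 1"
    have R0: "R > 0" using root_rate_bounds by (simp add: R_def)
    have ip: "1/p^k \<le> R" unfolding R_def using inverse_p_power_le[OF root_rate_bounds(1), of k] by simp
    have p0: "real p^k > 0" by simp
    have VX: "V * p^k \<le> X"
    proof -
      have "V * p^k = p^(401*k)" by (simp add: V_def flip: power_add)
      also have "\<dots> \<le> p^(D*k)" by (intro power_increasing) (auto simp: D_def)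
      finally show ?thesis using X by simp
    qed
    have V1: "V \<ge> 1" by (simp add: V_def)
    have "V * 1 \<le> V * p^k" by (intro mult_left_mono) auto
    hence VX': "V \<le> X" using VX by linarith
    have X1: "X \<ge> 1" using V1 VX' by simp
    have l0: "l \<ge> 0" using X1 by (simp add: l_def)
    have VR: "real V \<le> X*R"
    proof -
      have "real (V*p^k) \<le> X" using VX by (simp only: of_nat_le_iff)
      hence "V \<le> X*(1/p^k)" by (simp add: field_simps)
      also have "\<dots> \<le> X*R" using ip by (intro mult_left_mono) auto
      finally show ?thesis .
    qed
    have T0: "norm (psi_sum \<chi> V) \<le> X*R*l"
    proof -
      have "norm (psi_sum \<chi> V) \<le> V * l" unfolding l_def by (rule norm_psi_sum_trivial[OF \<chi> VX' X1])
      also have "\<dots> \<le> X*R*l" using VR l0 by (intro mult_right_mono)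
      finally show ?thesis .
    qed
    have T1: "norm (\<Sum>d\<in>{1..V}. of_real (mob d) * (\<Sum>m\<in>{1..X div d}. of_real (tail_log V m) * F \<chi> (d*m))) \<le> 12*X*R*l"
    proof -
      have lr: "lin_rate^(A*k) \<le> 1/p^(801*k)"
      proof -
        have "(lin_rate^A)^k \<le> (1/real p^801)^k" using A lin_rate_bounds by (intro power_mono) auto
        thus ?thesis by (simp add: power_mult power_divide)
      qed
      have V2: "(real V)^2 = p^(800*k)" by (simp add: V_def flip: power_mult)
      have a: "(real V)^2 * (2*X*lin_rate^(A*k)) \<le> 2*X*(1/p^k)"
      proof -
        have "(real V)^2 * (2*X*lin_rate^(A*k)) \<le> p^(800*k) * (2*X*(1/p^(801*k)))"
          unfolding V2 using lr by (intro mult_left_mono) auto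
        also have "\<dots> = 2*X*(p^(800*k)/p^(801*k))" by simp
        also have "real (p^(800*k))/p^(801*k) = 1/p^k"
        proof -
          have "p^(801*k) = p^(800*k)*p^k" by (simp flip: power_add)
          thus ?thesis by simp
        qed
        finally show ?thesis .
      qed
      have b: "(real V)^2 * (p^(2*(A*k)) + 1) \<le> 2*X*(1/p^k)"
      proof -
        have "p^(800*k) * p^(2*(A*k)) * p^k \<le> X"
        proof -
          have "p^(800*k) * p^(2*(A*k)) * p^k = p^(D*k)" by (simp add: D_def algebra_simps flip: power_add)
          thus ?thesis using X by simp
        qed
        hence "real (p^(800*k) * p^(2*(A*k)) * p^k) \<le> X" by (simp only: of_nat_le_iff)
        hence "real (p^(800*k)) * p^(2*(A*k)) \<le> X*(1/p^k)" by (simp add: field_simps)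
        moreover have "(real V)^2 * (p^(2*(A*k)) + 1) \<le> (real V)^2 * (2*p^(2*(A*k)))" by (intro mult_left_mono) auto
        moreover have "(real V)^2 * (2*p^(2*(A*k))) = 2*(real (p^(800*k)) * p^(2*(A*k)))" unfolding V2 by simp
        ultimately have "(real V)^2 * (p^(2*(A*k)) + 1) \<le> 2*(X*(1/p^k))" by linarith
        thus ?thesis by simp
      qed
      have "norm (\<Sum>d\<in>{1..V}. of_real (mob d) * (\<Sum>m\<in>{1..X div d}. of_real (tail_log V m) * F \<chi> (d*m))) \<le> 3*V^2*l*E"
        unfolding l_def E_def by (rule norm_type_I_le[OF \<chi> V1 X1])
      also have "3*V^2*l*E = 3*l*((real V)^2 * (2*X*lin_rate^(A*k)) + (real V)^2 * (p^(2*(A*k)) + 1))"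
        by (simp add: E_def algebra_simps)
      also have "\<dots> \<le> 3*l*(2*X*(1/p^k) + 2*X*(1/p^k))" using a b l0 by (intro mult_left_mono add_mono) auto
      also have "\<dots> = 12*X*l*(1/p^k)" by simp
      also have "\<dots> \<le> 12*X*l*R" using ip l0 by (intro mult_left_mono) auto
      finally show ?thesis by (simp add: mult_ac)
    qed
    have T2: "norm (\<Sum>d\<in>{1..X}. \<Sum>m\<in>{1..X div d}. (if V < d then of_real (mob d) else 0) * of_real (tail_log V m) * F \<chi> (d*m)) \<le> 19*l*(1+l)*X*R"
      unfolding l_def R_def
    proof (rule norm_type_II_le[OF k \<chi>])
      show "p^(400*k) \<le> X" using VX' by (simp add: V_def)
      show "norm (if V < d then complex_of_real (mob d) else 0) \<le> 1" for d using abs_mob_le_1[of d] by simp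
      show "(if V < d then complex_of_real (mob d) else 0) = 0" if "d \<le> p^(400*k)" for d using that by (simp add: V_def)
      show "\<bar>tail_log V m\<bar> \<le> ln X" if "1 \<le> m" "m \<le> X" for m
      proof -
        have "ln (real m) \<le> ln X" using that by (intro ln_mono) auto
        thus ?thesis using tail_log_bounds[OF that(1), of V] by simp
      qed
      show "tail_log V m = 0" if "1 \<le> m" "m \<le> p^(400*k)" for m
        using that by (intro tail_log_eq_0) (auto simp: V_def)
    qed
    have "norm (psi_sum \<chi> X) \<le> X*R*l + 12*X*R*l + 19*l*(1+l)*X*R"
      unfolding psi_sum_decompose[OF VX', of \<chi>] using T0 T1 T2
      by (intro order.trans[OF norm_triangle_ineq] add_mono) auto
    also have "\<dots> \<le> 32*(1+l)^2*X*R"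
    proof -
      have "X*R*l + 12*X*R*l + 19*l*(1+l)*X*R = (X*R)*(13*l+19*l*(1+l))" by (simp add: algebra_simps)
      also have "\<dots> \<le> (X*R)*(32*(1+l)^2)"
        using l0 R0 by (intro mult_left_mono) (auto simp: power2_eq_square algebra_simps)
      finally show ?thesis by (simp add: mult_ac)
    qed
    finally show ?thesis by (simp add: l_def R_def)
  qed
  thus ?thesis using that[of D] by (simp add: D_def)
qed

text \<open>Removing the weight ln q by partial summation needs all Y \<le> X. For Y below p^(D*k)
  only the trivial bound is available; raising D by one makes p^(D*k) \<le> X/p^k, so this bound is
  good enough.\<close>

lemma prime_sum_le:
  obtains D :: nat and C :: real where "D \<ge> 1" "C \<ge> 1" and
    "\<And>k X \<chi>. k \<ge> 1 \<Longrightarrow> norm \<chi> = 1 \<Longrightarrow> p^(D*k) \<le> X \<Longrightarrow> norm (\<Sum>q | prime q \<and> q \<le> X. F \<chi> q) \<le> C*(1+ln X)^2*X*root_rate^k"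
proof -
  obtain D where D: "D \<ge> 400" and psi: "\<And>k X \<chi>. k \<ge> 1 \<Longrightarrow> norm \<chi> = 1 \<Longrightarrow> p^(D*k) \<le> X \<Longrightarrow> norm (psi_sum \<chi> X) \<le> 32*(1+ln X)^2*X*root_rate^k"
    using psi_sum_le by blast
  have "norm (\<Sum>q | prime q \<and> q \<le> X. F \<chi> q) \<le> (37/ln 2)*(1+ln X)^2*X*root_rate^k" if k: "k \<ge> 1" and \<chi>: "norm \<chi> = 1" and X: "p^((D+1)*k) \<le> X" for k X \<chi>
  proof -
    define R where "R = root_rate^k"
    define l where "l = ln (real X)"
    define \<theta> where "\<theta> n = (if prime n then of_real (ln (real n)) * F \<chi> n else 0)" for n
    have R0: "R > 0" using root_rate_bounds by (simp add: R_def)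
    have ip: "1/p^k \<le> R" unfolding R_def using inverse_p_power_le[OF root_rate_bounds(1), of k] by simp
    have DX: "p^(D*k) * p^k \<le> X" using X by (simp add: algebra_simps power_add)
    have "p^1 \<le> p^((D+1)*k)" using k by (intro power_increasing) auto
    hence X2: "X \<ge> 2" using X p_ge_2 by simp
    have l0: "l \<ge> 0" using X2 by (simp add: l_def)
    have DR: "real (p^(D*k)) \<le> X*R"
    proof -
      have "real (p^(D*k) * p^k) \<le> X" using DX by (simp only: of_nat_le_iff)
      hence "p^(D*k) \<le> X*(1/p^k)" by (simp add: field_simps)
      also have "\<dots> \<le> X*R" using ip by (intro mult_left_mono) auto
      finally show ?thesis .
    qed
    have sqR: "sqrt X \<le> X*R"
    proof -
      have "p^k * p^k \<le> p^(D*k) * p^k" using D by (intro mult_right_mono power_increasing) auto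
      hence "p^k * p^k \<le> X" using DX by linarith
      hence "real (p^k * p^k) \<le> X" by (simp only: of_nat_le_iff)
      hence "(real p^k)^2 \<le> X" by (simp add: power2_eq_square)
      hence "real p^k \<le> sqrt X" by (rule real_le_rsqrt)
      hence "sqrt X * real p^k \<le> sqrt X * sqrt X" by (intro mult_left_mono) auto
      hence "sqrt X \<le> X*(1/p^k)" by (simp add: field_simps)
      also have "\<dots> \<le> X*R" using ip by (intro mult_left_mono) auto
      finally show ?thesis .
    qed
    define B where "B = 37*(1+l)^2*X*R"
    have theta: "norm (\<Sum>n\<in>{1..Y}. \<theta> n) \<le> B" if Y: "Y \<le> X" for Y
    proof -
      have "(\<Sum>n\<in>{1..Y}. \<theta> n) = psi_sum \<chi> Y - (\<Sum>n\<in>{1..Y}. if primepow n \<and> \<not> prime n then of_real (mangoldt n) * F \<chi> n else 0)"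
        unfolding psi_sum_def sum_subtractf[symmetric]
      proof (rule sum.cong[OF refl])
        fix n
        show "\<theta> n = of_real (mangoldt n) * F \<chi> n - (if primepow n \<and> \<not> prime n then of_real (mangoldt n) * F \<chi> n else 0)"
        proof (cases "prime n")
          case True
          have "mangoldt n = ln (real n)" using mangoldt_prime[OF True, where ?'a = real] by simp
          thus ?thesis using True by (simp add: \<theta>_def)
        qed (auto simp: \<theta>_def mangoldt_def)
      qed
      hence "norm (\<Sum>n\<in>{1..Y}. \<theta> n) \<le> norm (psi_sum \<chi> Y) + norm (\<Sum>n\<in>{1..Y}. if primepow n \<and> \<not> prime n then of_real (mangoldt n) * F \<chi> n else 0)"
        by (simp only: norm_triangle_ineq4)
      moreover have "norm (\<Sum>n\<in>{1..Y}. if primepow n \<and> \<not> prime n then of_real (mangoldt n) * F \<chi> n else 0) \<le> 4*X*R*l"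
      proof -
        have "norm (\<Sum>n\<in>{1..Y}. if primepow n \<and> \<not> prime n then of_real (mangoldt n) * F \<chi> n else 0) \<le> (\<Sum>n\<in>{1..Y}. if primepow n \<and> \<not> prime n then l else 0)"
        proof (rule sum_norm_le)
          fix n assume n: "n \<in> {1..Y}"
          have "mangoldt n \<le> ln n" using n by (intro mangoldt_le) auto
          also have "\<dots> \<le> l" unfolding l_def using n Y by (intro ln_mono) auto
          finally show "norm (if primepow n \<and> \<not> prime n then of_real (mangoldt n) * F \<chi> n else 0) \<le> (if primepow n \<and> \<not> prime n then l else 0)"
            using mangoldt_nonneg[of n] by (simp add: norm_mult \<chi>)
        qed
        also have "\<dots> = (\<Sum>n\<in>{n\<in>{1..Y}. primepow n \<and> \<not> prime n}. l)" by (rule sum.inter_filter[symmetric]) simp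
        also have "\<dots> = card {n\<in>{1..Y}. primepow n \<and> \<not> prime n} * l" by simp
        also have "\<dots> \<le> (2 * (sqrt Y + 1)) * l" using card_nonprime_primepow_le[of Y] l0 by (intro mult_right_mono) auto
        also have "\<dots> \<le> (4 * sqrt X) * l"
        proof (rule mult_right_mono)
          have "sqrt Y \<le> sqrt X" using Y by simp
          moreover have "1 \<le> sqrt X" using X2 by simp
          ultimately have "2 * (sqrt Y + 1) \<le> 2 * (sqrt X + sqrt X)" by (intro mult_left_mono add_mono) auto
          thus "2 * (sqrt Y + 1) \<le> 4 * sqrt X" by simp
        qed (rule l0)
        also have "\<dots> \<le> 4*(X*R)*l" using sqR l0 by (intro mult_right_mono) auto
        finally show ?thesis by (simp add: mult.assoc)
      qed
      moreover have "norm (psi_sum \<chi> Y) \<le> 32*(1+l)^2*X*R + X*R*l"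
      proof (cases "p^(D*k) \<le> Y")
        case True
        have Y1: "Y \<ge> 1" using True by (metis One_nat_def Suc_0_le_p_power(2) order.trans)
        have "norm (psi_sum \<chi> Y) \<le> 32*(1+ln Y)^2*Y*R" unfolding R_def by (rule psi[OF k \<chi> True])
        also have "\<dots> \<le> 32*(1+l)^2*X*R"
        proof -
          have "ln (real Y) \<le> l" unfolding l_def using Y Y1 by (intro ln_mono) auto
          moreover have "ln (real Y) \<ge> 0" using Y1 by simp
          ultimately have "(1+ln (real Y))^2 \<le> (1+l)^2" by (intro power_mono) auto
          thus ?thesis using Y R0 by (intro mult_right_mono mult_mono) auto
        qed
        also have "\<dots> \<le> 32*(1+l)^2*X*R + X*R*l" using R0 l0 by simp
        finally show ?thesis .
      next
        case False
        have "norm (psi_sum \<chi> Y) \<le> Y * l" unfolding l_def using X2 by (intro norm_psi_sum_trivial[OF \<chi> Y]) auto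
        also have "\<dots> \<le> (X*R)*l"
        proof -
          have "real Y \<le> real (p^(D*k))" using False by (simp only: of_nat_le_iff)
          hence "real Y \<le> X*R" using DR by linarith
          thus ?thesis using l0 by (intro mult_right_mono)
        qed
        also have "\<dots> \<le> 32*(1+l)^2*X*R + X*R*l" using R0 by simp
        finally show ?thesis .
      qed
      ultimately have "norm (\<Sum>n\<in>{1..Y}. \<theta> n) \<le> (X*R)*(32*(1+l)^2 + 5*l)" by (simp add: algebra_simps)
      also have "\<dots> \<le> (X*R)*(37*(1+l)^2)"
        using R0 l0 by (intro mult_left_mono) (auto simp: power2_eq_square algebra_simps)
      finally show ?thesis by (simp add: B_def mult_ac)
    qed
    \<comment> \<open>Starting at 2 avoids dividing by ln 1; the largest weight 1/ln 2 enters the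
      constant.\<close>
    define w where "w i = 1 / ln (real (i+2))" for i
    define g where "g i = \<theta> (i+2)" for i
    have gs: "(\<Sum>i<j. g i) = (\<Sum>n\<in>{1..j+1}. \<theta> n)" for j
    proof -
      have "(\<Sum>n\<in>{1..j+1}. \<theta> n) = (\<Sum>i<Suc j. \<theta> (Suc i))" using sum.atLeast1_atMost_eq[of \<theta> "Suc j"] by simp
      also have "\<dots> = \<theta> 1 + (\<Sum>i<j. \<theta> (Suc (Suc i)))" by (subst sum.lessThan_Suc_shift) simp
      also have "\<theta> 1 = 0" by (simp add: \<theta>_def)
      finally show ?thesis by (simp add: g_def)
    qed
    have "norm (\<Sum>i<X-1. of_real (w i) * g i) \<le> w 0 * B"
    proof (rule norm_sum_decreasing_weights)
      fix i
      have "ln (real (i+2)) > 0" by simp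
      moreover have "ln (real (i+2)) \<le> ln (real (Suc i+2))" by (intro ln_mono) auto
      ultimately show "w (Suc i) \<le> w i" unfolding w_def by (intro divide_left_mono mult_pos_pos) auto
      show "0 \<le> w i" by (simp add: w_def)
    next
      fix j assume "j \<le> X-1"
      thus "norm (\<Sum>i<j. g i) \<le> B" unfolding gs using X2 by (intro theta) auto
    qed
    moreover have "(\<Sum>i<X-1. of_real (w i) * g i) = (\<Sum>q | prime q \<and> q \<le> X. F \<chi> q)"
    proof -
      have "(\<Sum>i<X-1. of_real (w i) * g i) = (\<Sum>i<X-1. if prime (i+2) then F \<chi> (i+2) else 0)"
      proof (rule sum.cong[OF refl])
        fix i
        have "ln (real (i+2)) > 0" by simp
        thus "of_real (w i) * g i = (if prime (i+2) then F \<chi> (i+2) else 0)" unfolding w_def g_def \<theta>_def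
          by (simp del: of_nat_add)
      qed
      also have "\<dots> = (\<Sum>n\<in>{2..X}. if prime n then F \<chi> n else 0)"
        using X2 by (intro sum.reindex_bij_witness[of _ "\<lambda>n. n-2" "\<lambda>i. i+2"]) auto
      also have "\<dots> = (\<Sum>q | prime q \<and> q \<le> X. F \<chi> q)"
        by (rule sum.mono_neutral_cong_right) (auto dest: prime_ge_2_nat)
      finally show ?thesis .
    qed
    moreover have "w 0 * B = (37/ln 2)*(1+ln X)^2*X*root_rate^k" by (simp add: w_def B_def l_def R_def)
    ultimately show ?thesis by simp
  qed
  moreover have "37/ln 2 \<ge> (1::real)"
  proof -
    have "ln (2::real) \<le> 2 - 1" by (rule ln_le_minus_one) simp
    thus ?thesis by (simp add: field_simps)
  qed
  ultimately show ?thesis using that[of "D+1" "37/ln 2"] by simp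
qed

end

text \<open>k is chosen with p^(D*k) \<le> X \<le> p^(D*(k+1)), so \<rho>^k is a negative power of
  X, half of which pays for the logarithms; k = 0 is covered by the trivial bound. The functions S
  are quantified after the constants, because C' and \<delta> have to be uniform in \<chi>.\<close>

lemma power_saving:
  fixes p D :: nat and \<rho> C :: real
  assumes p: "p \<ge> 2" and D: "D \<ge> 1" and \<rho>: "0 < \<rho>" "\<rho> < 1" and C: "C \<ge> 1"
  shows "\<exists>C'>0. \<exists>\<delta>>0. \<forall>S. (\<forall>X. S X \<le> real X) \<longrightarrow>
     (\<forall>k X. k \<ge> 1 \<longrightarrow> p^(D*k) \<le> X \<longrightarrow> S X \<le> C*(1+ln X)^2*X*\<rho>^k) \<longrightarrow> (\<forall>X\<ge>1. S X \<le> C' * real X powr (1-\<delta>))"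
proof -
  define \<delta>0 where "\<delta>0 = - ln \<rho> / (D * ln p)"
  have lp: "ln (real p) > 0" using p by simp
  have \<delta>0: "\<delta>0 > 0" using \<rho> D lp by (simp add: \<delta>0_def divide_neg_pos)
  define c where "c = 1 + 4/\<delta>0"
  have c1: "c \<ge> 1" using \<delta>0 by (simp add: c_def)
  define C' where "C' = C * c^2 / \<rho>"
  have C'0: "C' > 0" using C c1 \<rho> by (simp add: C'_def)
  have "S X \<le> C' * real X powr (1-\<delta>0/2)" 
    if triv: "\<And>X. S X \<le> real X" and S: "\<And>k X. k \<ge> 1 \<Longrightarrow> p^(D*k) \<le> X \<Longrightarrow> S X \<le> C*(1+ln X)^2*X*\<rho>^k" and X: "X \<ge> 1" for S :: "nat \<Rightarrow> real" and X
  proof -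
    obtain n where n: "p^n \<le> X" "X < p^(n+1)" using ex_power_ivl1[OF p X] by auto
    define k where "k = n div D"
    have "D*k \<le> n" by (simp add: k_def)
    hence "p^(D*k) \<le> p^n" using p by (intro power_increasing) auto
    hence kX: "p^(D*k) \<le> X" using n by linarith
    have "n < D*(k+1)" unfolding k_def using D by (metis Suc_eq_plus1 dividend_less_times_div mult_Suc_right add.commute less_le_trans zero_less_one)
    hence "p^(n+1) \<le> p^(D*(k+1))" using p by (intro power_increasing) auto
    hence Xk: "X \<le> p^(D*(k+1))" using n by linarith
    have lnX: "ln (real X) \<le> D*(k+1) * ln p"
    proof -
      have "real X \<le> real (p^(D*(k+1)))" using Xk by (simp only: of_nat_le_iff)
      hence "ln (real X) \<le> ln (real (p^(D*(k+1))))" using X by (intro ln_mono) auto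
      also have "\<dots> = D*(k+1) * ln p" using p by (simp only: of_nat_power ln_realpow)
      finally show ?thesis .
    qed
    have rk: "\<rho>^k \<le> (1/\<rho>) * real X powr (-\<delta>0)"
    proof -
      have "\<rho>^(k+1) = exp (real (k+1) * ln \<rho>)" using \<rho> by (simp only: exp_of_nat_mult exp_ln)
      also have "real (k+1) * ln \<rho> = -\<delta>0 * (D*(k+1) * ln p)" using D lp by (simp add: \<delta>0_def field_simps)
      also have "exp \<dots> \<le> exp (-\<delta>0 * ln X)" using lnX \<delta>0 by (simp add: mult_left_mono)
      also have "\<dots> = real X powr (-\<delta>0)" using X by (simp add: powr_def)
      finally show ?thesis using \<rho> by (simp add: field_simps)
    qed
    have l0: "ln (real X) \<ge> 0" using X by simp
    have lg: "(1+ln X)^2 \<le> c^2 * real X powr (\<delta>0/2)"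
    proof -
      have "ln X \<le> real X powr (\<delta>0/4) / (\<delta>0/4)" using X \<delta>0 by (intro ln_powr_bound) auto
      moreover have "1 \<le> real X powr (\<delta>0/4)" using X \<delta>0 by (intro ge_one_powr_ge_zero) auto
      ultimately have "1 + ln X \<le> c * real X powr (\<delta>0/4)" by (simp add: c_def algebra_simps)
      hence "(1+ln X)^2 \<le> (c * real X powr (\<delta>0/4))^2" using l0 by (intro power_mono) auto
      also have "\<dots> = c^2 * (real X powr (\<delta>0/4) * real X powr (\<delta>0/4))" by (simp add: power2_eq_square)
      also have "real X powr (\<delta>0/4) * real X powr (\<delta>0/4) = real X powr (\<delta>0/2)" by (simp flip: powr_add)
      finally show ?thesis .
    qed
    have main: "S X \<le> C*(1+ln X)^2*X*\<rho>^k"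
    proof (cases "k \<ge> 1")
      case True thus ?thesis using S kX by blast
    next
      case False
      have "(1::real)^2 \<le> (1+ln X)^2" using l0 by (intro power_mono) auto
      hence "1*1*real X \<le> C*(1+ln X)^2*X" using C by (intro mult_right_mono mult_mono) auto
      moreover have "k = 0" using False by simp
      ultimately show ?thesis using triv[of X] by simp
    qed
    also have "\<dots> \<le> C*(c^2 * real X powr (\<delta>0/2))*X*((1/\<rho>) * real X powr (-\<delta>0))"
      using lg rk C \<rho> by (intro mult_mono) auto
    also have "\<dots> = C' * (real X powr (\<delta>0/2) * real X powr (-\<delta>0) * real X powr 1)" using X by (simp add: C'_def)
    also have "real X powr (\<delta>0/2) * real X powr (-\<delta>0) * real X powr 1 = real X powr (1-\<delta>0/2)"
      by (simp only: powr_add[symmetric]) (simp add: algebra_simps)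
    finally show ?thesis .
  qed
  hence "\<forall>S. (\<forall>X. S X \<le> real X) \<longrightarrow>
     (\<forall>k X. k \<ge> 1 \<longrightarrow> p^(D*k) \<le> X \<longrightarrow> S X \<le> C*(1+ln X)^2*X*\<rho>^k) \<longrightarrow> (\<forall>X\<ge>1. S X \<le> C' * real X powr (1-\<delta>0/2))"
    by blast
  moreover have "\<delta>0/2 > 0" using \<delta>0 by simp
  ultimately show ?thesis using C'0 by blast
qed

section \<open>Detection of residue classes and the theorem\<close>

lemma power_saving_exponential_sums:
  assumes "digital_phase p \<omega>"
  shows "\<exists>C>0. \<exists>\<delta>>0. \<delta> \<le> 1 \<and> (\<forall>\<chi> Y. norm \<chi> = 1 \<longrightarrow> Y \<ge> 1 \<longrightarrow>
     norm (\<Sum>n<Y. \<omega>^fact_exponent p (n^2) * \<chi>^n) \<le> C * real Y powr (1-\<delta>) \<and>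
     norm (\<Sum>q | prime q \<and> q < Y. \<omega>^fact_exponent p q * \<chi>^q) \<le> C * real Y powr (1-\<delta>))"
proof -
  interpret digital_phase p \<omega> by fact
  have "\<exists>C'>0. \<exists>\<delta>>0. \<forall>S. (\<forall>X. S X \<le> real X) \<longrightarrow>
     (\<forall>k X. k \<ge> 1 \<longrightarrow> p^(400*k) \<le> X \<longrightarrow> S X \<le> 8*(1+ln X)^2*X*root_rate^k) \<longrightarrow> (\<forall>X\<ge>1. S X \<le> C' * real X powr (1-\<delta>))"
    by (rule power_saving) (use p_ge_2 root_rate_bounds in auto)
  then obtain C1 \<delta>1 where C1: "C1 > 0" "\<delta>1 > 0" and S1: "\<forall>S. (\<forall>X. S X \<le> real X) \<longrightarrow>
     (\<forall>k X. k \<ge> 1 \<longrightarrow> p^(400*k) \<le> X \<longrightarrow> S X \<le> 8*(1+ln X)^2*X*root_rate^k) \<longrightarrow> (\<forall>X\<ge>1. S X \<le> C1 * real X powr (1-\<delta>1))"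
    by blast
  obtain D C where D: "D \<ge> 1" "C \<ge> 1" and
    PS: "\<And>k X \<chi>. k \<ge> 1 \<Longrightarrow> norm \<chi> = 1 \<Longrightarrow> p^(D*k) \<le> X \<Longrightarrow> norm (\<Sum>q | prime q \<and> q \<le> X. F \<chi> q) \<le> C*(1+ln X)^2*X*root_rate^k"
    using prime_sum_le by blast
  have "\<exists>C'>0. \<exists>\<delta>>0. \<forall>S. (\<forall>X. S X \<le> real X) \<longrightarrow>
     (\<forall>k X. k \<ge> 1 \<longrightarrow> p^(D*k) \<le> X \<longrightarrow> S X \<le> C*(1+ln X)^2*X*root_rate^k) \<longrightarrow> (\<forall>X\<ge>1. S X \<le> C' * real X powr (1-\<delta>))"
    by (rule power_saving) (use p_ge_2 root_rate_bounds D in auto)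
  then obtain C2 \<delta>2 where C2: "C2 > 0" "\<delta>2 > 0" and S2: "\<forall>S. (\<forall>X. S X \<le> real X) \<longrightarrow>
     (\<forall>k X. k \<ge> 1 \<longrightarrow> p^(D*k) \<le> X \<longrightarrow> S X \<le> C*(1+ln X)^2*X*root_rate^k) \<longrightarrow> (\<forall>X\<ge>1. S X \<le> C2 * real X powr (1-\<delta>2))"
    by blast
  define \<delta> where "\<delta> = min 1 (min \<delta>1 \<delta>2)"
  have \<delta>: "\<delta> > 0" "\<delta> \<le> 1" "\<delta> \<le> \<delta>1" "\<delta> \<le> \<delta>2" using C1 C2 by (auto simp: \<delta>_def)
  have sq: "norm (\<Sum>n<Y. f (n^2) * \<chi>^n) \<le> C1 * real Y powr (1-\<delta>1)" if \<chi>: "norm \<chi> = 1" and Y: "Y \<ge> 1" for \<chi> Y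
  proof (rule S1[rule_format, where S = "\<lambda>Y. norm (\<Sum>n<Y. f (n^2) * \<chi>^n)"])
    fix X
    have "norm (\<Sum>n<X. f (n^2) * \<chi>^n) \<le> (\<Sum>n<X. 1)" by (intro sum_norm_le) (simp add: norm_mult norm_power \<chi>)
    thus "norm (\<Sum>n<X. f (n^2) * \<chi>^n) \<le> real X" by simp
  next
    fix k X assume k: "1 \<le> k" and X: "p^(400*k) \<le> X"
    have X1: "X \<ge> 1" using X by (metis One_nat_def Suc_0_le_p_power(2) order.trans)
    have "norm (\<Sum>n<X. f (n^2) * \<chi>^n) \<le> 8*real X*root_rate^k" by (rule square_sum_le[OF X \<chi>])
    also have "\<dots> \<le> 8*(1+ln X)^2*X*root_rate^k"
    proof -
      have "(1::real)^2 \<le> (1+ln X)^2" using X1 by (intro power_mono) auto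
      hence "8*1*real X*root_rate^k \<le> 8*(1+ln X)^2*X*root_rate^k"
        using root_rate_bounds by (intro mult_right_mono mult_left_mono) auto
      thus ?thesis by simp
    qed
    finally show "norm (\<Sum>n<X. f (n^2) * \<chi>^n) \<le> 8*(1+ln X)^2*X*root_rate^k" .
  qed (rule Y)
  have pr: "norm (\<Sum>q | prime q \<and> q \<le> Y. F \<chi> q) \<le> C2 * real Y powr (1-\<delta>2)" if \<chi>: "norm \<chi> = 1" and Y: "Y \<ge> 1" for \<chi> Y
  proof (rule S2[rule_format, where S = "\<lambda>Y. norm (\<Sum>q | prime q \<and> q \<le> Y. F \<chi> q)"])
    fix X :: nat
    have "norm (\<Sum>q | prime q \<and> q \<le> X. F \<chi> q) \<le> (\<Sum>q | prime q \<and> q \<le> X. 1)" by (intro sum_norm_le) (simp add: \<chi>)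
    also have "\<dots> = card {q. prime q \<and> q \<le> X}" by simp
    also have "card {q. prime q \<and> q \<le> X} \<le> card {1..X}" by (rule card_mono) (auto dest: prime_ge_1_nat)
    finally show "norm (\<Sum>q | prime q \<and> q \<le> X. F \<chi> q) \<le> real X" by simp
  qed (use PS \<chi> Y in auto)
  have "norm (\<Sum>n<Y. \<omega>^fact_exponent p (n^2) * \<chi>^n) \<le> (C1+C2) * real Y powr (1-\<delta>)"
       "norm (\<Sum>q | prime q \<and> q < Y. \<omega>^fact_exponent p q * \<chi>^q) \<le> (C1+C2) * real Y powr (1-\<delta>)" if \<chi>: "norm \<chi> = 1" and Y: "Y \<ge> 1" for \<chi> Y
  proof -
    have "norm (\<Sum>n<Y. f (n^2) * \<chi>^n) \<le> C1 * real Y powr (1-\<delta>1)" by (rule sq[OF that])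
    also have "\<dots> \<le> (C1+C2) * real Y powr (1-\<delta>)" using C1 C2 Y \<delta> by (intro mult_mono powr_mono) auto
    finally show "norm (\<Sum>n<Y. \<omega>^fact_exponent p (n^2) * \<chi>^n) \<le> (C1+C2) * real Y powr (1-\<delta>)" by (simp add: f_def)
    have "norm (\<Sum>q | prime q \<and> q < Y. F \<chi> q) \<le> (C1+C2) * real Y powr (1-\<delta>)"
    proof (cases "Y \<ge> 2")
      case True
      have "{q. prime q \<and> q < Y} = {q. prime q \<and> q \<le> Y-1}" using True by auto
      hence "norm (\<Sum>q | prime q \<and> q < Y. F \<chi> q) \<le> C2 * real (Y-1) powr (1-\<delta>2)" using pr[OF \<chi>, of "Y-1"] True by simp
      also have "\<dots> \<le> (C1+C2) * real (Y-1) powr (1-\<delta>)" using C1 C2 True \<delta> by (intro mult_mono powr_mono) auto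
      also have "\<dots> \<le> (C1+C2) * real Y powr (1-\<delta>)" using C1 C2 \<delta> by (intro mult_left_mono powr_mono2) auto
      finally show ?thesis .
    next
      case False
      hence e: "{q. prime q \<and> q < Y} = {}" by (auto dest: prime_ge_2_nat)
      show ?thesis unfolding e using C1 C2 by simp
    qed
    thus "norm (\<Sum>q | prime q \<and> q < Y. \<omega>^fact_exponent p q * \<chi>^q) \<le> (C1+C2) * real Y powr (1-\<delta>)"
      by (simp add: F_def f_def)
  qed
  thus ?thesis using C1 C2 \<delta> by (intro exI[of _ "C1+C2"] conjI exI[of _ \<delta>]) auto
qed

text \<open>Among natural numbers (d-1)*a stands for -a modulo d.\<close>

lemma cong_iff_dvd_add:
  fixes d n a :: nat
  assumes d: "d \<ge> 1"
  shows "[n = a] (mod d) \<longleftrightarrow> d dvd n + (d-1)*a"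
proof -
  have "[n = a] (mod d) \<longleftrightarrow> [n + (d-1)*a = a + (d-1)*a] (mod d)" by (rule cong_add_rcancel_nat[symmetric])
  also have "a + (d-1)*a = d*a" using d by (metis add.commute le_add_diff_inverse2 mult_Suc Suc_eq_plus1)
  also have "[n + (d-1)*a = d*a] (mod d) \<longleftrightarrow> d dvd n + (d-1)*a" by (simp add: cong_def dvd_eq_mod_eq_0)
  finally show ?thesis .
qed

lemma cis_root_neq_1:
  assumes "1 \<le> l" "l < m"
  shows "cis (2*pi*real l/real m) \<noteq> 1"
proof
  assume "cis (2*pi*real l/real m) = 1"
  hence "cos (2*pi*real l/real m) = 1" by (simp add: complex_eq_iff)
  then obtain k :: int where "2*pi*real l/real m = of_int k * 2 * pi" by (auto simp: cos_one_2pi_int)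
  hence "real l = of_int k * real m" using assms by (simp add: field_simps)
  hence "int l = k * int m" by (metis of_int_eq_iff of_int_mult of_int_of_nat_eq)
  hence "int m dvd int l" by simp
  hence "m dvd l" by simp
  thus False using assms by (auto dest: dvd_imp_le)
qed

text \<open>Orthogonality in both variables. The term l = 0 reproduces the count in the class of a
  modulo d exactly, divided by m. The other sums are bounded by B one by one and then averaged over
  the d*m pairs of characters, so d and m do not multiply the error.\<close>

lemma residue_detection:
  fixes S :: "nat set" and e :: "nat \<Rightarrow> nat" and B :: real
  assumes fin: "finite S" and d: "d \<ge> 1" and m: "m \<ge> 1" and B: "B \<ge> 0"
    and bd: "\<And>l \<chi>. l \<in> {1..<m} \<Longrightarrow> norm \<chi> = 1 \<Longrightarrow> norm (\<Sum>n\<in>S. cis (2*pi*real l/real m)^e n * \<chi>^n) \<le> B"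
  shows "\<bar>real (card {n\<in>S. [n = a] (mod d) \<and> [e n = r] (mod m)}) - card {n\<in>S. [n = a] (mod d)} / m\<bar> \<le> B"
proof -
  define A where "A = (d-1)*a"
  define R where "R = (m-1)*r"
  define \<xi> where "\<xi> h = cis (2*pi*real h/real d)" for h
  define w where "w l = cis (2*pi*real l/real m)" for l
  define K where "K = card {n\<in>S. [n = a] (mod d) \<and> [e n = r] (mod m)}"
  define K1 where "K1 = card {n\<in>S. [n = a] (mod d)}"
  have n\<xi>: "norm (\<xi> h) = 1" and nw: "norm (w h) = 1" for h by (simp_all add: \<xi>_def w_def)
  have Id: "(\<Sum>h<d. \<xi> h^(n+A)) = (if [n = a] (mod d) then of_nat d else 0)" for n
    unfolding \<xi>_def A_def cong_iff_dvd_add[OF d] by (rule sum_roots_of_unity[OF d])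
  have Im: "(\<Sum>l<m. w l^(e n+R)) = (if [e n = r] (mod m) then of_nat m else 0)" for n
    unfolding w_def R_def cong_iff_dvd_add[OF m] by (rule sum_roots_of_unity[OF m])
  have t1: "(\<Sum>n\<in>S. (\<Sum>h<d. \<xi> h^(n+A)) * (\<Sum>l<m. w l^(e n+R))) = of_nat (d*m*K)"
  proof -
    have "(\<Sum>n\<in>S. (\<Sum>h<d. \<xi> h^(n+A)) * (\<Sum>l<m. w l^(e n+R))) = (\<Sum>n\<in>S. if [n = a] (mod d) \<and> [e n = r] (mod m) then of_nat (d*m) else 0)"
      unfolding Id Im by (rule sum.cong) auto
    also have "\<dots> = (\<Sum>n\<in>{n\<in>S. [n = a] (mod d) \<and> [e n = r] (mod m)}. of_nat (d*m))"
      by (rule sum.inter_filter[symmetric, OF fin])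
    finally show ?thesis by (simp add: K_def)
  qed
  have t2: "(\<Sum>n\<in>S. \<Sum>h<d. \<xi> h^(n+A)) = of_nat (d*K1)"
  proof -
    have "(\<Sum>n\<in>S. \<Sum>h<d. \<xi> h^(n+A)) = (\<Sum>n\<in>{n\<in>S. [n = a] (mod d)}. of_nat d)"
      unfolding Id by (rule sum.inter_filter[symmetric, OF fin])
    thus ?thesis by (simp add: K1_def)
  qed
  have sp: "(\<Sum>l<m. w l^j) = 1 + (\<Sum>l\<in>{1..<m}. w l^j)" for j
  proof -
    have "(\<Sum>l<m. w l^j) = w 0^j + (\<Sum>l\<in>{1..<m}. w l^j)"
      using m sum.atLeast_Suc_lessThan[of 0 m "\<lambda>l. w l^j"] by (simp add: lessThan_atLeast0)
    thus ?thesis by (simp add: w_def)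
  qed
  have "(\<Sum>n\<in>S. (\<Sum>h<d. \<xi> h^(n+A)) * (\<Sum>l<m. w l^(e n+R))) = (\<Sum>n\<in>S. \<Sum>h<d. \<xi> h^(n+A)) + (\<Sum>n\<in>S. (\<Sum>h<d. \<xi> h^(n+A)) * (\<Sum>l\<in>{1..<m}. w l^(e n+R)))"
    unfolding sp by (simp add: distrib_left sum.distrib)
  hence "of_nat (d*m*K) - of_nat (d*K1) = (\<Sum>n\<in>S. (\<Sum>h<d. \<xi> h^(n+A)) * (\<Sum>l\<in>{1..<m}. w l^(e n+R)))"
    unfolding t1 t2 by simp
  also have "\<dots> = (\<Sum>n\<in>S. \<Sum>h<d. \<Sum>l\<in>{1..<m}. \<xi> h^(n+A) * w l^(e n+R))"
    by (simp only: sum_product)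
  also have "\<dots> = (\<Sum>h<d. \<Sum>l\<in>{1..<m}. \<Sum>n\<in>S. \<xi> h^(n+A) * w l^(e n+R))"
    by (rule sum_rotate[symmetric])
  also have "\<dots> = (\<Sum>h<d. \<Sum>l\<in>{1..<m}. (\<xi> h^A * w l^R) * (\<Sum>n\<in>S. w l^e n * \<xi> h^n))"
    unfolding sum_distrib_left by (intro sum.cong refl) (simp add: power_add mult_ac)
  finally have eq: "of_nat (d*m*K) - of_nat (d*K1) = (\<Sum>h<d. \<Sum>l\<in>{1..<m}. (\<xi> h^A * w l^R) * (\<Sum>n\<in>S. w l^e n * \<xi> h^n))" .
  have "norm (of_nat (d*m*K) - of_nat (d*K1) :: complex) \<le> (\<Sum>h<d. \<Sum>l\<in>{1..<m}. B)"
    unfolding eq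
  proof (intro sum_norm_le)
    fix h l assume "l \<in> {1..<m}"
    from bd[OF this n\<xi>[of h]] show "norm ((\<xi> h^A * w l^R) * (\<Sum>n\<in>S. w l^e n * \<xi> h^n)) \<le> B"
      by (simp add: norm_mult norm_power n\<xi> nw w_def)
  qed
  also have "\<dots> = d * (real (m-1) * B)" by simp
  also have "\<dots> \<le> d * (m * B)" using B by (intro mult_left_mono mult_right_mono) auto
  finally have "\<bar>real (d*m*K) - real (d*K1)\<bar> \<le> d * (m * B)"
    by (metis norm_of_real of_real_diff of_real_of_nat_eq)
  moreover have "real (d*m*K) - real (d*K1) = d * (m * (real K - K1 / m))" using m by (simp add: field_simps)
  ultimately have "d * (m * \<bar>real K - K1 / m\<bar>) \<le> d * (m * B)" by (simp add: abs_mult)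
  thus ?thesis using d m by (simp add: K_def K1_def)
qed

lemma card_residue_class_real:
  fixes Y d a :: nat
  assumes d: "d \<ge> 1" and a: "a < d"
  shows "\<bar>real (card {n\<in>{..<Y}. [n = a] (mod d)}) - Y / d\<bar> \<le> 1"
proof -
  define K where "K = card {n\<in>{..<Y}. [n = a] (mod d)}"
  have c: "[n = a] (mod d) \<longleftrightarrow> n mod d = a" for n using a by (simp add: cong_def)
  have d0: "d > 0" using d by simp
  have e: "Y div d * d \<le> Y" "Y < (Y div d + 1) * d"
    using d0 by (auto simp: dividend_less_div_times add.commute)
  have "card {j. j < Y div d * d \<and> j mod d = a} \<le> K"
    unfolding K_def by (intro card_mono) (auto simp: c intro: less_le_trans[OF _ e(1)])
  hence 1: "Y div d \<le> K" by (simp add: card_cong_lessThan[OF d0 a])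
  have "K \<le> card {j. j < (Y div d + 1) * d \<and> j mod d = a}"
    unfolding K_def using e by (intro card_mono) (auto simp: c)
  hence 2: "K \<le> Y div d + 1" by (simp only: card_cong_lessThan[OF d0 a])
  have 3: "real (Y div d) \<le> Y / d" by (rule of_nat_div_le_of_nat)
  have "real Y \<le> real ((Y div d + 1) * d)" using e(2) by (simp only: of_nat_le_iff)
  hence 4: "Y / d \<le> real (Y div d) + 1" using d0 by (simp add: field_simps)
  show ?thesis using 1 2 3 4 unfolding K_def[symmetric] by linarith
qed

definition square_error :: "nat \<Rightarrow> nat \<Rightarrow> nat \<Rightarrow> nat \<Rightarrow> nat \<Rightarrow> real \<Rightarrow> real" where
  "square_error p m d a r x =
     \<bar>real (card {n. real n < x \<and> [n = a] (mod d) \<and> [fact_exponent p (n^2) = r] (mod m)}) - x / (real d * real m)\<bar>"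

definition prime_error :: "nat \<Rightarrow> nat \<Rightarrow> nat \<Rightarrow> nat \<Rightarrow> nat \<Rightarrow> real \<Rightarrow> real" where
  "prime_error p m d a r x =
     \<bar>real (card {q. real q < x \<and> prime q \<and> [q = a] (mod d) \<and> [fact_exponent p q = r] (mod m)})
       - real (primes_ap_pi x a d) / real m\<bar>"

text \<open>Only the numbers l from 1 to m-1 occur, so the sum of their constants and the minimum of
  their exponents serve for all of them; both depend on p and m alone.\<close>

lemma equidistribution_fixed_modulus:
  fixes p m :: nat
  assumes p: "prime p" and m: "m \<ge> 1"
  shows "\<exists>C>0. \<exists>\<delta>>0. \<forall>(d::nat) (a::nat) (r::nat) (x::real). d \<ge> 1 \<longrightarrow> a < d \<longrightarrow> x \<ge> 2 \<longrightarrow>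
      square_error p m d a r x \<le> C * x powr (1-\<delta>) \<and>
      prime_error p m d a r x \<le> C * x powr (1-\<delta>)"
proof -
  define w where "w l = cis (2*pi*real l/real m)" for l
  have "\<forall>l\<in>{1..<m}. \<exists>C \<delta>. C > 0 \<and> \<delta> > 0 \<and> \<delta> \<le> 1 \<and> (\<forall>\<chi> Y. norm \<chi> = 1 \<longrightarrow> Y \<ge> 1 \<longrightarrow>
     norm (\<Sum>n<Y. w l^fact_exponent p (n^2) * \<chi>^n) \<le> C * real Y powr (1-\<delta>) \<and>
     norm (\<Sum>q | prime q \<and> q < Y. w l^fact_exponent p q * \<chi>^q) \<le> C * real Y powr (1-\<delta>))"
  proof
    fix l assume "l \<in> {1..<m}"
    hence "digital_phase p (w l)" using p cis_root_neq_1[of l m] by unfold_locales (auto simp: w_def)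
    from power_saving_exponential_sums[OF this]
    show "\<exists>C \<delta>. C > 0 \<and> \<delta> > 0 \<and> \<delta> \<le> 1 \<and> (\<forall>\<chi> Y. norm \<chi> = 1 \<longrightarrow> Y \<ge> 1 \<longrightarrow>
     norm (\<Sum>n<Y. w l^fact_exponent p (n^2) * \<chi>^n) \<le> C * real Y powr (1-\<delta>) \<and>
     norm (\<Sum>q | prime q \<and> q < Y. w l^fact_exponent p q * \<chi>^q) \<le> C * real Y powr (1-\<delta>))" by blast
  qed
  then obtain C \<delta> where C: "\<And>l. l \<in> {1..<m} \<Longrightarrow> C l > 0" and \<delta>: "\<And>l. l \<in> {1..<m} \<Longrightarrow> \<delta> l > 0" "\<And>l. l \<in> {1..<m} \<Longrightarrow> \<delta> l \<le> 1"
    and sq: "\<And>l \<chi> Y. l \<in> {1..<m} \<Longrightarrow> norm \<chi> = 1 \<Longrightarrow> Y \<ge> 1 \<Longrightarrow> norm (\<Sum>n<Y. w l^fact_exponent p (n^2) * \<chi>^n) \<le> C l * real Y powr (1-\<delta> l)"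
    and pr: "\<And>l \<chi> Y. l \<in> {1..<m} \<Longrightarrow> norm \<chi> = 1 \<Longrightarrow> Y \<ge> 1 \<Longrightarrow> norm (\<Sum>q | prime q \<and> q < Y. w l^fact_exponent p q * \<chi>^q) \<le> C l * real Y powr (1-\<delta> l)"
    unfolding bchoice_iff by blast
  define C0 where "C0 = (\<Sum>l\<in>{1..<m}. C l)"
  define \<delta>0 where "\<delta>0 = Min (insert 1 (\<delta> ` {1..<m}))"
  have \<delta>0: "\<delta>0 > 0" "\<delta>0 \<le> 1" unfolding \<delta>0_def using \<delta> by (auto simp: Min_gr_iff)
  have \<delta>l: "\<delta>0 \<le> \<delta> l" if "l \<in> {1..<m}" for l unfolding \<delta>0_def using that by (intro Min_le) auto
  have Cl: "C l \<le> C0" if "l \<in> {1..<m}" for l unfolding C0_def using that C by (intro member_le_sum) (auto intro: less_imp_le)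
  have C00: "C0 \<ge> 0" unfolding C0_def using C by (intro sum_nonneg) (auto intro: less_imp_le)
  have up: "C l * real Y powr (1-\<delta> l) \<le> C0 * real Y powr (1-\<delta>0)" if "l \<in> {1..<m}" "Y \<ge> 1" for l and Y :: nat
    using that Cl[of l] \<delta>l[of l] C00 by (intro mult_mono powr_mono) auto
  have "square_error p m d a r x \<le> (2*C0+2) * x powr (1-\<delta>0)" (is ?A)
    and "prime_error p m d a r x \<le> (2*C0+2) * x powr (1-\<delta>0)" (is ?B)
    if d: "d \<ge> 1" and a: "a < d" and x: "x \<ge> 2" for d a r :: nat and x :: real
  proof -
    define Y where "Y = nat \<lceil>x\<rceil>"
    define B where "B = C0 * real Y powr (1-\<delta>0)"
    define xp where "xp = x powr (1-\<delta>0)"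
    have lt: "real n < x \<longleftrightarrow> n < Y" for n using x by (simp add: Y_def zless_nat_eq_int_zless less_ceiling_iff)
    have Yx: "x \<le> real Y" "real Y < x + 1" using x by (auto simp: Y_def) linarith+
    have Y1: "Y \<ge> 1" using Yx x by (metis One_nat_def Suc_leI gr0I le_zero_eq not_numeral_le_zero of_nat_0 of_nat_0_less_iff order.trans)
    have xp1: "xp \<ge> 1" unfolding xp_def using x \<delta>0 by (intro ge_one_powr_ge_zero) auto
    have BB: "B \<le> 2*C0*xp"
    proof -
      have "real Y powr (1-\<delta>0) \<le> (2*x) powr (1-\<delta>0)" using Yx x \<delta>0 by (intro powr_mono2) auto
      also have "\<dots> = 2 powr (1-\<delta>0) * xp" using x by (simp add: powr_mult xp_def)
      also have "2 powr (1-\<delta>0) \<le> (2::real) powr 1" using \<delta>0 by (intro powr_mono) auto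
      finally have "real Y powr (1-\<delta>0) \<le> 2*xp" using xp1 by (simp add: mult_right_mono)
      thus ?thesis unfolding B_def using C00 mult_left_mono[of "real Y powr (1-\<delta>0)" "2*xp" C0] by simp
    qed
    have B0: "B \<ge> 0" using C00 by (simp add: B_def)
    have m1: "real m \<ge> 1" using m by simp
    have d1: "real d \<ge> 1" using d by simp
    have r1: "\<bar>real (card {n\<in>{..<Y}. [n = a] (mod d) \<and> [fact_exponent p (n^2) = r] (mod m)}) - card {n\<in>{..<Y}. [n = a] (mod d)} / m\<bar> \<le> B"
    proof (rule residue_detection[OF _ d m B0])
      fix l and \<chi> :: complex assume l: "l \<in> {1..<m}" and \<chi>: "norm \<chi> = 1"
      show "norm (\<Sum>n<Y. cis (2*pi*real l/real m)^fact_exponent p (n^2) * \<chi>^n) \<le> B"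
        using sq[OF l \<chi> Y1] up[OF l Y1] unfolding w_def B_def by linarith
    qed simp
    have r2: "\<bar>real (card {q\<in>{q. prime q \<and> q < Y}. [q = a] (mod d) \<and> [fact_exponent p q = r] (mod m)}) - card {q\<in>{q. prime q \<and> q < Y}. [q = a] (mod d)} / m\<bar> \<le> B"
    proof (rule residue_detection[OF _ d m B0])
      fix l and \<chi> :: complex assume l: "l \<in> {1..<m}" and \<chi>: "norm \<chi> = 1"
      show "norm (\<Sum>q\<in>{q. prime q \<and> q < Y}. cis (2*pi*real l/real m)^fact_exponent p q * \<chi>^q) \<le> B"
        using pr[OF l \<chi> Y1] up[OF l Y1] unfolding w_def B_def by linarith
    qed simp
    have e1: "\<bar>real (card {n\<in>{..<Y}. [n = a] (mod d)}) - x / d\<bar> \<le> 2"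
    proof -
      have "\<bar>real Y / d - x / d\<bar> \<le> 1"
      proof -
        have "real Y / d - x / d = (real Y - x) / d" by (simp add: diff_divide_distrib)
        moreover have "0 \<le> (real Y - x) / d" "(real Y - x) / d \<le> 1" using Yx d1 by (auto simp: field_simps)
        ultimately show ?thesis by simp
      qed
      thus ?thesis using card_residue_class_real[OF d a, of Y] by linarith
    qed
    have scale: "\<bar>u / m - v / m\<bar> \<le> \<bar>u - v\<bar>" for u v :: real
    proof -
      have "\<bar>u / m - v / m\<bar> = \<bar>u - v\<bar> / m" using m1 by (simp add: diff_divide_distrib[symmetric] abs_divide)
      also have "\<dots> \<le> \<bar>u - v\<bar> / 1" using m1 by (intro divide_left_mono) auto
      finally show ?thesis by simp
    qed
    have s1: "{n. real n < x \<and> [n = a] (mod d) \<and> [fact_exponent p (n^2) = r] (mod m)} = {n\<in>{..<Y}. [n = a] (mod d) \<and> [fact_exponent p (n^2) = r] (mod m)}"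
      by (auto simp: lt)
    have "\<bar>real (card {n\<in>{..<Y}. [n = a] (mod d)}) / m - (x / d) / m\<bar> \<le> 2"
      using scale[of "real (card {n\<in>{..<Y}. [n = a] (mod d)})" "x/d"] e1 by linarith
    moreover have "(x / d) / m = x / (real d * real m)" by simp
    ultimately have "square_error p m d a r x \<le> B + 2"
      using r1 unfolding square_error_def s1 by linarith
    also have "\<dots> \<le> (2*C0+2)*xp" using BB xp1 by (simp add: algebra_simps)
    finally show ?A by (simp only: xp_def)
    have s2: "{q. real q < x \<and> prime q \<and> [q = a] (mod d) \<and> [fact_exponent p q = r] (mod m)} = {q\<in>{q. prime q \<and> q < Y}. [q = a] (mod d) \<and> [fact_exponent p q = r] (mod m)}"
      by (auto simp: lt)
    \<comment> \<open>The primes counted satisfy q < x, whereas \<open>primes_ap_pi\<close> allows q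
      \<le> x; at most one prime makes the difference.\<close>
    define T where "T = {q\<in>{q. prime q \<and> q < Y}. [q = a] (mod d)}"
    define T' where "T' = {q::nat. prime q \<and> real q \<le> x \<and> [q = a] (mod d)}"
    have finT: "finite T" by (simp add: T_def)
    have sub: "T \<subseteq> T'" by (auto simp: T_def T'_def lt[symmetric])
    have "T' \<subseteq> insert (nat \<lfloor>x\<rfloor>) T"
    proof
      fix q assume q: "q \<in> T'"
      show "q \<in> insert (nat \<lfloor>x\<rfloor>) T"
      proof (cases "real q < x")
        case True thus ?thesis using q by (auto simp: T_def T'_def lt)
      next
        case False
        hence "real q = x" using q by (auto simp: T'_def)
        hence "q = nat \<lfloor>x\<rfloor>" by (metis floor_of_nat nat_int)
        thus ?thesis by simp
      qed
    qed
    hence "card T' \<le> card (insert (nat \<lfloor>x\<rfloor>) T)" using finT by (intro card_mono) auto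
    also have "\<dots> \<le> card T + 1" by (simp add: card_insert_if finT)
    finally have u: "card T' \<le> card T + 1" .
    have "finite T'" using \<open>T' \<subseteq> insert (nat \<lfloor>x\<rfloor>) T\<close> finT by (meson finite.insertI finite_subset)
    hence "card T \<le> card T'" using sub by (rule card_mono)
    hence "\<bar>real (card T) - real (card T')\<bar> \<le> 1" using u by linarith
    hence "\<bar>real (card T) / m - real (card T') / m\<bar> \<le> 1" using scale[of "real (card T)" "real (card T')"] by linarith
    moreover have "primes_ap_pi x a d = card T'" by (simp add: primes_ap_pi_def T'_def)
    ultimately have "prime_error p m d a r x \<le> B + 1"
      using r2 unfolding prime_error_def s2 T_def[symmetric] by simp
    also have "\<dots> \<le> (2*C0+2)*xp" using BB xp1 by (simp add: algebra_simps)
    finally show ?B by (simp only: xp_def)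
  qed
  thus ?thesis using C00 \<delta>0(1) by (intro exI[of _ "2*C0+2"] conjI exI[of _ \<delta>0]) auto
qed

text \<open>A power saving with a constant depending on the modulus becomes one with an absolute constant
  at the cost of a smaller exponent: below a threshold the trivial bound is used, and there
  \<^term>\<open>x powr \<delta> \<le> 2\<close>.\<close>

lemma absorb_constant:
  fixes C \<delta> :: real
  assumes C: "C > 0" and \<delta>: "\<delta> > 0"
  obtains \<delta>' where "\<delta>' > 0" and "\<And>x. x \<ge> 2 \<Longrightarrow> min (C * x powr (1-\<delta>)) (2*x) \<le> 4 * x powr (1-\<delta>')"
proof -
  \<comment> \<open>From X0 on C \<le> x powr (\<delta>/2), so half of the saving swallows C; the
    maximum with 2 keeps ln X0 positive.\<close>
  define X0 where "X0 = max 2 (C powr (2/\<delta>))"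
  define \<delta>' where "\<delta>' = min (\<delta>/2) (ln 2 / ln X0)"
  have X0: "X0 \<ge> 2" by (simp add: X0_def)
  have lX0: "ln X0 > 0" using X0 by simp
  have \<delta>': "\<delta>' > 0" "\<delta>' \<le> \<delta>/2" "\<delta>' \<le> ln 2 / ln X0"
  proof -
    show "\<delta>' > 0" using \<delta> lX0 by (simp add: \<delta>'_def)
    show "\<delta>' \<le> \<delta>/2" unfolding \<delta>'_def by (rule min.cobounded1)
    show "\<delta>' \<le> ln 2 / ln X0" unfolding \<delta>'_def by (rule min.cobounded2)
  qed
  have "min (C * x powr (1-\<delta>)) (2*x) \<le> 4 * x powr (1-\<delta>')" if x: "x \<ge> 2" for x
  proof (cases "x \<ge> X0")
    case True
    hence "C powr (2/\<delta>) \<le> x" by (simp add: X0_def)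
    hence "(C powr (2/\<delta>)) powr (\<delta>/2) \<le> x powr (\<delta>/2)" using \<delta> by (intro powr_mono2) auto
    hence "C \<le> x powr (\<delta>/2)" using C \<delta> by (simp add: powr_powr)
    hence "C * x powr (1-\<delta>) \<le> x powr (\<delta>/2) * x powr (1-\<delta>)" by (intro mult_right_mono) auto
    also have "\<dots> = x powr (1-\<delta>/2)" by (simp flip: powr_add)
    also have "\<dots> \<le> x powr (1-\<delta>')" using x \<delta>' by (intro powr_mono) auto
    also have "\<dots> \<le> 4 * x powr (1-\<delta>')" by simp
    finally show ?thesis by simp
  next
    case False
    have "ln x \<le> ln X0" using False x by (intro ln_mono) auto
    hence "\<delta>' * ln x \<le> (ln 2 / ln X0) * ln X0" using \<delta>' x lX0 by (intro mult_mono) auto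
    hence "\<delta>' * ln x \<le> ln 2" using lX0 by simp
    hence "exp (\<delta>' * ln x) \<le> exp (ln 2)" by (simp only: exp_le_cancel_iff)
    hence "x powr \<delta>' \<le> 2" using x by (simp add: powr_def)
    hence "x powr \<delta>' * x powr (1-\<delta>') \<le> 2 * x powr (1-\<delta>')" by (intro mult_right_mono) auto
    moreover have "x powr \<delta>' * x powr (1-\<delta>') = x" using x by (simp flip: powr_add)
    ultimately show ?thesis by simp
  qed
  thus ?thesis using that \<delta>' by blast
qed

lemma trivial_bounds:
  fixes p m d a r :: nat and x :: real
  assumes m: "m \<ge> 1" and d: "d \<ge> 1" and x: "x \<ge> 2"
  shows "square_error p m d a r x \<le> 2*x"
    and "prime_error p m d a r x \<le> 2*x"
proof -
  have count: "real (card {n::nat. P n}) \<le> 2*x" if P: "\<And>n. P n \<Longrightarrow> real n \<le> x" for P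
  proof -
    have "{n. P n} \<subseteq> {..nat \<lfloor>x\<rfloor>}" using P by (auto simp: le_nat_floor)
    hence "card {n. P n} \<le> card {..nat \<lfloor>x\<rfloor>}" by (intro card_mono) auto
    hence "real (card {n. P n}) \<le> real (nat \<lfloor>x\<rfloor>) + 1" by simp
    also have "\<dots> \<le> x + 1" using x by simp
    finally show ?thesis using x by simp
  qed
  have ab: "\<bar>u - v\<bar> \<le> 2*x" if "0 \<le> u" "u \<le> 2*x" "0 \<le> v" "v \<le> 2*x" for u v :: real using that by linarith
  have "1 * 1 \<le> real d * real m" using d m by (intro mult_mono) auto
  hence "x / (real d * real m) \<le> x / 1" using x by (intro divide_left_mono) auto
  thus "square_error p m d a r x \<le> 2*x"
    unfolding square_error_def using x by (intro ab count) auto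
  have "real (primes_ap_pi x a d) \<le> 2*x" unfolding primes_ap_pi_def by (rule count) auto
  moreover have "real (primes_ap_pi x a d) / real m \<le> real (primes_ap_pi x a d) / 1" using m by (intro divide_left_mono) auto
  ultimately show "prime_error p m d a r x \<le> 2*x"
    unfolding prime_error_def by (intro ab count) auto
qed

lemma ln_2_ge_half: "ln (2::real) \<ge> 1/2"
proof -
  have "ln (1/2::real) \<le> 1/2 - 1" by (rule ln_le_minus_one) simp
  thus ?thesis by (simp add: ln_div)
qed

theorem theorem1:
  fixes p :: nat
  assumes "prime p"
  shows "\<exists>C1>0. \<exists>C2>0. \<forall>m\<ge>1. \<exists>\<delta>1>0. \<exists>\<delta>2>0.
           \<forall>(d::nat) (a::nat) (r::nat) (x::real).
             d \<ge> 1 \<longrightarrow> a < d \<longrightarrow> r < m \<longrightarrow> x \<ge> 2 \<longrightarrow>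
               \<bar>real (card {n::nat. real n < x \<and> [n = a] (mod d) \<and>
                                   [fact_exponent p (n^2) = r] (mod m)})
                  - x / (real d * real m)\<bar>
                 \<le> C1 * (ln x powr (11/4) * x powr (1 - \<delta>1)) \<and>
               \<bar>real (card {q::nat. real q < x \<and> prime q \<and> [q = a] (mod d) \<and>
                                   [fact_exponent p q = r] (mod m)})
                  - real (primes_ap_pi x a d) / real m\<bar>
                 \<le> C2 * ((ln x) ^ 3 * x powr (1 - \<delta>2))"
proof -
  have "\<exists>\<delta>>0. \<forall>d a r x. d \<ge> 1 \<longrightarrow> a < d \<longrightarrow> r < m \<longrightarrow> x \<ge> 2 \<longrightarrow>
      square_error p m d a r x \<le> 32 * (ln x powr (11/4) * x powr (1 - \<delta>)) \<and>
      prime_error p m d a r x \<le> 32 * ((ln x) ^ 3 * x powr (1 - \<delta>))" if m: "m \<ge> 1" for m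
  proof -
    obtain C \<delta> where C: "C > 0" "\<delta> > 0" and bd: "\<And>d a r x. d \<ge> 1 \<Longrightarrow> a < d \<Longrightarrow> x \<ge> 2 \<Longrightarrow>
      square_error p m d a r x \<le> C * x powr (1-\<delta>) \<and> prime_error p m d a r x \<le> C * x powr (1-\<delta>)"
      using equidistribution_fixed_modulus[OF assms m] by blast
    obtain \<delta>' where \<delta>': "\<delta>' > 0" and ab: "\<And>x. x \<ge> 2 \<Longrightarrow> min (C * x powr (1-\<delta>)) (2*x) \<le> 4 * x powr (1-\<delta>')"
      using absorb_constant[OF C] by blast
    show ?thesis
    proof (intro exI[of _ \<delta>'] conjI allI impI \<delta>')
      fix d a r :: nat and x :: real
      assume h: "d \<ge> 1" "a < d" "r < m" "x \<ge> 2"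
      \<comment> \<open>The saving obtained contains no logarithm. As ln x \<ge> 1/2, each
        logarithmic factor of the statement is at least 1/8; this 8 and the 4 of
        \<open>absorb_constant\<close> give the absolute constant 32.\<close>
      have lx: "ln x \<ge> 1/2" using ln_2_ge_half ln_mono[of 2 x] h(4) by linarith
      have "(1/2::real)^3 \<le> (ln x)^3" using lx by (intro power_mono) auto
      hence l3: "1 \<le> 8 * (ln x)^3" by (simp add: power_divide)
      have "(1/2::real) powr 3 \<le> (1/2) powr (11/4)" by (intro powr_mono') auto
      also have "\<dots> \<le> ln x powr (11/4)" using lx by (intro powr_mono2) auto
      finally have l11: "1 \<le> 8 * ln x powr (11/4)" by (simp add: powr_numeral power_divide)
      have fin: "E \<le> 32 * (L * x powr (1-\<delta>'))" if "E \<le> C * x powr (1-\<delta>)" "E \<le> 2*x" "1 \<le> 8 * L" for E L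
      proof -
        have "E \<le> 4 * x powr (1-\<delta>')" using ab[OF h(4)] that by linarith
        also have "\<dots> = 1 * (4 * x powr (1-\<delta>'))" by simp
        also have "\<dots> \<le> (8 * L) * (4 * x powr (1-\<delta>'))" using that(3) by (intro mult_right_mono) auto
        finally show ?thesis by simp
      qed
      show "square_error p m d a r x \<le> 32 * (ln x powr (11/4) * x powr (1 - \<delta>'))"
        using bd[OF h(1,2,4), of r] trivial_bounds(1)[OF m h(1,4)] l11 by (intro fin) auto
      show "prime_error p m d a r x \<le> 32 * ((ln x) ^ 3 * x powr (1 - \<delta>'))"
        using bd[OF h(1,2,4), of r] trivial_bounds(2)[OF m h(1,4)] l3 by (intro fin) auto
    qed
  qed
  hence "\<forall>m\<ge>1. \<exists>\<delta>1>0. \<exists>\<delta>2>0. \<forall>d a r x. d \<ge> 1 \<longrightarrow> a < d \<longrightarrow> r < m \<longrightarrow> x \<ge> 2 \<longrightarrow>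
      square_error p m d a r x \<le> 32 * (ln x powr (11/4) * x powr (1 - \<delta>1)) \<and>
      prime_error p m d a r x \<le> 32 * ((ln x) ^ 3 * x powr (1 - \<delta>2))" by blast
  thus ?thesis unfolding square_error_def prime_error_def by (intro exI[of _ "32::real"] conjI) simp_all
qed

end
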